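(* Let $t\in\mathbb{C}\setminus\{0,1\}$, let $\theta_0,\theta_1,\theta_t,\theta_\infty\in\mathbb{C}$, and set $\kappa_1=(\theta_\infty-\theta_0-\theta_1-\theta_t)/2$, $\kappa_2=-(\theta_\infty+\theta_0+\theta_1+\theta_t)/2$. Let $\lambda\in\mathbb{C}\setminus\{0,1,t\}$, $\mu\in\mathbb{C}$, $k\in\mathbb{C}\setminus\{0\}$, and put $$\tilde\lambda=\lambda-\frac{\kappa_2}{\mu-\frac{\theta_0}{\lambda}-\frac{\theta_1}{\lambda-1}-\frac{\theta_t}{\lambda-t}},\qquad \tilde\mu=\frac{\kappa_2+\theta_0}{\tilde\lambda}+\frac{\kappa_2+\theta_1}{\tilde\lambda-1}+\frac{\kappa_2+\theta_t}{\tilde\lambda-t}+\frac{\kappa_2}{\lambda-\tilde\lambda},$$ where the parameters are such that all these expressions and those below are defined (i.e. $\kappa_1\neq0$, $\kappa_2\ne 0$, $\theta_\infty\neq 0$, $\mu-\frac{\theta_0}{\lambda}-\frac{\theta_1}{\lambda-1}-\frac{\theta_t}{\lambda-t}\neq 0$, $\tilde\lambda\notin\{0,1,t\}$). If $y_1(z)$ is a solution to the Fuchsian equation $D_{y_1}(\theta_0,\theta_1,\theta_t,\theta_\infty;\lambda,\mu)$, then for each $p\in\{0,1,t,\infty\}$ the function $\tilde Y={}^t(\tilde y_1(z),\tilde y_2(z))$ defined by $$\tilde y_1(z)=\int_{[\gamma_z,\gamma_p]}\frac{dy_1(w)}{dw}(z-w)^{\kappa_2}\,dw,$$ $$\tilde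 y_2(z)=\frac{\kappa_2\lambda(\lambda-1)(\lambda-t)}{k(\lambda-\tilde\lambda)}\int_{[\gamma_z,\gamma_p]}\left\{\left(\frac{dy_1(w)}{dw}-\mu y_1(w)\right)\frac{1}{\lambda-w}+\frac{\mu}{\kappa_1}\frac{dy_1(w)}{dw}\right\}(z-w)^{\kappa_2}\,dw$$ satisfies the Fuchsian system $D_Y(\kappa_2+\theta_0,\kappa_2+\theta_1,\kappa_2+\theta_t,\kappa_2+\theta_\infty;\tilde\lambda,\tilde\mu;k)$.
   Context: Contours. For $z\in\mathbb{C}\setminus\{0,1,t\}$, fix a base point $o\in\mathbb{C}\setminus\{0,1,t,z\}$. $\gamma_p$ denotes a loop in $\mathbb{C}\setminus\{0,1,t,z\}$ based at $o$ turning once anti-clockwise around $w=p$ (for $p=\infty$: a loop turning once around $\infty$ on the Riemann sphere), and $[\gamma_z,\gamma_p]=\gamma_z\gamma_p\gamma_z^{-1}\gamma_p^{-1}$ is the Pochhammer contour; integrands are analytically continued along the contour. (The point $w=\lambda$ is a non-logarithmic apparent singularity of $D_{y_1}$ with exponents $0,2$, so solutions $y_1$ are holomorphic there and satisfy $y_1'(\lambda)=\mu y_1(\lambda)$.) The equation $D_{y_1}$. With $\kappa_1=(\theta_\infty-\theta_0-\theta_1-\theta_t)/2$, $\kappa_2=-(\theta_\infty+\theta_0+\theta_1+\theta_t)/2$, $D_{y_1}(\theta_0,\theta_1,\theta_t,\theta_\infty;\lambda,\mu)$ is $$\frac{d^2y_1}{dz^2}+\left(\frac{1-\theta_0}{z}+\frac{1-\theta_1}{z-1}+\frac{1-\theta_t}{z-t}-\frac1{z-\lambda}\right)\frac{dy_1}{dz}+\left(\frac{\kappa_1(\kappa_2+1)}{z(z-1)}+\frac{\lambda(\lambda-1)\mu}{z(z-1)(z-\lambda)}-\frac{t(t-1)H}{z(z-1)(z-t)}\right)y_1=0,$$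 $$H=\frac{1}{t(t-1)}\big[\lambda(\lambda-1)(\lambda-t)\mu^2-\{\theta_0(\lambda-1)(\lambda-t)+\theta_1\lambda(\lambda-t)+(\theta_t-1)\lambda(\lambda-1)\}\mu+\kappa_1(\kappa_2+1)(\lambda-t)\big].$$ The system $D_Y$. For $\theta_\infty\ne0$, $k\neq0$, $\lambda\notin\{0,1,t\}$, $D_Y(\theta_0,\theta_1,\theta_t,\theta_\infty;\lambda,\mu;k)$ is the system $\frac{dY}{dz}=\left(\frac{A_0}{z}+\frac{A_1}{z-1}+\frac{A_t}{z-t}\right)Y$, $Y={}^t(y_1,y_2)$, with $$A_i=\begin{pmatrix}u_i+\theta_i&-w_i\\ u_i(u_i+\theta_i)/w_i&-u_i\end{pmatrix}\ (i=0,1,t),\qquad w_0=\frac{k\lambda}{t},\quad w_1=-\frac{k(\lambda-1)}{t-1},\quad w_t=\frac{k(\lambda-t)}{t(t-1)},$$ $$u_0=-\theta_0+\frac{\lambda}{t\theta_\infty}\big[\lambda(\lambda-1)(\lambda-t)\mu^2+\{2\kappa_1(\lambda-1)(\lambda-t)-\theta_1(\lambda-t)-t\theta_t(\lambda-1)\}\mu+\kappa_1\{\kappa_1(\lambda-t-1)-\theta_1-t\theta_t\}\big],$$ $$u_1=-\theta_1-\frac{\lambda-1}{(t-1)\theta_\infty}\big[\lambda(\lambda-1)(\lambda-t)\mu^2+\{2\kappa_1(\lambda-1)(\lambda-t)+(\theta_\infty-\theta_1)(\lambda-t)-t\theta_t(\lambda-1)\}\mu+\kappa_1\{\kappa_1(\lambda-t+1)+\theta_0-(t-1)\theta_t\}\big],$$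 $$u_t=-\theta_t+\frac{\lambda-t}{t(t-1)\theta_\infty}\big[\lambda(\lambda-1)(\lambda-t)\mu^2+\{2\kappa_1(\lambda-1)(\lambda-t)-\theta_1(\lambda-t)+t(\theta_\infty-\theta_t)(\lambda-1)\}\mu+\kappa_1\{\kappa_1(\lambda-t+1)+\theta_0+(t-1)(\theta_\infty-\theta_t)\}\big].$$ These are the unique values for which $-(A_0+A_1+A_t)=\mathrm{diag}(\kappa_1,\kappa_2)$, the $(1,2)$ entry of the coefficient matrix is $k(z-\lambda)/(z(z-1)(z-t))$, and its $(1,1)$ entry at $z=\lambda$ equals $\mu$. Eliminating $y_2$ from $D_Y$ gives $D_{y_1}$ for $y_1$. In $D_Y(\kappa_2+\theta_0,\kappa_2+\theta_1,\kappa_2+\theta_t,\kappa_2+\theta_\infty;\tilde\lambda,\tilde\mu;k)$ the quantities $\kappa_1,\kappa_2$ are replaced by those computed from the new parameters. *)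

theory Defs
  imports "HOL-Complex_Analysis.Complex_Analysis"
begin

section \<open>Analytic continuation along a path\<close>

text \<open>
  A family of function elements \<open>F s\<close>, each holomorphic near \<open>\<gamma> s\<close>, such that the germs of
  \<open>F s'\<close> and \<open>F s\<close> at \<open>\<gamma> s'\<close> coincide for \<open>s'\<close> near \<open>s\<close>.
  The initial condition only refers to a punctured neighbourhood of \<open>\<gamma> 0\<close>, so that an expression
  \<open>f\<close> with a removable singularity at \<open>\<gamma> 0\<close> (where HOL's division by zero gives a
  meaningless value) is continued as its holomorphic extension.
\<close>

definition analytic_continuation_along ::
    "(real \<Rightarrow> complex) \<Rightarrow> (complex \<Rightarrow> complex) \<Rightarrow> (real \<Rightarrow> complex \<Rightarrow> complex) \<Rightarrow> bool" where
  "analytic_continuation_along \<gamma> f F \<longleftrightarrow>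
     (\<forall>s\<in>{0..1}. F s analytic_on {\<gamma> s}) \<and>
     (\<forall>\<^sub>F w in at (\<gamma> 0). F 0 w = f w) \<and>
     (\<forall>s\<in>{0..1}. \<forall>\<^sub>F s' in at s within {0..1}. \<forall>\<^sub>F w in nhds (\<gamma> s'). F s' w = F s w)"

text \<open>
  The integral along \<open>\<gamma>\<close> of the analytic continuation of the function element \<open>f\<close> given near
  the starting point. Continuations are unique as germs, so the value does not depend on \<open>F\<close>.
\<close>

definition continued_contour_integral ::
    "(real \<Rightarrow> complex) \<Rightarrow> (complex \<Rightarrow> complex) \<Rightarrow> complex" where
  "continued_contour_integral \<gamma> f =
     (THE I. \<exists>F. analytic_continuation_along \<gamma> f F \<and>
        ((\<lambda>s. F s (\<gamma> s) * vector_derivative \<gamma> (at s within {0..1})) has_integral I) {0..1})"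


section \<open>Loops and the Pochhammer contour\<close>

text \<open>
  \<open>\<gamma>\<close> is homotopic in \<open>S\<close>, with fixed end points, to: a path from \<open>b\<close> to a small circle around
  \<open>p\<close>, the circle traversed once anti-clockwise, and the same path back.
\<close>

definition turns_once_around ::
    "complex set \<Rightarrow> complex \<Rightarrow> complex \<Rightarrow> (real \<Rightarrow> complex) \<Rightarrow> bool" where
  "turns_once_around S b p \<gamma> \<longleftrightarrow>
     (\<exists>r>0. \<exists>\<delta>. cball p r - {p} \<subseteq> S \<and>
        path \<delta> \<and> path_image \<delta> \<subseteq> S \<and> pathstart \<delta> = b \<and> pathfinish \<delta> = p + of_real r \<and>
        homotopic_paths S \<gamma> (\<delta> +++ circlepath p r +++ reversepath \<delta>))"

text \<open>
  Likewise for the point at infinity, with a large circle. Both orientations are admitted.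
\<close>

definition turns_once_around_infinity ::
    "complex set \<Rightarrow> complex \<Rightarrow> (real \<Rightarrow> complex) \<Rightarrow> bool" where
  "turns_once_around_infinity S b \<gamma> \<longleftrightarrow>
     (\<exists>R>0. \<exists>\<delta>. - ball 0 R \<subseteq> S \<and>
        path \<delta> \<and> path_image \<delta> \<subseteq> S \<and> pathstart \<delta> = b \<and> pathfinish \<delta> = of_real R \<and>
        (homotopic_paths S \<gamma> (\<delta> +++ circlepath 0 R +++ reversepath \<delta>) \<or>
         homotopic_paths S \<gamma> (\<delta> +++ reversepath (circlepath 0 R) +++ reversepath \<delta>)))"

definition pochhammer_contour ::
    "(real \<Rightarrow> complex) \<Rightarrow> (real \<Rightarrow> complex) \<Rightarrow> real \<Rightarrow> complex" where
  "pochhammer_contour \<gamma> \<gamma>' = \<gamma> +++ \<gamma>' +++ reversepath \<gamma> +++ reversepath \<gamma>'"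


section \<open>The scalar equation\<close>

definition kappa1 :: "complex \<Rightarrow> complex \<Rightarrow> complex \<Rightarrow> complex \<Rightarrow> complex" where
  "kappa1 \<theta>0 \<theta>1 \<theta>t \<theta>inf = (\<theta>inf - \<theta>0 - \<theta>1 - \<theta>t) / 2"

definition kappa2 :: "complex \<Rightarrow> complex \<Rightarrow> complex \<Rightarrow> complex \<Rightarrow> complex" where
  "kappa2 \<theta>0 \<theta>1 \<theta>t \<theta>inf = - (\<theta>inf + \<theta>0 + \<theta>1 + \<theta>t) / 2"

definition Dy1_H ::
    "complex \<Rightarrow> complex \<Rightarrow> complex \<Rightarrow> complex \<Rightarrow> complex \<Rightarrow> complex \<Rightarrow> complex \<Rightarrow> complex" where
  "Dy1_H t \<theta>0 \<theta>1 \<theta>t \<theta>inf lam \<mu> =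
     (let \<kappa>1 = kappa1 \<theta>0 \<theta>1 \<theta>t \<theta>inf; \<kappa>2 = kappa2 \<theta>0 \<theta>1 \<theta>t \<theta>inf in
      1 / (t * (t - 1)) *
      (lam * (lam - 1) * (lam - t) * \<mu>\<^sup>2
       - (\<theta>0 * (lam - 1) * (lam - t) + \<theta>1 * lam * (lam - t) + (\<theta>t - 1) * lam * (lam - 1)) * \<mu>
       + \<kappa>1 * (\<kappa>2 + 1) * (lam - t)))"

text \<open>
  Solutions of \<open>D\<^sub>y\<^sub>1\<close> on an open set \<open>V\<close>. The point \<open>lam\<close> is an apparent singularity
  with exponents 0 and 2: a solution is holomorphic there, although the coefficients have poles.
\<close>

definition solves_Dy1_on ::
    "complex \<Rightarrow> complex \<Rightarrow> complex \<Rightarrow> complex \<Rightarrow> complex \<Rightarrow> complex \<Rightarrow> complex \<Rightarrow>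
     (complex \<Rightarrow> complex) \<Rightarrow> complex set \<Rightarrow> bool" where
  "solves_Dy1_on t \<theta>0 \<theta>1 \<theta>t \<theta>inf lam \<mu> y V \<longleftrightarrow>
     (let \<kappa>1 = kappa1 \<theta>0 \<theta>1 \<theta>t \<theta>inf; \<kappa>2 = kappa2 \<theta>0 \<theta>1 \<theta>t \<theta>inf;
          H = Dy1_H t \<theta>0 \<theta>1 \<theta>t \<theta>inf lam \<mu> in
      y holomorphic_on V \<and>
      (\<forall>z\<in>V - {0, 1, t, lam}.
         deriv (deriv y) z
         + ((1 - \<theta>0) / z + (1 - \<theta>1) / (z - 1) + (1 - \<theta>t) / (z - t) - 1 / (z - lam)) * deriv y z
         + (\<kappa>1 * (\<kappa>2 + 1) / (z * (z - 1))
            + lam * (lam - 1) * \<mu> / (z * (z - 1) * (z - lam))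
            - t * (t - 1) * H / (z * (z - 1) * (z - t))) * y z = 0))"


section \<open>The first-order system\<close>

definition DY_w0 :: "complex \<Rightarrow> complex \<Rightarrow> complex \<Rightarrow> complex" where
  "DY_w0 t lam k = k * lam / t"

definition DY_w1 :: "complex \<Rightarrow> complex \<Rightarrow> complex \<Rightarrow> complex" where
  "DY_w1 t lam k = - (k * (lam - 1) / (t - 1))"

definition DY_wt :: "complex \<Rightarrow> complex \<Rightarrow> complex \<Rightarrow> complex" where
  "DY_wt t lam k = k * (lam - t) / (t * (t - 1))"

definition DY_u0 ::
    "complex \<Rightarrow> complex \<Rightarrow> complex \<Rightarrow> complex \<Rightarrow> complex \<Rightarrow> complex \<Rightarrow> complex \<Rightarrow> complex" where
  "DY_u0 t \<theta>0 \<theta>1 \<theta>t \<theta>inf lam \<mu> =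
     (let \<kappa>1 = kappa1 \<theta>0 \<theta>1 \<theta>t \<theta>inf in
      - \<theta>0 + lam / (t * \<theta>inf) *
      (lam * (lam - 1) * (lam - t) * \<mu>\<^sup>2
       + (2 * \<kappa>1 * (lam - 1) * (lam - t) - \<theta>1 * (lam - t) - t * \<theta>t * (lam - 1)) * \<mu>
       + \<kappa>1 * (\<kappa>1 * (lam - t - 1) - \<theta>1 - t * \<theta>t)))"

definition DY_u1 ::
    "complex \<Rightarrow> complex \<Rightarrow> complex \<Rightarrow> complex \<Rightarrow> complex \<Rightarrow> complex \<Rightarrow> complex \<Rightarrow> complex" where
  "DY_u1 t \<theta>0 \<theta>1 \<theta>t \<theta>inf lam \<mu> =
     (let \<kappa>1 = kappa1 \<theta>0 \<theta>1 \<theta>t \<theta>inf in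
      - \<theta>1 - (lam - 1) / ((t - 1) * \<theta>inf) *
      (lam * (lam - 1) * (lam - t) * \<mu>\<^sup>2
       + (2 * \<kappa>1 * (lam - 1) * (lam - t) + (\<theta>inf - \<theta>1) * (lam - t) - t * \<theta>t * (lam - 1)) * \<mu>
       + \<kappa>1 * (\<kappa>1 * (lam - t + 1) + \<theta>0 - (t - 1) * \<theta>t)))"

definition DY_ut ::
    "complex \<Rightarrow> complex \<Rightarrow> complex \<Rightarrow> complex \<Rightarrow> complex \<Rightarrow> complex \<Rightarrow> complex \<Rightarrow> complex" where
  "DY_ut t \<theta>0 \<theta>1 \<theta>t \<theta>inf lam \<mu> =
     (let \<kappa>1 = kappa1 \<theta>0 \<theta>1 \<theta>t \<theta>inf in
      - \<theta>t + (lam - t) / (t * (t - 1) * \<theta>inf) *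
      (lam * (lam - 1) * (lam - t) * \<mu>\<^sup>2
       + (2 * \<kappa>1 * (lam - 1) * (lam - t) - \<theta>1 * (lam - t) + t * (\<theta>inf - \<theta>t) * (lam - 1)) * \<mu>
       + \<kappa>1 * (\<kappa>1 * (lam - t + 1) + \<theta>0 + (t - 1) * (\<theta>inf - \<theta>t))))"

definition DY_residue :: "complex \<Rightarrow> complex \<Rightarrow> complex \<Rightarrow> complex^2^2" where
  "DY_residue \<theta> u w = vector [vector [u + \<theta>, - w], vector [u * (u + \<theta>) / w, - u]]"

definition DY_matrix ::
    "complex \<Rightarrow> complex \<Rightarrow> complex \<Rightarrow> complex \<Rightarrow> complex \<Rightarrow> complex \<Rightarrow> complex \<Rightarrow> complex \<Rightarrow>
     complex \<Rightarrow> complex^2^2" where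
  "DY_matrix t \<theta>0 \<theta>1 \<theta>t \<theta>inf lam \<mu> k z =
     (let A0 = DY_residue \<theta>0 (DY_u0 t \<theta>0 \<theta>1 \<theta>t \<theta>inf lam \<mu>) (DY_w0 t lam k);
          A1 = DY_residue \<theta>1 (DY_u1 t \<theta>0 \<theta>1 \<theta>t \<theta>inf lam \<mu>) (DY_w1 t lam k);
          At = DY_residue \<theta>t (DY_ut t \<theta>0 \<theta>1 \<theta>t \<theta>inf lam \<mu>) (DY_wt t lam k)
      in \<chi> i j. A0 $ i $ j / z + A1 $ i $ j / (z - 1) + At $ i $ j / (z - t))"

definition satisfies_DY_at ::
    "complex \<Rightarrow> complex \<Rightarrow> complex \<Rightarrow> complex \<Rightarrow> complex \<Rightarrow> complex \<Rightarrow> complex \<Rightarrow> complex \<Rightarrow>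
     (complex \<Rightarrow> complex^2) \<Rightarrow> complex \<Rightarrow> bool" where
  "satisfies_DY_at t \<theta>0 \<theta>1 \<theta>t \<theta>inf lam \<mu> k Y z \<longleftrightarrow>
     (\<forall>i. ((\<lambda>x. Y x $ i) has_field_derivative
            (DY_matrix t \<theta>0 \<theta>1 \<theta>t \<theta>inf lam \<mu> k z *v Y z) $ i) (at z))"


section \<open>The transformed parameters and the integral transformation\<close>

definition lam_tilde ::
    "complex \<Rightarrow> complex \<Rightarrow> complex \<Rightarrow> complex \<Rightarrow> complex \<Rightarrow> complex \<Rightarrow> complex \<Rightarrow> complex" where
  "lam_tilde t \<theta>0 \<theta>1 \<theta>t \<theta>inf lam \<mu> =
     lam - kappa2 \<theta>0 \<theta>1 \<theta>t \<theta>inf / (\<mu> - \<theta>0 / lam - \<theta>1 / (lam - 1) - \<theta>t / (lam - t))"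

definition mu_tilde ::
    "complex \<Rightarrow> complex \<Rightarrow> complex \<Rightarrow> complex \<Rightarrow> complex \<Rightarrow> complex \<Rightarrow> complex \<Rightarrow> complex" where
  "mu_tilde t \<theta>0 \<theta>1 \<theta>t \<theta>inf lam \<mu> =
     (let \<kappa>2 = kappa2 \<theta>0 \<theta>1 \<theta>t \<theta>inf; lam' = lam_tilde t \<theta>0 \<theta>1 \<theta>t \<theta>inf lam \<mu> in
      (\<kappa>2 + \<theta>0) / lam' + (\<kappa>2 + \<theta>1) / (lam' - 1) + (\<kappa>2 + \<theta>t) / (lam' - t)
      + \<kappa>2 / (lam - lam'))"

text \<open>
  The transforms of the function element \<open>y\<close> along a fixed contour \<open>\<Gamma>\<close>. The argument \<open>lg\<close> is
  the branch of the logarithm used for \<open>(z - w)\<^sup>\<kappa> = exp (\<kappa> lg (z - w))\<close> at the starting point of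
  \<open>\<Gamma>\<close>; from there the integrand is continued along \<open>\<Gamma>\<close>.
\<close>

definition y1_tilde ::
    "complex \<Rightarrow> (real \<Rightarrow> complex) \<Rightarrow> (complex \<Rightarrow> complex) \<Rightarrow> (complex \<Rightarrow> complex) \<Rightarrow>
     complex \<Rightarrow> complex" where
  "y1_tilde \<kappa>2 \<Gamma> lg y z =
     continued_contour_integral \<Gamma> (\<lambda>w. deriv y w * exp (\<kappa>2 * lg (z - w)))"

definition y2_tilde ::
    "complex \<Rightarrow> complex \<Rightarrow> complex \<Rightarrow> complex \<Rightarrow> complex \<Rightarrow> complex \<Rightarrow> complex \<Rightarrow>
     (real \<Rightarrow> complex) \<Rightarrow> (complex \<Rightarrow> complex) \<Rightarrow> (complex \<Rightarrow> complex) \<Rightarrow> complex \<Rightarrow> complex" where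
  "y2_tilde t \<kappa>1 \<kappa>2 lam lam' \<mu> k \<Gamma> lg y z =
     \<kappa>2 * lam * (lam - 1) * (lam - t) / (k * (lam - lam')) *
     continued_contour_integral \<Gamma>
       (\<lambda>w. ((deriv y w - \<mu> * y w) * (1 / (lam - w)) + \<mu> / \<kappa>1 * deriv y w)
            * exp (\<kappa>2 * lg (z - w)))"

end

theory Submission
  imports Defs
begin

text \<open>
  Put \<open>v = (y' - \<mu> y) / (w - lam)\<close>. Since \<open>lam\<close> is an apparent singularity, \<open>(y, v)\<close> solves a linear
  system whose only finite singularities are \<open>0, 1, t\<close>. The loop \<open>\<gamma>\<^sub>z\<close> is contractible away from
  \<open>0, 1, t\<close>, hence so is the commutator \<open>[\<gamma>\<^sub>z, \<gamma>\<^sub>p]\<close>, and the commutator has winding number 0 about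
  \<open>z\<close>. So both \<open>(y, v)\<close> and \<open>(z - w)\<^sup>\<kappa>\<close> can be continued along it and return to their initial values, and
  total derivatives integrate to 0. With \<open>X\<close> and \<open>Z\<close> the transforms of \<open>y'\<close> and \<open>v\<close>, and \<open>Q = z (z - 1) (z - t)\<close>, two such
  total derivatives suffice: \<open>(y (z - w)\<^sup>\<kappa>)'\<close> gives \<open>X' = \<mu> X + (z - lam) Z' - \<kappa> Z\<close>, and
  \<open>((A y - Q v) (z - w)\<^sup>\<kappa>)'\<close> with a polynomial \<open>A\<close> gives \<open>Q Z' = m\<^sub>2\<^sub>1 X + m\<^sub>2\<^sub>2 Z\<close>. A constant change
  of basis turns this system for \<open>(X, Z)\<close> into \<open>D\<^sub>Y\<close> at the new parameters.
\<close>

section \<open>Linear systems on a disc\<close>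

text \<open>With 0, 1, t and z all removed the contour is in general not contractible. Each factor
  of the integrand is therefore continued in its own larger domain, and only products of compatible
  elements are integrated. The loops may pass through \<open>lam\<close> and may even start there;
  hence the pair of the overview, whose system has no pole at \<open>lam\<close>. Uniform radii and
  steps of the continuations reduce every integral to finitely many straight segments.

  The primitive is shaped by the pole of \<kappa> / (z - w): the factor w - z of \<open>A\<close>
  removes it from the y term, and Q w leaves it on the v term with the constant factor Q z, while Q
  also clears the poles at 0, 1, t. The rest of \<open>A\<close> makes the remaining coefficients of
  y' and v independent of w.

  In the matrix so obtained the upper right entry is linear, and its zero is the new apparent
  singularity. At a zero of Q the first row is z - lam times the second, so the determinant
  vanishes, as for the residues of the target system; it remains to match one diagonal entry, the
  trace and the upper right entry. The constant \<mu> / \<kappa>1 in the second transform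
  diagonalises the residue at infinity.\<close>

locale linear_system =
  fixes S :: "complex set" and a b c d :: "complex \<Rightarrow> complex"
  assumes open_S: "open S"
    and holomorphic_coeffs: "a holomorphic_on S" "b holomorphic_on S" "c holomorphic_on S" "d holomorphic_on S"
begin

definition solves :: "complex set \<Rightarrow> (complex \<Rightarrow> complex) \<Rightarrow> (complex \<Rightarrow> complex) \<Rightarrow> bool" where
  "solves U f g \<longleftrightarrow> (\<forall>w\<in>U.
     (f has_field_derivative a w * f w + b w * g w) (at w) \<and>
     (g has_field_derivative c w * f w + d w * g w) (at w))"

lemma solves_subset: "solves U f g \<Longrightarrow> V \<subseteq> U \<Longrightarrow> solves V f g"
  by (auto simp: solves_def)

lemma solves_diff:
  assumes "solves U f g" "solves U f' g'"
  shows "solves U (\<lambda>w. f w - f' w) (\<lambda>w. g w - g' w)"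
  unfolding solves_def
proof (intro ballI conjI)
  fix w assume "w \<in> U"
  then have D: "(f has_field_derivative a w * f w + b w * g w) (at w)"
      "(g has_field_derivative c w * f w + d w * g w) (at w)"
      "(f' has_field_derivative a w * f' w + b w * g' w) (at w)"
      "(g' has_field_derivative c w * f' w + d w * g' w) (at w)"
    using assms by (auto simp: solves_def)
  show "((\<lambda>w. f w - f' w) has_field_derivative a w * (f w - f' w) + b w * (g w - g' w)) (at w)"
    by (rule DERIV_cong[OF DERIV_diff[OF D(1) D(3)]]) (simp add: algebra_simps)
  show "((\<lambda>w. g w - g' w) has_field_derivative c w * (f w - f' w) + d w * (g w - g' w)) (at w)"
    by (rule DERIV_cong[OF DERIV_diff[OF D(2) D(4)]]) (simp add: algebra_simps)
qed

lemma solves_imp_holomorphic: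
  assumes "solves U f g" "open U"
  shows "f holomorphic_on U" "g holomorphic_on U"
  using assms by (auto simp: solves_def holomorphic_on_open)

lemma coeffs_bounded_on_compact:
  assumes "compact K" "K \<subseteq> S"
  obtains M where "M > 0" "\<And>w. w \<in> K \<Longrightarrow> norm (a w) \<le> M \<and> norm (b w) \<le> M \<and> norm (c w) \<le> M \<and> norm (d w) \<le> M"
proof -
  have ex: "\<exists>M>0. \<forall>w\<in>K. norm (h w) \<le> M" if "h holomorphic_on S" for h :: "complex \<Rightarrow> complex"
  proof -
    have "continuous_on K h"
      using that assms(2) continuous_on_subset holomorphic_on_imp_continuous_on by blast
    then have "bounded (h ` K)"
      using assms(1) compact_continuous_image compact_imp_bounded by blast
    then show ?thesis unfolding bounded_pos by auto
  qed
  obtain Ma where Ma: "Ma > 0" "\<forall>w\<in>K. norm (a w) \<le> Ma" using ex[OF holomorphic_coeffs(1)] by auto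
  obtain Mb where Mb: "Mb > 0" "\<forall>w\<in>K. norm (b w) \<le> Mb" using ex[OF holomorphic_coeffs(2)] by auto
  obtain Mc where Mc: "Mc > 0" "\<forall>w\<in>K. norm (c w) \<le> Mc" using ex[OF holomorphic_coeffs(3)] by auto
  obtain Md where Md: "Md > 0" "\<forall>w\<in>K. norm (d w) \<le> Md" using ex[OF holomorphic_coeffs(4)] by auto
  show ?thesis
  proof (rule that[of "Ma + Mb + Mc + Md"])
    fix w assume w: "w \<in> K"
    have "norm (a w) \<le> Ma" "norm (b w) \<le> Mb" "norm (c w) \<le> Mc" "norm (d w) \<le> Md"
      using Ma(2) Mb(2) Mc(2) Md(2) w by auto
    then show "norm (a w) \<le> Ma + Mb + Mc + Md \<and> norm (b w) \<le> Ma + Mb + Mc + Md \<and>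
        norm (c w) \<le> Ma + Mb + Mc + Md \<and> norm (d w) \<le> Ma + Mb + Mc + Md"
      using Ma(1) Mb(1) Mc(1) Md(1) by linarith
  qed (use Ma(1) Mb(1) Mc(1) Md(1) in linarith)
qed

text \<open>
  On a disc so small that integrating the system halves the supremum norm, a solution that
  vanishes at the centre vanishes identically; the identity theorem does the rest.
\<close>
lemma solves_zero:
  assumes U: "open U" "connected U" "U \<subseteq> S" and p: "p \<in> U"
    and sol: "solves U f g" and zero: "f p = 0" "g p = 0" and w: "w \<in> U"
  shows "f w = 0" "g w = 0"
proof -
  obtain r0 where r0: "r0 > 0" "cball p r0 \<subseteq> U"
    using U(1) p open_contains_cball by blast
  obtain M where M: "M > 0" "\<And>w. w \<in> cball p r0 \<Longrightarrow> norm (a w) \<le> M \<and> norm (b w) \<le> M \<and> norm (c w) \<le> M \<and> norm (d w) \<le> M"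
    using coeffs_bounded_on_compact[of "cball p r0"] r0 U(3) by (metis compact_cball subset_trans)
  define r where "r = min r0 (1 / (4 * M))"
  have r: "r > 0" "r \<le> r0" "4 * M * r \<le> 1"
    using r0 M by (auto simp: r_def min_def field_simps)
  define m where "m = (\<lambda>w. max (norm (f w)) (norm (g w)))"
  have m_nonneg: "m w \<ge> 0" for w by (auto simp: m_def le_max_iff_disj)
  note hol = solves_imp_holomorphic[OF sol U(1)]
  have sub: "cball p r \<subseteq> U" using r0 r(2) by (meson order_trans subset_cball)
  have "continuous_on (cball p r) m"
    unfolding m_def using hol sub
    by (intro continuous_intros; meson continuous_on_subset holomorphic_on_imp_continuous_on)
  then obtain w0 where w0: "w0 \<in> cball p r" "\<And>w. w \<in> cball p r \<Longrightarrow> m w \<le> m w0"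
    using continuous_attains_sup[of "cball p r" m] r(1) by auto
  have bd: "norm (h w0) \<le> m w0 / 2"
    if h: "h p = 0" "\<And>w. w \<in> cball p r \<Longrightarrow> (h has_field_derivative \<alpha> w * f w + \<beta> w * g w) (at w)"
      and ab: "\<And>w. w \<in> cball p r \<Longrightarrow> norm (\<alpha> w) \<le> M \<and> norm (\<beta> w) \<le> M" for h \<alpha> \<beta>
  proof -
    have "norm (h w0 - h p) \<le> (2 * M * m w0) * norm (w0 - p)"
    proof (rule field_differentiable_bound[of "cball p r"])
      show "(h has_field_derivative \<alpha> z * f z + \<beta> z * g z) (at z within cball p r)" if "z \<in> cball p r" for z
        using h(2)[OF that] has_field_derivative_at_within by blast
      show "norm (\<alpha> z * f z + \<beta> z * g z) \<le> 2 * M * m w0" if z: "z \<in> cball p r" for z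
      proof -
        have "norm (f z) \<le> m w0" "norm (g z) \<le> m w0" using w0(2)[OF z] by (auto simp: m_def)
        then have "norm (\<alpha> z * f z) \<le> M * m w0" "norm (\<beta> z * g z) \<le> M * m w0"
          using ab[OF z] M(1) by (auto simp: norm_mult intro!: mult_mono)
        then show ?thesis using norm_triangle_ineq[of "\<alpha> z * f z" "\<beta> z * g z"] by linarith
      qed
    qed (use w0 r in auto)
    also have "\<dots> \<le> (2 * M * m w0) * r"
      using w0(1) M(1) by (intro mult_left_mono mult_nonneg_nonneg)
        (auto simp: dist_norm norm_minus_commute m_nonneg)
    also have "\<dots> = (4 * M * r) * (m w0 / 2)" by simp
    also have "\<dots> \<le> 1 * (m w0 / 2)" using r(3) by (intro mult_right_mono) (auto simp: m_nonneg)
    finally show ?thesis using h(1) by simp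
  qed
  have sub0: "z \<in> cball p r0" "z \<in> U" if "z \<in> cball p r" for z
    using that r(2) sub by auto
  have "norm (f w0) \<le> m w0 / 2"
    by (rule bd[of f a b]) (use sol zero M(2) sub0 in \<open>auto simp: solves_def\<close>)
  moreover have "norm (g w0) \<le> m w0 / 2"
    by (rule bd[of g c d]) (use sol zero M(2) sub0 in \<open>auto simp: solves_def\<close>)
  ultimately have "m w0 \<le> m w0 / 2" by (subst m_def) simp
  then have "m w0 \<le> 0" by simp
  then have z: "f z = 0 \<and> g z = 0" if "z \<in> cball p r" for z
    using w0(2)[OF that] by (auto simp: m_def)
  have "h w = 0" if "h holomorphic_on U" "\<And>z. z \<in> cball p r \<Longrightarrow> h z = 0" for h
  proof (rule analytic_continuation[OF that(1) U(1,2) sub p])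
    show "p islimpt cball p r"
      by (rule islimpt_subset[OF _ ball_subset_cball]) (use r(1) in \<open>simp add: islimpt_ball\<close>)
  qed (use that w in auto)
  then show "f w = 0" "g w = 0" using z hol by auto
qed

text \<open>Discs are convex, so their intersection is connected and a single common value there
  decides the whole overlap. The compatibility of neighbouring function elements rests on
  this.\<close>

lemma solves_unique:
  assumes "ball p R \<subseteq> S" "ball p' R' \<subseteq> S"
    and "solves (ball p R) f g" "solves (ball p' R') f' g'"
    and "x \<in> ball p R \<inter> ball p' R'" "f x = f' x" "g x = g' x" "w \<in> ball p R \<inter> ball p' R'"
  shows "f w = f' w" "g w = g' w"
proof -
  let ?U = "ball p R \<inter> ball p' R'"
  have "solves ?U (\<lambda>w. f w - f' w) (\<lambda>w. g w - g' w)"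
    using assms by (intro solves_diff) (auto intro: solves_subset)
  moreover have "connected ?U" by (intro convex_connected convex_Int convex_ball)
  ultimately have "f w - f' w = 0" "g w - g' w = 0"
    using solves_zero[of ?U x "\<lambda>w. f w - f' w" "\<lambda>w. g w - g' w" w] assms by auto
  then show "f w = f' w" "g w = g' w" by auto
qed

lemma geometric_increments_uniform_limit:
  fixes f :: "nat \<Rightarrow> 'a \<Rightarrow> complex"
  assumes "\<And>n z. z \<in> B \<Longrightarrow> norm (f (Suc n) z - f n z) \<le> C / 2 ^ n"
  obtains l where "uniform_limit B f l sequentially"
proof -
  have "uniform_limit B (\<lambda>n z. \<Sum>i<n. f (Suc i) z - f i z) (\<lambda>z. suminf (\<lambda>i. f (Suc i) z - f i z)) sequentially"
  proof (rule Weierstrass_m_test)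
    show "summable (\<lambda>n. C / 2 ^ n)"
      using summable_mult[OF summable_geometric[of "1/2 :: real"], of C] by (simp add: power_divide)
  qed (use assms in auto)
  then have "uniform_limit B (\<lambda>n z. f 0 z + (\<Sum>i<n. f (Suc i) z - f i z)) (\<lambda>z. f 0 z + suminf (\<lambda>i. f (Suc i) z - f i z)) sequentially"
    by (intro uniform_limit_intros)
  moreover have "f 0 z + (\<Sum>i<n. f (Suc i) z - f i z) = f n z" for n z
    using sum_lessThan_telescope[of "\<lambda>i. f i z" n] by simp
  ultimately show ?thesis using that by simp
qed

text \<open>Picard iteration, carried out with complex primitives on the disc. Both terms of the
  right-hand side are at most \<open>M\<close> times the supremum, so
  \<open>4 * M * R \<le> 1\<close> halves the increments at each step and the iterates converge
  uniformly without shrinking the disc.\<close>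

lemma solution_exists:
  assumes R: "R > 0" "ball p R \<subseteq> S" "4 * M * R \<le> 1" "M > 0"
    and M: "\<And>w. w \<in> ball p R \<Longrightarrow> norm (a w) \<le> M \<and> norm (b w) \<le> M \<and> norm (c w) \<le> M \<and> norm (d w) \<le> M"
  shows "\<exists>f g. solves (ball p R) f g \<and> f p = u \<and> g p = v"
proof -
  let ?B = "ball p R"
  note hc = holomorphic_coeffs[THEN holomorphic_on_subset[OF _ R(2)]]
  have prim: "\<exists>k. k p = x \<and> (\<forall>w\<in>?B. (k has_field_derivative h w) (at w))" if h: "h holomorphic_on ?B" for h x
  proof -
    obtain k where k: "\<And>w. w \<in> ?B \<Longrightarrow> (k has_field_derivative h w) (at w within ?B)"
      using holomorphic_convex_primitive'[of ?B h] h by auto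
    then have "\<And>w. w \<in> ?B \<Longrightarrow> ((\<lambda>w. k w + (x - k p)) has_field_derivative h w) (at w)"
      by (auto intro!: derivative_eq_intros simp: at_within_open[of _ ?B])
    then show ?thesis by (intro exI[of _ "\<lambda>w. k w + (x - k p)"]) auto
  qed
  \<comment> \<open>The clause for \<open>n = 0\<close> pins the starting pair to the constants,
    which dependent choice alone would not reveal; the first increment is estimated from it.\<close>
  define good where "good = (\<lambda>(n::nat) (fg :: (complex \<Rightarrow> complex) \<times> (complex \<Rightarrow> complex)).
     fst fg holomorphic_on ?B \<and> snd fg holomorphic_on ?B \<and> fst fg p = u \<and> snd fg p = v \<and>
     (n = 0 \<longrightarrow> fg = (\<lambda>_. u, \<lambda>_. v)))"
  define nxt where "nxt = (\<lambda>(n::nat) (fg :: (complex \<Rightarrow> complex) \<times> (complex \<Rightarrow> complex)) fg'.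
     \<forall>w\<in>?B. (fst fg' has_field_derivative a w * fst fg w + b w * snd fg w) (at w) \<and>
      (snd fg' has_field_derivative c w * fst fg w + d w * snd fg w) (at w))"
  have "\<exists>E. \<forall>n. good n (E n) \<and> nxt n (E n) (E (Suc n))"
  proof (rule dependent_nat_choice)
    show "\<exists>x. good 0 x"
      by (rule exI[of _ "(\<lambda>_. u, \<lambda>_. v)"]) (auto simp: good_def)
    fix x n assume x: "good n x"
    have "(\<lambda>w. a w * fst x w + b w * snd x w) holomorphic_on ?B" "(\<lambda>w. c w * fst x w + d w * snd x w) holomorphic_on ?B"
      using x hc by (auto simp: good_def intro!: holomorphic_intros)
    from this[THEN prim] obtain k l where
      "k p = u" "\<forall>w\<in>?B. (k has_field_derivative a w * fst x w + b w * snd x w) (at w)"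
      "l p = v" "\<forall>w\<in>?B. (l has_field_derivative c w * fst x w + d w * snd x w) (at w)"
      by meson
    then show "\<exists>y. good (Suc n) y \<and> nxt n x y"
      by (intro exI[of _ "(k, l)"]) (auto simp: good_def nxt_def holomorphic_on_open)
  qed
  then obtain E where E: "\<And>n. good n (E n)" "\<And>n. nxt n (E n) (E (Suc n))" by blast
  define f where "f n = fst (E n)" for n
  define g where "g n = snd (E n)" for n
  have fg0: "f n p = u" "g n p = v" for n using E(1)[of n] by (auto simp: good_def f_def g_def)
  have fg': "(f (Suc n) has_field_derivative a w * f n w + b w * g n w) (at w)"
      "(g (Suc n) has_field_derivative c w * f n w + d w * g n w) (at w)" if "w \<in> ?B" for n w
    using E(2)[of n] that by (auto simp: nxt_def f_def g_def)
  have ineq: "norm (k w) \<le> C / 2"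
    if k: "k p = 0" "\<And>w. w \<in> ?B \<Longrightarrow> (k has_field_derivative \<alpha> w * x w + \<beta> w * y w) (at w)"
      and ab: "\<And>w. w \<in> ?B \<Longrightarrow> norm (\<alpha> w) \<le> M \<and> norm (\<beta> w) \<le> M"
      and xy: "\<And>w. w \<in> ?B \<Longrightarrow> norm (x w) \<le> C \<and> norm (y w) \<le> C" and w: "w \<in> ?B" for k \<alpha> x \<beta> y C w
  proof -
    have C: "C \<ge> 0" using xy[OF w] norm_ge_zero[of "x w"] by linarith
    have "norm (k w - k p) \<le> (2 * M * C) * norm (w - p)"
    proof (rule field_differentiable_bound[of ?B])
      show "(k has_field_derivative \<alpha> z * x z + \<beta> z * y z) (at z within ?B)" if "z \<in> ?B" for z
        using k(2)[OF that] has_field_derivative_at_within by blast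
      show "norm (\<alpha> z * x z + \<beta> z * y z) \<le> 2 * M * C" if z: "z \<in> ?B" for z
      proof -
        have "norm (\<alpha> z * x z) \<le> M * C" "norm (\<beta> z * y z) \<le> M * C"
          using ab[OF z] xy[OF z] R(4) by (auto simp: norm_mult intro!: mult_mono)
        then show ?thesis using norm_triangle_ineq[of "\<alpha> z * x z" "\<beta> z * y z"] by linarith
      qed
    qed (use w R in auto)
    also have "\<dots> \<le> (2 * M * C) * R"
      using w R C by (intro mult_left_mono) (auto simp: dist_norm norm_minus_commute)
    also have "\<dots> = (4 * M * R) * (C / 2)" by simp
    also have "\<dots> \<le> 1 * (C / 2)" using R(3) C by (intro mult_right_mono) auto
    finally show ?thesis using k(1) by simp
  qed
  \<comment> \<open>\<open>C\<close> dominates both initial constants, so the first increments are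
    at most \<open>C / 2\<close>; they are used with the weaker bound \<open>C\<close>.\<close>
  define C where "C = norm u + norm v"
  have f0: "f 0 = (\<lambda>_. u)" "g 0 = (\<lambda>_. v)"
    using E(1)[of 0] by (auto simp: good_def f_def g_def)
  have "norm (f 1 w - f 0 w) \<le> C / 2" if "w \<in> ?B" for w
  proof (rule ineq[of "\<lambda>w. f 1 w - f 0 w" a "\<lambda>_. u" b "\<lambda>_. v"])
    fix w assume "w \<in> ?B"
    from fg'(1)[OF this, of 0] show "((\<lambda>w. f 1 w - f 0 w) has_field_derivative a w * u + b w * v) (at w)"
      by (auto simp: f0 intro!: derivative_eq_intros)
  qed (use that M fg0 in \<open>auto simp: C_def\<close>)
  moreover have "norm (g 1 w - g 0 w) \<le> C / 2" if "w \<in> ?B" for w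
  proof (rule ineq[of "\<lambda>w. g 1 w - g 0 w" c "\<lambda>_. u" d "\<lambda>_. v"])
    fix w assume "w \<in> ?B"
    from fg'(2)[OF this, of 0] show "((\<lambda>w. g 1 w - g 0 w) has_field_derivative c w * u + d w * v) (at w)"
      by (auto simp: f0 intro!: derivative_eq_intros)
  qed (use that M fg0 in \<open>auto simp: C_def\<close>)
  moreover have "C / 2 \<le> C" by (simp add: C_def)
  ultimately have C0: "norm (f 1 w - f 0 w) \<le> C \<and> norm (g 1 w - g 0 w) \<le> C" if "w \<in> ?B" for w
    using that by (meson order_trans)
  have incr: "\<forall>w\<in>?B. norm (f (Suc n) w - f n w) \<le> C / 2 ^ n \<and> norm (g (Suc n) w - g n w) \<le> C / 2 ^ n" for n
  proof (induction n)
    case 0 then show ?case using C0 by auto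
  next
    case (Suc n)
    have D: "((\<lambda>w. f (Suc (Suc n)) w - f (Suc n) w) has_field_derivative
         a w * (f (Suc n) w - f n w) + b w * (g (Suc n) w - g n w)) (at w)"
      "((\<lambda>w. g (Suc (Suc n)) w - g (Suc n) w) has_field_derivative
         c w * (f (Suc n) w - f n w) + d w * (g (Suc n) w - g n w)) (at w)" if "w \<in> ?B" for w
      using fg'[OF that, of n] fg'[OF that, of "Suc n"]
      by (auto intro!: derivative_eq_intros simp: algebra_simps)
    have "norm (f (Suc (Suc n)) w - f (Suc n) w) \<le> (C / 2 ^ n) / 2" if "w \<in> ?B" for w
      by (rule ineq[of "\<lambda>w. f (Suc (Suc n)) w - f (Suc n) w", OF _ D(1)]) (use Suc M fg0 that in auto)
    moreover have "norm (g (Suc (Suc n)) w - g (Suc n) w) \<le> (C / 2 ^ n) / 2" if "w \<in> ?B" for w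
      by (rule ineq[of "\<lambda>w. g (Suc (Suc n)) w - g (Suc n) w", OF _ D(2)]) (use Suc M fg0 that in auto)
    ultimately show ?case by (auto simp: field_simps)
  qed
  obtain lf where lf: "uniform_limit ?B f lf sequentially"
    by (rule geometric_increments_uniform_limit[of ?B f C]) (use incr in auto)
  obtain lg where lg: "uniform_limit ?B g lg sequentially"
    by (rule geometric_increments_uniform_limit[of ?B g C]) (use incr in auto)
  have lim: "(\<lambda>n. f n w) \<longlonglongrightarrow> lf w" "(\<lambda>n. g n w) \<longlonglongrightarrow> lg w" if "w \<in> ?B" for w
    using tendsto_uniform_limitI[OF lf that] tendsto_uniform_limitI[OF lg that] by auto
  have deriv_lim: "(l has_field_derivative \<alpha> w * lf w + \<beta> w * lg w) (at w)"
    if l: "uniform_limit ?B h l sequentially" "w \<in> ?B"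
      and h: "\<And>n w. w \<in> ?B \<Longrightarrow> (h (Suc n) has_field_derivative \<alpha> w * f n w + \<beta> w * g n w) (at w)" for h l \<alpha> \<beta> w
  proof -
    \<comment> \<open>By Weierstrass the derivatives of the iterates converge to the derivative of
      the limit. They also converge pointwise to the right-hand side formed with the limits, which
      gives the equation.\<close>
    have "\<exists>g'. \<forall>x\<in>?B. (l has_field_derivative g' x) (at x) \<and> (\<lambda>n. \<alpha> x * f n x + \<beta> x * g n x) \<longlonglongrightarrow> g' x"
    proof (rule has_complex_derivative_uniform_sequence[of ?B "\<lambda>n. h (Suc n)"])
      fix x assume "x \<in> ?B"
      then obtain e where e: "e > 0" "cball x e \<subseteq> ?B" using open_contains_cball open_ball by blast
      have "uniform_limit (cball x e) h l sequentially" using l(1) e(2) uniform_limit_on_subset by blast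
      then have "uniform_limit (cball x e) (\<lambda>n. h (Suc n)) l sequentially"
        by (simp add: filterlim_sequentially_Suc)
      then show "\<exists>d>0. cball x d \<subseteq> ?B \<and> uniform_limit (cball x d) (\<lambda>n. h (Suc n)) l sequentially"
        using e by blast
    qed (use h in auto)
    then obtain g' where g': "(l has_field_derivative g' w) (at w)" "(\<lambda>n. \<alpha> w * f n w + \<beta> w * g n w) \<longlonglongrightarrow> g' w"
      using l(2) by blast
    have "(\<lambda>n. \<alpha> w * f n w + \<beta> w * g n w) \<longlonglongrightarrow> \<alpha> w * lf w + \<beta> w * lg w"
      using lim[OF l(2)] by (intro tendsto_intros)
    from LIMSEQ_unique[OF g'(2) this] show ?thesis using g'(1) by simp
  qed
  have "solves ?B lf lg"
    unfolding solves_def using deriv_lim[OF lf _ fg'(1)] deriv_lim[OF lg _ fg'(2)] by blast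
  moreover have "lf p = u" "lg p = v"
    using lim[of p] R(1) by (simp_all add: fg0 LIMSEQ_const_iff)
  ultimately show ?thesis by blast
qed

end

section \<open>Continuation along null-homotopic loops\<close>

text \<open>One radius \<open>R\<close> and one step \<open>\<delta>\<close> for all parameters, so
  that finitely many elements suffice. Agreement is demanded only for close parameters, since
  distant ones may carry different branches over the same point.\<close>

definition function_elements ::
    "(real \<Rightarrow> complex) \<Rightarrow> real \<Rightarrow> real \<Rightarrow> (real \<Rightarrow> complex \<Rightarrow> complex) \<Rightarrow> bool" where
  "function_elements \<gamma> R \<delta> F \<longleftrightarrow>
     (\<forall>s\<in>{0..1}. F s holomorphic_on ball (\<gamma> s) R) \<and>
     (\<forall>s\<in>{0..1}. \<forall>s'\<in>{0..1}. \<bar>s - s'\<bar> < \<delta> \<longrightarrow>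
        (\<forall>w\<in>ball (\<gamma> s) R \<inter> ball (\<gamma> s') R. F s w = F s' w))"

context linear_system begin

text \<open>
  The solution is transported along the homotopy, from the constant path to \<open>\<gamma>\<close>, simultaneously
  for all \<open>s\<close>. Nearby values of \<open>s\<close> give compatible elements, and since the homotopy keeps the
  end points fixed, nothing happens at \<open>s = 0\<close> and \<open>s = 1\<close>.
\<close>
lemma null_homotopic_loop_solutions:
  assumes hom: "homotopic_paths S \<gamma> (linepath q q)"
  obtains R \<delta> F G where "R > 0" "\<delta> > 0" "\<And>s. s \<in> {0..1} \<Longrightarrow> ball (\<gamma> s) R \<subseteq> S"
    "\<And>s. s \<in> {0..1} \<Longrightarrow> solves (ball (\<gamma> s) R) (F s) (G s)"
    "function_elements \<gamma> R \<delta> F" "function_elements \<gamma> R \<delta> G"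
    "F 0 q = u" "G 0 q = v" "F 1 q = u" "G 1 q = v"
proof -
  let ?I = "{0..1} \<times> {0..1} :: (real \<times> real) set"
  obtain h where h: "continuous_on ?I h" "h ` ?I \<subseteq> S" "\<And>s. s \<in> {0..1} \<Longrightarrow> h (0, s) = \<gamma> s"
      "\<And>s. s \<in> {0..1} \<Longrightarrow> h (1, s) = linepath q q s"
      "\<And>x. x \<in> {0..1} \<Longrightarrow> pathstart (h \<circ> Pair x) = pathstart \<gamma> \<and> pathfinish (h \<circ> Pair x) = pathfinish \<gamma>"
    using hom unfolding homotopic_paths by blast
  have ends: "pathstart \<gamma> = q" "pathfinish \<gamma> = q"
    using homotopic_paths_imp_pathstart[OF hom] homotopic_paths_imp_pathfinish[OF hom] by auto
  have h1: "h (1, s) = q" if "s \<in> {0..1}" for s using h(4)[OF that] by (simp add: linepath_refl)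
  have h0: "h (x, 0) = q" "h (x, 1) = q" if "x \<in> {0..1}" for x
    using h(5)[OF that] ends by (auto simp: pathstart_def pathfinish_def)
  let ?K = "h ` ?I"
  have compact_K: "compact ?K" by (intro compact_continuous_image h(1) compact_Times) auto
  obtain e where e: "e > 0" "(\<Union>x\<in>?K. ball x e) \<subseteq> S"
    using compact_subset_open_imp_ball_epsilon_subset[OF compact_K open_S h(2)] by blast
  let ?L = "\<Union>x\<in>?K. cball x (e / 2)"
  have "compact ?L"
    using compact_minkowski_sum_cball[OF compact_K] by simp
  moreover have "?L \<subseteq> S" using e by force
  ultimately obtain M where M: "M > 0"
    "\<And>w. w \<in> ?L \<Longrightarrow> norm (a w) \<le> M \<and> norm (b w) \<le> M \<and> norm (c w) \<le> M \<and> norm (d w) \<le> M"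
    using coeffs_bounded_on_compact by blast
  \<comment> \<open>Initial values will be prescribed at an arbitrary point \<open>y\<close> of
    \<open>ball x R\<close>, and the disc of radius \<open>2 * R\<close> about \<open>y\<close>
    contains that ball. So existence is needed at radius \<open>2 * R\<close>, and
    \<open>3 * R < e / 2\<close> keeps this disc where \<open>M\<close> bounds the
    coefficients.\<close>
  define R where "R = min (e / 4) (1 / (8 * M)) / 2"
  have R: "R > 0" "2 * R \<le> e / 4" "4 * M * (2 * R) \<le> 1"
    using e(1) M(1) by (auto simp: R_def min_def field_simps)
  have ball_S: "ball x R \<subseteq> S" if "x \<in> ?K" for x
    using e R that by (force simp: subset_iff)
  have local: "\<exists>f g. solves (ball x R) f g \<and> f y = u \<and> g y = v" if x: "x \<in> ?K" and y: "y \<in> ball x R" for x y u v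
  proof -
    have sub: "ball y (2 * R) \<subseteq> cball x (e / 2)"
    proof
      fix w assume "w \<in> ball y (2 * R)"
      then show "w \<in> cball x (e / 2)"
        using y R dist_triangle[of x w y] by auto
    qed
    have "\<exists>f g. solves (ball y (2 * R)) f g \<and> f y = u \<and> g y = v"
    proof (rule solution_exists)
      show "ball y (2 * R) \<subseteq> S" using sub x \<open>?L \<subseteq> S\<close> by blast
      show "norm (a w) \<le> M \<and> norm (b w) \<le> M \<and> norm (c w) \<le> M \<and> norm (d w) \<le> M" if "w \<in> ball y (2 * R)" for w
        using M(2) sub x that by blast
    qed (use R M(1) in auto)
    then obtain f g where fg: "solves (ball y (2 * R)) f g" "f y = u" "g y = v" by blast
    have "ball x R \<subseteq> ball y (2 * R)"
    proof
      fix w assume "w \<in> ball x R"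
      then show "w \<in> ball y (2 * R)"
        using y dist_triangle[of y w x] by (auto simp: dist_commute)
    qed
    then show ?thesis using fg solves_subset by blast
  qed
  have "uniformly_continuous_on ?I h"
    by (intro compact_uniformly_continuous h(1) compact_Times) auto
  \<comment> \<open>One \<open>\<delta>\<close> serves both the homotopy parameter and the path
    parameter; \<open>R / 3\<close> leaves room for chaining two such moves inside one disc.\<close>
  then obtain \<delta> where \<delta>: "\<delta> > 0" "\<And>x y. x \<in> ?I \<Longrightarrow> y \<in> ?I \<Longrightarrow> dist x y < \<delta> \<Longrightarrow> dist (h x) (h y) < R / 3"
    unfolding uniformly_continuous_on_def using R(1)
    by (metis dist_commute divide_pos_pos zero_less_numeral)
  obtain N :: nat where N: "N > 0" "1 / real N < \<delta>"
    using \<delta>(1) by (metis nat_approx_posE zero_less_Suc)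
  \<comment> \<open>The homotopy \<open>h\<close> runs from \<open>\<gamma>\<close> to the constant
    path, hence the reversed time.\<close>
  define p where "p n s = h (1 - real n / real N, s)" for n s
  have inI: "(1 - real n / real N, s) \<in> ?I" if "n \<le> N" "s \<in> {0..1}" for n s
    using that N by (auto simp: field_simps)
  have pK: "p n s \<in> ?K" if "n \<le> N" "s \<in> {0..1}" for n s
    using inI[OF that] by (simp add: p_def)
  have p_Suc: "dist (p n s) (p (Suc n) s) < R / 3" if "Suc n \<le> N" "s \<in> {0..1}" for n s
    unfolding p_def using that N inI[of n s] inI[of "Suc n" s]
    by (intro \<delta>(2)) (auto simp: dist_Pair_Pair dist_real_def diff_divide_distrib[symmetric])
  have p_s: "dist (p n s) (p n s') < R / 3" if "n \<le> N" "s \<in> {0..1}" "s' \<in> {0..1}" "\<bar>s - s'\<bar> < \<delta>" for n s s'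
    unfolding p_def using that inI
    by (intro \<delta>(2)) (auto simp: dist_Pair_Pair dist_real_def)
  have "\<exists>F G. (\<forall>s\<in>{0..1}. solves (ball (p n s) R) (F s) (G s)) \<and>
      (\<forall>s\<in>{0..1}. \<forall>s'\<in>{0..1}. \<bar>s - s'\<bar> < \<delta> \<longrightarrow>
        (\<forall>w\<in>ball (p n s) R \<inter> ball (p n s') R. F s w = F s' w \<and> G s w = G s' w)) \<and>
      F 0 q = u \<and> G 0 q = v \<and> F 1 q = u \<and> G 1 q = v" if "n \<le> N" for n
    using that
  proof (induction n)
    case 0
    have p0: "p 0 s = q" if "s \<in> {0..1}" for s using h1[OF that] by (simp add: p_def)
    have "q \<in> ?K" using pK[of 0 0] p0[of 0] by simp
    then obtain f g where "solves (ball q R) f g" "f q = u" "g q = v"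
      using local[of q q u v] R(1) by auto
    then show ?case
      by (intro exI[of _ "\<lambda>_. f"] exI[of _ "\<lambda>_. g"]) (simp add: p0)
  next
    case (Suc n)
    then obtain F G where FG: "\<And>s. s \<in> {0..1} \<Longrightarrow> solves (ball (p n s) R) (F s) (G s)"
      "\<And>s s' w. s \<in> {0..1} \<Longrightarrow> s' \<in> {0..1} \<Longrightarrow> \<bar>s - s'\<bar> < \<delta> \<Longrightarrow> w \<in> ball (p n s) R \<inter> ball (p n s') R
         \<Longrightarrow> F s w = F s' w \<and> G s w = G s' w"
      "F 0 q = u" "G 0 q = v" "F 1 q = u" "G 1 q = v"
      by (auto simp: Ball_def) (metis Suc_leD)
    have near: "p n s \<in> ball (p (Suc n) s) R" if "s \<in> {0..1}" for s
      using p_Suc[OF Suc.prems that] R(1) by (simp add: dist_commute)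
    \<comment> \<open>The new element takes over the value of the old one at the old centre, which
      lies in the new disc.\<close>
    have "\<forall>s\<in>{0..1}. \<exists>f g. solves (ball (p (Suc n) s) R) f g \<and> f (p n s) = F s (p n s) \<and> g (p n s) = G s (p n s)"
      using local[OF pK[OF Suc.prems] near] by blast
    then obtain F' G' where FG': "\<And>s. s \<in> {0..1} \<Longrightarrow> solves (ball (p (Suc n) s) R) (F' s) (G' s)"
      "\<And>s. s \<in> {0..1} \<Longrightarrow> F' s (p n s) = F s (p n s)" "\<And>s. s \<in> {0..1} \<Longrightarrow> G' s (p n s) = G s (p n s)"
      by metis
    have nN: "n \<le> N" using Suc.prems by simp
    \<comment> \<open>The old centre \<open>p n s\<close> lies in all four discs (both stages, both
      parameters). There the two old elements agree, and each new element agrees with its old one: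
      for \<open>s\<close> by construction, for \<open>s'\<close> by uniqueness from the point
      \<open>p n s'\<close>.\<close>
    have agree: "F' s w = F' s' w \<and> G' s w = G' s' w"
      if s: "s \<in> {0..1}" "s' \<in> {0..1}" "\<bar>s - s'\<bar> < \<delta>" and w: "w \<in> ball (p (Suc n) s) R \<inter> ball (p (Suc n) s') R"
      for s s' w
    proof -
      let ?x = "p n s"
      have d: "dist ?x (p n s') < R / 3" "dist ?x (p (Suc n) s) < R / 3" "dist (p (Suc n) s) (p (Suc n) s') < R / 3"
        using p_s[OF nN s] p_Suc[OF Suc.prems s(1)] p_s[OF Suc.prems s] by auto
      have "dist ?x (p (Suc n) s') < R"
        using d dist_triangle[of ?x "p (Suc n) s'" "p (Suc n) s"] R(1) by linarith
      then have x: "?x \<in> ball (p n s') R \<inter> ball (p (Suc n) s') R" "?x \<in> ball (p n s) R \<inter> ball (p n s') R"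
          "?x \<in> ball (p (Suc n) s) R \<inter> ball (p (Suc n) s') R"
        using d R(1) by (auto simp: dist_commute)
      have sub: "ball (p n s') R \<subseteq> S" "ball (p (Suc n) s') R \<subseteq> S" "ball (p (Suc n) s) R \<subseteq> S"
        using ball_S pK nN Suc.prems s by auto
      have "p n s' \<in> ball (p n s') R \<inter> ball (p (Suc n) s') R" using near[OF s(2)] R(1) by auto
      then have "F s' ?x = F' s' ?x" "G s' ?x = G' s' ?x"
        using solves_unique[OF sub(1,2) FG(1)[OF s(2)] FG'(1)[OF s(2)] _ _ _ x(1)] FG'(2,3)[OF s(2)] by metis+
      then have "F' s ?x = F' s' ?x" "G' s ?x = G' s' ?x"
        using FG(2)[OF s x(2)] FG'(2,3)[OF s(1)] by auto
      then show ?thesis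
        using solves_unique[OF sub(3,2) FG'(1)[OF s(1)] FG'(1)[OF s(2)] x(3) _ _ w] by auto
    qed
    \<comment> \<open>At both ends the centre is \<open>q\<close> at every stage, so the prescribed
      values are handed on unchanged.\<close>
    have "p n 0 = q" "p n 1 = q" using h0 inI[OF nN, of 0] by (auto simp: p_def)
    then have "F' 0 q = u \<and> G' 0 q = v \<and> F' 1 q = u \<and> G' 1 q = v"
      using FG'(2,3)[of 0] FG'(2,3)[of 1] FG(3-6) by simp
    then show ?case
      using FG'(1) agree by (intro exI[of _ F'] exI[of _ G']) blast
  qed
  from this[OF order_refl] obtain F G where FG: "\<forall>s\<in>{0..1}. solves (ball (p N s) R) (F s) (G s)"
      "\<forall>s\<in>{0..1}. \<forall>s'\<in>{0..1}. \<bar>s - s'\<bar> < \<delta> \<longrightarrow>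
        (\<forall>w\<in>ball (p N s) R \<inter> ball (p N s') R. F s w = F s' w \<and> G s w = G s' w)"
      "F 0 q = u" "G 0 q = v" "F 1 q = u" "G 1 q = v"
    by (elim exE conjE)
  have pN: "p N s = \<gamma> s" if "s \<in> {0..1}" for s using h(3)[OF that] N by (simp add: p_def)
  have sol: "solves (ball (\<gamma> s) R) (F s) (G s)" if "s \<in> {0..1}" for s using bspec[OF FG(1) that] pN[OF that] by simp
  have compat: "F s w = F s' w" "G s w = G s' w"
    if "s \<in> {0..1}" "s' \<in> {0..1}" "\<bar>s - s'\<bar> < \<delta>" "w \<in> ball (\<gamma> s) R \<inter> ball (\<gamma> s') R" for s s' w
    using bspec[OF bspec[OF FG(2) that(1)] that(2)] that(3,4) by (simp_all add: pN[OF that(1)] pN[OF that(2)])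
  have "function_elements \<gamma> R \<delta> F" "function_elements \<gamma> R \<delta> G"
    unfolding function_elements_def
    by (intro conjI ballI impI solves_imp_holomorphic[OF sol open_ball] compat; assumption)+
  then show ?thesis
    using ball_S[OF pK[OF order_refl]] by (intro that[OF R(1) \<delta>(1) _ sol _ _ FG(3-6)]) (simp_all add: pN)
qed

end

section \<open>Integrals of continued function elements\<close>

lemma analytic_continuation_alongD:
  assumes "analytic_continuation_along \<gamma> f F"
  shows "s \<in> {0..1} \<Longrightarrow> F s analytic_on {\<gamma> s}"
    and "\<forall>\<^sub>F w in at (\<gamma> 0). F 0 w = f w"
    and "s \<in> {0..1} \<Longrightarrow> \<forall>\<^sub>F s' in at s within {0..1}. \<forall>\<^sub>F w in nhds (\<gamma> s'). F s' w = F s w"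
proof -
  note A = assms[unfolded analytic_continuation_along_def]
  show "s \<in> {0..1} \<Longrightarrow> F s analytic_on {\<gamma> s}" by (rule bspec[OF conjunct1[OF A]])
  show "\<forall>\<^sub>F w in at (\<gamma> 0). F 0 w = f w" by (rule conjunct1[OF conjunct2[OF A]])
  show "s \<in> {0..1} \<Longrightarrow> \<forall>\<^sub>F s' in at s within {0..1}. \<forall>\<^sub>F w in nhds (\<gamma> s'). F s' w = F s w"
    by (rule bspec[OF conjunct2[OF conjunct2[OF A]]])
qed

text \<open>By the identity theorem on a disc about \<open>\<gamma> s\<close>, agreement of germs is
  a locally constant property of the parameter; connectedness of the unit interval carries it from 0
  to every \<open>s\<close>.\<close>

lemma continuation_values_unique:
  assumes path: "path \<gamma>" and F: "analytic_continuation_along \<gamma> f F" and G: "analytic_continuation_along \<gamma> f G"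
    and s: "s \<in> {0..1}"
  shows "F s (\<gamma> s) = G s (\<gamma> s)"
proof -
  define A where "A = {s\<in>{0..1}. \<forall>\<^sub>F w in nhds (\<gamma> s). F s w = G s w}"
  have cont: "(\<gamma> \<longlongrightarrow> \<gamma> s) (at s within {0..1})" if "s \<in> {0..1}" for s
    using path that by (auto simp: path_def continuous_on_def)
  have ev: "\<forall>\<^sub>F s' in at s within {0..1}. (s' \<in> A \<longleftrightarrow> s \<in> A)" if s: "s \<in> {0..1}" for s
  proof -
    obtain r where r: "r > 0" "F s holomorphic_on ball (\<gamma> s) r" "G s holomorphic_on ball (\<gamma> s) r"
    proof -
      have "F s analytic_on {\<gamma> s}" "G s analytic_on {\<gamma> s}"
        using analytic_continuation_alongD(1)[OF F s] analytic_continuation_alongD(1)[OF G s] by this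
      then obtain r1 r2 where "r1 > 0" "F s holomorphic_on ball (\<gamma> s) r1" "r2 > 0" "G s holomorphic_on ball (\<gamma> s) r2"
        by (auto simp: analytic_on_def)
      then show ?thesis
        by (intro that[of "min r1 r2"]) (auto elim: holomorphic_on_subset)
    qed
    have near: "\<forall>\<^sub>F s' in at s within {0..1}. \<gamma> s' \<in> ball (\<gamma> s) r"
      using cont[OF s] r(1) by (intro topological_tendstoD) auto
    have eqF: "\<forall>\<^sub>F s' in at s within {0..1}. \<forall>\<^sub>F w in nhds (\<gamma> s'). F s' w = F s w"
      and eqG: "\<forall>\<^sub>F s' in at s within {0..1}. \<forall>\<^sub>F w in nhds (\<gamma> s'). G s' w = G s w"
      using analytic_continuation_alongD(3)[OF F s] analytic_continuation_alongD(3)[OF G s] by this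
    have glob: "F s w = G s w" if x: "x \<in> ball (\<gamma> s) r" "\<forall>\<^sub>F w in nhds x. F s w = G s w" "w \<in> ball (\<gamma> s) r" for x w
    proof -
      obtain T where T: "open T" "x \<in> T" "\<And>w. w \<in> T \<Longrightarrow> F s w = G s w"
        using x(2) by (auto simp: eventually_nhds)
      have "F s w - G s w = 0"
      proof (rule analytic_continuation_open[of "T \<inter> ball (\<gamma> s) r" "ball (\<gamma> s) r" "\<lambda>w. F s w - G s w" "\<lambda>_. 0"])
        show "T \<inter> ball (\<gamma> s) r \<noteq> {}" using T(2) x(1) by auto
      qed (use T r x in \<open>auto intro!: holomorphic_intros\<close>)
      then show ?thesis by simp
    qed
    have nhds_ball: "\<forall>\<^sub>F w in nhds x. w \<in> ball (\<gamma> s) r" if "x \<in> ball (\<gamma> s) r" for x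
      using that eventually_nhds_in_open by blast
    have "\<forall>\<^sub>F s' in at s within {0..1}. s' \<in> {0..1}"
      by (simp add: eventually_at_filter)
    with near eqF eqG show ?thesis
    proof eventually_elim
      case (elim s')
      show ?case
      proof
        assume "s' \<in> A"
        then have "\<forall>\<^sub>F w in nhds (\<gamma> s'). F s' w = G s' w" by (simp add: A_def)
        with elim(2,3) have "\<forall>\<^sub>F w in nhds (\<gamma> s'). F s w = G s w" by eventually_elim auto
        with glob[OF elim(1)] have "\<And>w. w \<in> ball (\<gamma> s) r \<Longrightarrow> F s w = G s w" by blast
        then show "s \<in> A" using nhds_ball[of "\<gamma> s"] r(1) s by (auto simp: A_def elim!: eventually_mono)
      next
        assume "s \<in> A"
        then have "\<forall>\<^sub>F w in nhds (\<gamma> s). F s w = G s w" by (simp add: A_def)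
        with glob[of "\<gamma> s"] r(1) have eq: "\<And>w. w \<in> ball (\<gamma> s) r \<Longrightarrow> F s w = G s w" by auto
        from nhds_ball[OF elim(1)] elim(2,3) have "\<forall>\<^sub>F w in nhds (\<gamma> s'). F s' w = G s' w"
          by eventually_elim (use eq in auto)
        then show "s' \<in> A" using elim(4) by (simp add: A_def)
      qed
    qed
  qed
  \<comment> \<open>The initial condition speaks of a punctured neighbourhood only; continuity of
    both elements supplies the centre.\<close>
  have "0 \<in> A"
  proof -
    have an: "F 0 analytic_on {\<gamma> 0}" "G 0 analytic_on {\<gamma> 0}"
      and ev0: "\<forall>\<^sub>F w in at (\<gamma> 0). F 0 w = f w" "\<forall>\<^sub>F w in at (\<gamma> 0). G 0 w = f w"
      using analytic_continuation_alongD(1,2)[OF F] analytic_continuation_alongD(1,2)[OF G] by simp_all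
    from ev0 have eq: "\<forall>\<^sub>F w in at (\<gamma> 0). F 0 w = G 0 w" by eventually_elim auto
    have lim: "(F 0 \<longlongrightarrow> F 0 (\<gamma> 0)) (at (\<gamma> 0))" "(G 0 \<longlongrightarrow> G 0 (\<gamma> 0)) (at (\<gamma> 0))"
      using an by (auto dest!: analytic_at_imp_isCont simp: isCont_def)
    have "(G 0 \<longlongrightarrow> F 0 (\<gamma> 0)) (at (\<gamma> 0))"
      using lim(1) eq tendsto_cong by fastforce
    then have "F 0 (\<gamma> 0) = G 0 (\<gamma> 0)" using lim(2) tendsto_unique trivial_limit_at by blast
    with eq show ?thesis by (auto simp: A_def eventually_nhds_conv_at)
  qed
  have "(s \<in> A) = (0 \<in> A)"
  proof (rule connected_local_const[where f = "\<lambda>s. s \<in> A" and A = "{0..1}"])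
    show "\<forall>a\<in>{0..1}. \<forall>\<^sub>F b in at a within {0..1}. (a \<in> A) = (b \<in> A)"
    proof
      fix a :: real assume "a \<in> {0..1}"
      from ev[OF this] show "\<forall>\<^sub>F b in at a within {0..1}. (a \<in> A) = (b \<in> A)"
        by eventually_elim auto
    qed
  qed (use s in auto)
  with \<open>0 \<in> A\<close> have "\<forall>\<^sub>F w in nhds (\<gamma> s). F s w = G s w" by (simp add: A_def)
  then show ?thesis by (rule eventually_nhds_x_imp_x)
qed

lemma function_elements_agree:
  assumes "function_elements \<gamma> R \<delta> F" "s \<in> {0..1}" "s' \<in> {0..1}" "\<bar>s - s'\<bar> < \<delta>"
    "w \<in> ball (\<gamma> s) R" "w \<in> ball (\<gamma> s') R"
  shows "F s w = F s' w"
  using bspec[OF bspec[OF conjunct2[OF assms(1)[unfolded function_elements_def]] assms(2)] assms(3)] assms(4-6)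
  by simp

lemma function_elements_holomorphic:
  assumes "function_elements \<gamma> R \<delta> F" "s \<in> {0..1}"
  shows "F s holomorphic_on ball (\<gamma> s) R"
  by (rule bspec[OF conjunct1[OF assms(1)[unfolded function_elements_def]] assms(2)])

lemma function_elements_continuation:
  assumes F: "function_elements \<gamma> R \<delta> F" and path: "path \<gamma>" and pos: "R > 0" "\<delta> > 0"
    and f: "\<forall>\<^sub>F w in at (\<gamma> 0). F 0 w = f w"
  shows "analytic_continuation_along \<gamma> f F"
  unfolding analytic_continuation_along_def
proof (intro conjI ballI f)
  fix s :: real assume s: "s \<in> {0..1}"
  show "F s analytic_on {\<gamma> s}"
    using function_elements_holomorphic[OF F s] pos(1) by (auto simp: analytic_on_def)
  have "(\<gamma> \<longlongrightarrow> \<gamma> s) (at s within {0..1})"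
    using path s by (auto simp: path_def continuous_on_def)
  then have "\<forall>\<^sub>F s' in at s within {0..1}. \<gamma> s' \<in> ball (\<gamma> s) R"
    using pos(1) by (intro topological_tendstoD) auto
  moreover have "\<forall>\<^sub>F s' in at s within {0..1}. s' \<in> {0..1}" by (simp add: eventually_at_filter)
  moreover have "\<forall>\<^sub>F s' in at s within {0..1}. \<bar>s' - s\<bar> < \<delta>"
    using pos(2) by (auto simp: eventually_at dist_real_def intro!: exI[of _ \<delta>])
  ultimately show "\<forall>\<^sub>F s' in at s within {0..1}. \<forall>\<^sub>F w in nhds (\<gamma> s'). F s' w = F s w"
  proof eventually_elim
    case (elim s')
    have "\<forall>\<^sub>F w in nhds (\<gamma> s'). w \<in> ball (\<gamma> s') R \<inter> ball (\<gamma> s) R"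
      by (intro eventually_nhds_in_open) (use elim pos in auto)
    then show ?case
      by eventually_elim (use function_elements_agree[OF F _ s] elim in blast)
  qed
qed

text \<open>
  The derivative of a \<open>valid_path\<close> may be unbounded near the finitely many exceptional points, which
  rules out differentiating under an integral along \<open>\<gamma>\<close> itself; hence the passage to inscribed polygons.
\<close>
definition polygon_integral :: "(real \<Rightarrow> complex) \<Rightarrow> nat \<Rightarrow> (real \<Rightarrow> complex \<Rightarrow> complex) \<Rightarrow> complex" where
  "polygon_integral \<gamma> N K =
     (\<Sum>i<N. contour_integral (linepath (\<gamma> (real i / real N)) (\<gamma> (real (Suc i) / real N))) (K (real i / real N)))"

text \<open>Mesh below \<open>\<delta>\<close>, so that elements at consecutive vertices agree, and
  oscillation of \<open>\<gamma>\<close> below \<open>R\<close> on each piece, so that arc and chord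
  lie in the disc of the element at the left vertex.\<close>

definition fine_for :: "(real \<Rightarrow> complex) \<Rightarrow> real \<Rightarrow> real \<Rightarrow> nat \<Rightarrow> bool" where
  "fine_for \<gamma> R \<delta> N \<longleftrightarrow> R > 0 \<and> N > 0 \<and> 1 / real N < \<delta> \<and>
     (\<forall>s\<in>{0..1}. \<forall>s'\<in>{0..1}. \<bar>s - s'\<bar> \<le> 1 / real N \<longrightarrow> dist (\<gamma> s) (\<gamma> s') < R)"

lemma fine_for_exists:
  assumes "path \<gamma>" "R > 0" "\<delta> > 0"
  obtains N where "fine_for \<gamma> R \<delta> N"
proof -
  have "uniformly_continuous_on {0..1} \<gamma>"
    using assms(1) by (simp add: path_def compact_uniformly_continuous)
  then obtain e where e: "e > 0" "\<And>s s'. s \<in> {0..1} \<Longrightarrow> s' \<in> {0..1} \<Longrightarrow> dist s s' < e \<Longrightarrow> dist (\<gamma> s) (\<gamma> s') < R"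
    unfolding uniformly_continuous_on_def using assms(2) by (metis dist_commute)
  obtain N :: nat where N: "N > 0" "1 / real N < min e \<delta>"
    using e(1) assms(3) by (metis min_less_iff_conj nat_approx_posE zero_less_Suc)
  show ?thesis
    by (rule that[of N]) (use N e assms(2) in \<open>auto simp: fine_for_def dist_real_def\<close>)
qed

lemma fine_for_partition:
  assumes N: "fine_for \<gamma> R \<delta> N" and i: "i < N"
  shows "real i / real N \<in> {0..1}" "real (Suc i) / real N \<in> {0..1}"
    and "\<bar>real (Suc i) / real N - real i / real N\<bar> < \<delta>"
    and "\<And>s. s \<in> {real i / real N..real (Suc i) / real N} \<Longrightarrow> s \<in> {0..1} \<and> \<bar>s - real i / real N\<bar> < \<delta> \<and> \<gamma> s \<in> ball (\<gamma> (real i / real N)) R"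
    and "closed_segment (\<gamma> (real i / real N)) (\<gamma> (real (Suc i) / real N)) \<subseteq> ball (\<gamma> (real i / real N)) R"
proof -
  let ?p = "real i / real N" and ?p' = "real (Suc i) / real N"
  have N': "N > 0" "1 / real N < \<delta>" "R > 0" using N by (auto simp: fine_for_def)
  have pp: "?p' - ?p = 1 / real N" by (simp add: diff_divide_distrib[symmetric])
  show p: "?p \<in> {0..1}" "?p' \<in> {0..1}" using i by (auto simp: field_simps)
  show "\<bar>?p' - ?p\<bar> < \<delta>" unfolding pp using N' by simp
  show all: "s \<in> {0..1} \<and> \<bar>s - ?p\<bar> < \<delta> \<and> \<gamma> s \<in> ball (\<gamma> ?p) R" if s: "s \<in> {?p..?p'}" for s
  proof -
    have s01: "s \<in> {0..1}" using s p by (meson atLeastAtMost_iff order_trans)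
    have "\<bar>?p - s\<bar> \<le> 1 / real N" using s pp by auto
    then show ?thesis using s01 N' N p(1) by (auto simp: fine_for_def abs_minus_commute)
  qed
  have "?p' \<in> {?p..?p'}" using pp N' by (simp add: divide_right_mono)
  then show "closed_segment (\<gamma> ?p) (\<gamma> ?p') \<subseteq> ball (\<gamma> ?p) R"
    using all N' by (intro closed_segment_subset) auto
qed

text \<open>On each piece the element at the left vertex has a primitive on its disc, and the arc of
  \<open>\<gamma>\<close> and its chord both give the difference of that primitive at the two
  vertices.\<close>

lemma polygon_integral_has_integral:
  assumes K: "function_elements \<gamma> R \<delta> K" and \<gamma>: "valid_path \<gamma>" and N: "fine_for \<gamma> R \<delta> N"
  shows "((\<lambda>s. K s (\<gamma> s) * vector_derivative \<gamma> (at s within {0..1})) has_integral polygon_integral \<gamma> N K) {0..1}"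
proof -
  obtain X where X: "finite X" "\<gamma> C1_differentiable_on {0..1} - X" and cont: "continuous_on {0..1} \<gamma>"
    using \<gamma> by (auto simp: valid_path_def piecewise_C1_differentiable_on_def)
  let ?f = "\<lambda>s. K s (\<gamma> s) * vector_derivative \<gamma> (at s within {0..1})"
  let ?I = "\<lambda>i. contour_integral (linepath (\<gamma> (real i / real N)) (\<gamma> (real (Suc i) / real N))) (K (real i / real N))"
  have N0: "N > 0" using N by (auto simp: fine_for_def)
  have piece: "(?f has_integral ?I i) {real i / real N..real (Suc i) / real N}" if i: "i < N" for i
  proof -
    let ?p = "real i / real N" and ?p' = "real (Suc i) / real N"
    let ?B = "ball (\<gamma> ?p) R"
    note part = fine_for_partition[OF N i]
    have "K ?p holomorphic_on ?B" by (rule function_elements_holomorphic[OF K part(1)])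
    then obtain P where P: "\<And>w. w \<in> ?B \<Longrightarrow> (P has_field_derivative K ?p w) (at w within ?B)"
      using holomorphic_convex_primitive'[of ?B "K ?p"] by auto
    have "(K ?p has_contour_integral P (pathfinish (linepath (\<gamma> ?p) (\<gamma> ?p'))) - P (pathstart (linepath (\<gamma> ?p) (\<gamma> ?p')))) (linepath (\<gamma> ?p) (\<gamma> ?p'))"
      by (rule contour_integral_primitive[OF P]) (use part(5) in auto)
    then have I: "?I i = P (\<gamma> ?p') - P (\<gamma> ?p)" by (simp add: contour_integral_unique)
    \<comment> \<open>The form of the fundamental theorem used here tolerates the finite set
      \<open>X\<close> where \<open>\<gamma>\<close> need not be differentiable: continuity of the
      primitive along the arc bridges it.\<close>
    have "((\<lambda>s. K ?p (\<gamma> s) * vector_derivative \<gamma> (at s within {0..1})) has_integral P (\<gamma> ?p') - P (\<gamma> ?p)) {?p..?p'}"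
    proof (rule fundamental_theorem_of_calculus_interior_strong[OF X(1)])
      show "?p \<le> ?p'" using N0 by (simp add: field_simps)
      show "continuous_on {?p..?p'} (\<lambda>s. P (\<gamma> s))"
      proof (rule continuous_on_compose2[of ?B P])
        show "continuous_on ?B P" by (rule DERIV_continuous_on[OF P])
        show "continuous_on {?p..?p'} \<gamma>" using cont part(4) by (meson continuous_on_subset subsetI)
      qed (use part(4) in blast)
      fix x assume x: "x \<in> {?p<..<?p'} - X"
      have "0 \<le> ?p" by simp
      with x part(2) have x': "x \<in> {0<..<1}"
        unfolding atLeastAtMost_iff greaterThanLessThan_iff Diff_iff by linarith
      have B: "\<gamma> x \<in> ?B" using part(4)[of x] x by auto
      have at: "at x within {0..1} = at x" using x' by (intro at_within_interior) (simp add: interior_atLeastAtMost_real)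
      have "\<gamma> differentiable at x"
        using X(2) x x' by (auto simp: C1_differentiable_on_eq)
      then have "(\<gamma> has_vector_derivative vector_derivative \<gamma> (at x)) (at x)"
        by (simp add: vector_derivative_works)
      moreover have "(P has_field_derivative K ?p (\<gamma> x)) (at (\<gamma> x))"
        using P[OF B] B by (simp add: at_within_open[of _ ?B])
      ultimately have "((P \<circ> \<gamma>) has_vector_derivative vector_derivative \<gamma> (at x) * K ?p (\<gamma> x)) (at x)"
        by (rule field_vector_diff_chain_at)
      then show "((\<lambda>s. P (\<gamma> s)) has_vector_derivative K ?p (\<gamma> x) * vector_derivative \<gamma> (at x within {0..1})) (at x)"
        by (simp add: at o_def mult.commute)
    qed
    moreover have "K s (\<gamma> s) = K ?p (\<gamma> s)" if "s \<in> {?p..?p'}" for s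
    proof -
      note ps = part(4)[OF that]
      have "\<gamma> s \<in> ball (\<gamma> s) R" using N by (auto simp: fine_for_def)
      then show ?thesis
        using function_elements_agree[OF K _ part(1)] ps by blast
    qed
    ultimately show ?thesis unfolding I
      by (subst has_integral_cong[where g = "\<lambda>s. K ?p (\<gamma> s) * vector_derivative \<gamma> (at s within {0..1})"]) auto
  qed
  have "(?f has_integral (\<Sum>i<n. ?I i)) {0..real n / real N}" if "n \<le> N" for n
    using that
  proof (induction n)
    case (Suc n)
    have "(?f has_integral (\<Sum>i<n. ?I i) + ?I n) {0..real (Suc n) / real N}"
      by (rule has_integral_combine[of 0 "real n / real N"])
        (use Suc piece[of n] N0 in \<open>auto simp: field_simps\<close>)
    then show ?case by simp
  qed auto
  from this[of N] show ?thesis using N0 by (simp add: polygon_integral_def)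
qed

text \<open>Resolves the definite description: \<open>K\<close> witnesses existence, and any other
  continuation has the same values along \<open>\<gamma>\<close>, hence the same integral.\<close>

lemma continued_contour_integral_eq:
  assumes K: "function_elements \<gamma> R \<delta> K" and \<gamma>: "valid_path \<gamma>" and N: "fine_for \<gamma> R \<delta> N"
    and f: "\<forall>\<^sub>F w in at (\<gamma> 0). K 0 w = f w"
  shows "continued_contour_integral \<gamma> f = polygon_integral \<gamma> N K"
  unfolding continued_contour_integral_def
proof (rule the_equality)
  have pos: "R > 0" "\<delta> > 0" using N by (auto simp: fine_for_def intro: less_trans[of 0 "1 / real N"])
  have cont: "analytic_continuation_along \<gamma> f K"
    by (rule function_elements_continuation[OF K valid_path_imp_path[OF \<gamma>] pos f])
  note int = polygon_integral_has_integral[OF K \<gamma> N]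
  show "\<exists>F. analytic_continuation_along \<gamma> f F \<and>
      ((\<lambda>s. F s (\<gamma> s) * vector_derivative \<gamma> (at s within {0..1})) has_integral polygon_integral \<gamma> N K) {0..1}"
    using cont int by blast
  fix I assume "\<exists>F. analytic_continuation_along \<gamma> f F \<and>
      ((\<lambda>s. F s (\<gamma> s) * vector_derivative \<gamma> (at s within {0..1})) has_integral I) {0..1}"
  then obtain F where F: "analytic_continuation_along \<gamma> f F"
    "((\<lambda>s. F s (\<gamma> s) * vector_derivative \<gamma> (at s within {0..1})) has_integral I) {0..1}" by blast
  have "((\<lambda>s. K s (\<gamma> s) * vector_derivative \<gamma> (at s within {0..1})) has_integral I) {0..1}"
    using F(2) continuation_values_unique[OF valid_path_imp_path[OF \<gamma>] cont F(1)]
    by (subst has_integral_cong[where g = "\<lambda>s. F s (\<gamma> s) * vector_derivative \<gamma> (at s within {0..1})"]) auto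
  then show "I = polygon_integral \<gamma> N K" using int has_integral_unique by blast
qed

text \<open>At the common vertex of two consecutive chords the two elements of \<open>T\<close>
  agree, so the sum telescopes.\<close>

lemma polygon_integral_primitive:
  assumes T: "function_elements \<gamma> R \<delta> T" and N: "fine_for \<gamma> R \<delta> N"
    and deriv: "\<And>s w. s \<in> {0..1} \<Longrightarrow> w \<in> ball (\<gamma> s) R \<Longrightarrow> (T s has_field_derivative K s w) (at w)"
  shows "polygon_integral \<gamma> N K = T 1 (\<gamma> 1) - T 0 (\<gamma> 0)"
proof -
  have N0: "N > 0" "R > 0" using N by (auto simp: fine_for_def)
  have "polygon_integral \<gamma> N K =
      (\<Sum>i<N. T (real (Suc i) / real N) (\<gamma> (real (Suc i) / real N)) - T (real i / real N) (\<gamma> (real i / real N)))"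
    unfolding polygon_integral_def
  proof (rule sum.cong[OF refl])
    fix i assume "i \<in> {..<N}"
    then have i: "i < N" by simp
    let ?p = "real i / real N" and ?p' = "real (Suc i) / real N"
    note part = fine_for_partition[OF N i]
    have "(K ?p has_contour_integral T ?p (pathfinish (linepath (\<gamma> ?p) (\<gamma> ?p'))) - T ?p (pathstart (linepath (\<gamma> ?p) (\<gamma> ?p')))) (linepath (\<gamma> ?p) (\<gamma> ?p'))"
      by (rule contour_integral_primitive[of "ball (\<gamma> ?p) R"])
        (use part(5) in \<open>simp_all add: has_field_derivative_at_within[OF deriv[OF part(1)]]\<close>)
    moreover have "T ?p (\<gamma> ?p') = T ?p' (\<gamma> ?p')"
    proof -
      have "\<gamma> ?p' \<in> ball (\<gamma> ?p') R \<inter> ball (\<gamma> ?p) R"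
        using part(5) N0(2) by auto
      then show ?thesis
        using function_elements_agree[OF T part(2,1,3)] by simp
    qed
    ultimately show "contour_integral (linepath (\<gamma> ?p) (\<gamma> ?p')) (K ?p) = T ?p' (\<gamma> ?p') - T ?p (\<gamma> ?p)"
      by (simp add: contour_integral_unique)
  qed
  also have "\<dots> = T (real N / real N) (\<gamma> (real N / real N)) - T (real 0 / real N) (\<gamma> (real 0 / real N))"
    by (rule sum_lessThan_telescope)
  finally show ?thesis using N0 by simp
qed

text \<open>The Leibniz rule applies on a straight segment, where the velocity is the constant
  \<open>q - p\<close> and the integrands are continuous.\<close>

lemma convolution_linepath_has_field_derivative:
  assumes \<phi>: "continuous_on (closed_segment p q) \<phi>" and \<Phi>: "\<Phi> holomorphic_on A" "open A"
    and U: "open U" "convex U" "z \<in> U" "\<And>z w. z \<in> U \<Longrightarrow> w \<in> closed_segment p q \<Longrightarrow> z - w \<in> A"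
  shows "((\<lambda>z. contour_integral (linepath p q) (\<lambda>w. \<phi> w * \<Phi> (z - w))) has_field_derivative
          contour_integral (linepath p q) (\<lambda>w. \<phi> w * deriv \<Phi> (z - w))) (at z)"
proof -
  let ?l = "linepath p q"
  have l: "?l x \<in> closed_segment p q" if "x \<in> {0..1}" for x
    using that linepath_image_01[of p q] by blast
  have cl: "continuous_on {0..1} ?l" by (rule continuous_on_linepath)
  have c\<phi>: "continuous_on {0..1} (\<lambda>x. \<phi> (?l x))"
    by (rule continuous_on_compose2[OF \<phi> cl]) (use l in auto)
  have cA: "continuous_on A \<Phi>" "continuous_on A (deriv \<Phi>)"
    using \<Phi> by (auto intro: holomorphic_on_imp_continuous_on holomorphic_deriv)
  have eq: "contour_integral ?l h = integral (cbox 0 1) (\<lambda>x. h (?l x) * (q - p))" for h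
    by (simp add: contour_integral_integral vector_derivative_linepath_at)
  have "((\<lambda>z. integral (cbox 0 1) (\<lambda>x. \<phi> (?l x) * \<Phi> (z - ?l x) * (q - p))) has_field_derivative
     integral (cbox 0 1) (\<lambda>x. \<phi> (?l x) * deriv \<Phi> (z - ?l x) * (q - p))) (at z within U)"
  proof (rule leibniz_rule_field_derivative[OF _ _ _ U(3,2)])
    fix y x assume y: "y \<in> U" and x: "x \<in> cbox (0::real) 1"
    have "y - ?l x \<in> A" using U(4)[OF y l] x by auto
    then have "(\<Phi> has_field_derivative deriv \<Phi> (y - ?l x)) (at (y - ?l x))"
      using \<Phi> holomorphic_derivI by blast
    then have "((\<lambda>y. \<Phi> (y - ?l x)) has_field_derivative deriv \<Phi> (y - ?l x)) (at y)"
      using DERIV_shift[of \<Phi> _ y "- ?l x"] by simp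
    then show "((\<lambda>y. \<phi> (?l x) * \<Phi> (y - ?l x) * (q - p)) has_field_derivative
        \<phi> (?l x) * deriv \<Phi> (y - ?l x) * (q - p)) (at y within U)"
      by (rule DERIV_cmult_right[OF DERIV_cmult[OF has_field_derivative_at_within]])
  next
    fix y assume y: "y \<in> U"
    have "continuous_on {0..1} (\<lambda>x. y - ?l x)"
      by (intro continuous_on_diff continuous_on_const cl)
    then have "continuous_on {0..1} (\<lambda>x. \<Phi> (y - ?l x))"
      by (rule continuous_on_compose2[OF cA(1)]) (use U(4)[OF y l] in blast)
    then show "(\<lambda>x. \<phi> (?l x) * \<Phi> (y - ?l x) * (q - p)) integrable_on cbox 0 1"
      unfolding cbox_interval
      by (intro integrable_continuous_real continuous_on_mult c\<phi> continuous_on_const)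
  next
    have snd: "continuous_on (U \<times> {0..1}) (\<lambda>x. h (snd x))" if "continuous_on {0..1::real} h" for h :: "real \<Rightarrow> complex"
      by (rule continuous_on_compose2[OF that continuous_on_snd[OF continuous_on_id]]) auto
    have "continuous_on (U \<times> {0..1}) (\<lambda>x. fst x - ?l (snd x))"
      by (intro continuous_on_diff snd[OF cl] continuous_on_fst continuous_on_id)
    then have "continuous_on (U \<times> {0..1}) (\<lambda>x. deriv \<Phi> (fst x - ?l (snd x)))"
      by (rule continuous_on_compose2[OF cA(2)]) (use U(4) l in force)
    then show "continuous_on (U \<times> cbox 0 1) (\<lambda>(y, x). \<phi> (?l x) * deriv \<Phi> (y - ?l x) * (q - p))"
      unfolding cbox_interval case_prod_unfold
      by (intro continuous_on_mult snd[OF c\<phi>] continuous_on_const)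
  qed
  then show ?thesis unfolding eq at_within_open[OF U(3,1)] .
qed

section \<open>Operations on compatible families and linearity of polygon integrals\<close>

lemma function_elements_subset:
  assumes "function_elements \<gamma> R \<delta> F" "R' \<le> R" "\<delta>' \<le> \<delta>"
  shows "function_elements \<gamma> R' \<delta>' F"
  unfolding function_elements_def
proof (intro conjI ballI impI)
  fix s :: real assume s: "s \<in> {0..1}"
  show "F s holomorphic_on ball (\<gamma> s) R'"
    using function_elements_holomorphic[OF assms(1) s] subset_ball[OF assms(2)] by (rule holomorphic_on_subset)
  fix s' :: real and w assume "s' \<in> {0..1}" "\<bar>s - s'\<bar> < \<delta>'" "w \<in> ball (\<gamma> s) R' \<inter> ball (\<gamma> s') R'"
  then show "F s w = F s' w"
    using assms(2,3) s by (intro function_elements_agree[OF assms(1)]) auto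
qed

lemma function_elements_add:
  assumes F: "function_elements \<gamma> R \<delta> F" and G: "function_elements \<gamma> R \<delta> G"
  shows "function_elements \<gamma> R \<delta> (\<lambda>s w. F s w + G s w)"
  unfolding function_elements_def
proof (intro conjI ballI impI)
  fix s :: real assume s: "s \<in> {0..1}"
  show "(\<lambda>w. F s w + G s w) holomorphic_on ball (\<gamma> s) R"
    by (intro holomorphic_on_add function_elements_holomorphic[OF F s] function_elements_holomorphic[OF G s])
  fix s' w assume *: "s' \<in> {0..1}" "\<bar>s - s'\<bar> < \<delta>" "w \<in> ball (\<gamma> s) R \<inter> ball (\<gamma> s') R"
  then show "F s w + G s w = F s' w + G s' w"
    using function_elements_agree[OF F s *(1,2)] function_elements_agree[OF G s *(1,2)] by simp
qed

lemma function_elements_mult: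
  assumes F: "function_elements \<gamma> R \<delta> F" and G: "function_elements \<gamma> R \<delta> G"
  shows "function_elements \<gamma> R \<delta> (\<lambda>s w. F s w * G s w)"
  unfolding function_elements_def
proof (intro conjI ballI impI)
  fix s :: real assume s: "s \<in> {0..1}"
  show "(\<lambda>w. F s w * G s w) holomorphic_on ball (\<gamma> s) R"
    by (intro holomorphic_on_mult function_elements_holomorphic[OF F s] function_elements_holomorphic[OF G s])
  fix s' w assume *: "s' \<in> {0..1}" "\<bar>s - s'\<bar> < \<delta>" "w \<in> ball (\<gamma> s) R \<inter> ball (\<gamma> s') R"
  then show "F s w * G s w = F s' w * G s' w"
    using function_elements_agree[OF F s *(1,2)] function_elements_agree[OF G s *(1,2)] by simp
qed

lemma function_elements_fixed:
  assumes "h holomorphic_on U" "\<And>s. s \<in> {0..1} \<Longrightarrow> ball (\<gamma> s) R \<subseteq> U"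
  shows "function_elements \<gamma> R \<delta> (\<lambda>_. h)"
  unfolding function_elements_def
  by (intro conjI ballI impI refl holomorphic_on_subset[OF assms(1)] assms(2))

text \<open>The radius \<open>2 * R\<close> is split: \<open>R\<close> for the distance of
  \<open>z\<close> from \<open>z0\<close> and \<open>R\<close> for that of \<open>w\<close> from
  \<open>\<gamma> s\<close>. One family \<open>\<Phi>\<close>, continued for \<open>z0\<close>, thus
  serves all nearby \<open>z\<close>.\<close>

lemma function_elements_reflect:
  assumes \<Phi>: "function_elements (\<lambda>s. z0 - \<gamma> s) (2 * R) \<delta> \<Phi>" and z: "z \<in> ball z0 R"
  shows "function_elements \<gamma> R \<delta> (\<lambda>s w. \<Phi> s (z - w))"
proof -
  have sub: "z - w \<in> ball (z0 - \<gamma> s) (2 * R)" if "w \<in> ball (\<gamma> s) R" for s w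
  proof -
    have eq: "z0 - \<gamma> s - (z - w) = (z0 - z) - (\<gamma> s - w)" by simp
    show ?thesis unfolding mem_ball dist_norm eq using that z norm_triangle_ineq4[of "z0 - z" "\<gamma> s - w"] by (simp add: dist_norm)
  qed
  show ?thesis
    unfolding function_elements_def
  proof (intro conjI ballI impI)
    fix s :: real assume s: "s \<in> {0..1}"
    show "(\<lambda>w. \<Phi> s (z - w)) holomorphic_on ball (\<gamma> s) R"
      by (rule holomorphic_on_compose_gen[OF _ function_elements_holomorphic[OF \<Phi> s], unfolded o_def])
        (use sub in \<open>auto intro!: holomorphic_intros\<close>)
    fix s' w assume *: "s' \<in> {0..1}" "\<bar>s - s'\<bar> < \<delta>" "w \<in> ball (\<gamma> s) R \<inter> ball (\<gamma> s') R"
    then show "\<Phi> s (z - w) = \<Phi> s' (z - w)"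
      using sub by (intro function_elements_agree[OF \<Phi> s *(1,2)]) auto
  qed
qed

lemma fine_for_integrable:
  assumes K: "function_elements \<gamma> R \<delta> K" and N: "fine_for \<gamma> R \<delta> N" and i: "i < N"
  shows "K (real i / real N) contour_integrable_on linepath (\<gamma> (real i / real N)) (\<gamma> (real (Suc i) / real N))"
proof (rule contour_integrable_continuous_linepath)
  note part = fine_for_partition[OF N i]
  show "continuous_on (closed_segment (\<gamma> (real i / real N)) (\<gamma> (real (Suc i) / real N))) (K (real i / real N))"
    by (rule continuous_on_subset[OF holomorphic_on_imp_continuous_on[OF function_elements_holomorphic[OF K part(1)]] part(5)])
qed

lemma polygon_integral_add:
  assumes "function_elements \<gamma> R \<delta> K" "function_elements \<gamma> R \<delta> L" "fine_for \<gamma> R \<delta> N"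
  shows "polygon_integral \<gamma> N (\<lambda>s w. K s w + L s w) = polygon_integral \<gamma> N K + polygon_integral \<gamma> N L"
  unfolding polygon_integral_def sum.distrib[symmetric]
  by (intro sum.cong refl contour_integral_add fine_for_integrable[OF assms(1,3)] fine_for_integrable[OF assms(2,3)])
    simp_all

lemma polygon_integral_cmult:
  assumes "function_elements \<gamma> R \<delta> K" "fine_for \<gamma> R \<delta> N"
  shows "polygon_integral \<gamma> N (\<lambda>s w. c * K s w) = c * polygon_integral \<gamma> N K"
  unfolding polygon_integral_def sum_distrib_left
  by (intro sum.cong refl contour_integral_lmul fine_for_integrable[OF assms]) simp

lemma polygon_integral_cong:
  assumes N: "fine_for \<gamma> R \<delta> N"
    and eq: "\<And>s w. s \<in> {0..1} \<Longrightarrow> w \<in> ball (\<gamma> s) R \<Longrightarrow> K s w = L s w"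
  shows "polygon_integral \<gamma> N K = polygon_integral \<gamma> N L"
  unfolding polygon_integral_def
proof (rule sum.cong[OF refl])
  fix i assume "i \<in> {..<N}"
  then have i: "i < N" by simp
  note part = fine_for_partition[OF N i]
  show "contour_integral (linepath (\<gamma> (real i / real N)) (\<gamma> (real (Suc i) / real N))) (K (real i / real N))
      = contour_integral (linepath (\<gamma> (real i / real N)) (\<gamma> (real (Suc i) / real N))) (L (real i / real N))"
    by (rule contour_integral_eq) (use eq[OF part(1)] part(5) in auto)
qed

section \<open>Pochhammer contours\<close>

lemma homotopic_paths_conjugate_null:
  assumes \<gamma>: "homotopic_paths S c (linepath q q)"
    and \<delta>: "path \<delta>" "path_image \<delta> \<subseteq> S" "pathfinish \<delta> = q"
  shows "homotopic_paths S (\<delta> +++ c +++ reversepath \<delta>) (linepath (pathstart \<delta>) (pathstart \<delta>))"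
proof -
  have q: "q \<in> S" using \<delta> by (metis pathfinish_in_path_image subsetD)
  have c: "pathstart c = q" "pathfinish c = q"
    using homotopic_paths_imp_pathstart[OF \<gamma>] homotopic_paths_imp_pathfinish[OF \<gamma>] by auto
  have rev: "path (reversepath \<delta>)" "path_image (reversepath \<delta>) \<subseteq> S" "pathstart (reversepath \<delta>) = q"
    using \<delta> by auto
  have "homotopic_paths S (c +++ reversepath \<delta>) (linepath q q +++ reversepath \<delta>)"
    by (rule homotopic_paths_join[OF \<gamma>]) (use \<delta> c in auto)
  also have "homotopic_paths S (linepath q q +++ reversepath \<delta>) (reversepath \<delta>)"
    using homotopic_paths_lid[OF rev(1,2)] rev(3) by simp
  finally have "homotopic_paths S (\<delta> +++ c +++ reversepath \<delta>) (\<delta> +++ reversepath \<delta>)"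
    by (intro homotopic_paths_join) (use \<delta> c in auto)
  also have "homotopic_paths S (\<delta> +++ reversepath \<delta>) (linepath (pathstart \<delta>) (pathstart \<delta>))"
    by (rule homotopic_paths_rinv[OF \<delta>(1,2)])
  finally show ?thesis .
qed

text \<open>Once the puncture \<open>p\<close> is filled in, the small circle contracts within its
  own disc, and the path leading to it is then retraced.\<close>

lemma turns_once_around_null_homotopic:
  assumes "turns_once_around S q p \<gamma>" "S \<subseteq> S'" "p \<in> S'"
  shows "homotopic_paths S' \<gamma> (linepath q q)"
proof -
  obtain r \<delta> where r: "r > 0" "cball p r - {p} \<subseteq> S"
    and \<delta>: "path \<delta>" "path_image \<delta> \<subseteq> S" "pathstart \<delta> = q" "pathfinish \<delta> = p + of_real r"
    and hom: "homotopic_paths S \<gamma> (\<delta> +++ circlepath p r +++ reversepath \<delta>)"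
    using assms(1) unfolding turns_once_around_def by blast
  have sub: "cball p r \<subseteq> S'" using r assms by blast
  have "homotopic_paths (cball p r) (circlepath p r) (linepath (p + of_real r) (p + of_real r))"
  proof -
    have "simply_connected (cball p r)" by (simp add: convex_imp_simply_connected)
    moreover have "path_image (circlepath p r) \<subseteq> cball p r" using r(1) by (auto simp: path_image_circlepath)
    ultimately show ?thesis
      unfolding simply_connected_eq_contractible_path by (auto dest!: spec[of _ "circlepath p r"])
  qed
  then have "homotopic_paths S' (circlepath p r) (linepath (p + of_real r) (p + of_real r))"
    using sub homotopic_paths_subset by blast
  then have "homotopic_paths S' (\<delta> +++ circlepath p r +++ reversepath \<delta>) (linepath q q)"
    using homotopic_paths_conjugate_null[of S' "circlepath p r" "p + of_real r" \<delta>] \<delta> assms(2) by auto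
  with homotopic_paths_subset[OF hom assms(2)] show ?thesis
    by (rule homotopic_paths_trans)
qed

text \<open>The last three factors form a conjugate of the contractible loop
  \<open>reversepath \<gamma>\<close>. Nothing but the domain of \<open>\<gamma>'\<close> matters,
  so infinity is covered as well.\<close>

lemma pochhammer_null_homotopic:
  assumes \<gamma>: "homotopic_paths S \<gamma> (linepath q q)"
    and \<gamma>': "path \<gamma>'" "path_image \<gamma>' \<subseteq> S" "pathstart \<gamma>' = q" "pathfinish \<gamma>' = q"
  shows "homotopic_paths S (pochhammer_contour \<gamma> \<gamma>') (linepath q q)"
proof -
  have \<gamma>ends: "pathstart \<gamma> = q" "pathfinish \<gamma> = q"
    using homotopic_paths_imp_pathstart[OF \<gamma>] homotopic_paths_imp_pathfinish[OF \<gamma>] by auto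
  have "homotopic_paths S (reversepath \<gamma>) (reversepath (linepath q q))"
    using \<gamma> homotopic_paths_reversepath by blast
  then have "homotopic_paths S (reversepath \<gamma>) (linepath q q)" by simp
  from homotopic_paths_conjugate_null[OF this \<gamma>'(1,2,4)]
  have "homotopic_paths S (\<gamma>' +++ reversepath \<gamma> +++ reversepath \<gamma>') (linepath q q)"
    using \<gamma>' by simp
  with \<gamma> have "homotopic_paths S (\<gamma> +++ \<gamma>' +++ reversepath \<gamma> +++ reversepath \<gamma>') (linepath q q +++ linepath q q)"
    by (intro homotopic_paths_join) (use \<gamma>' \<gamma>ends in auto)
  also have "homotopic_paths S (linepath q q +++ linepath q q) (linepath q q)"
    using homotopic_paths_lid[of "linepath q q" S] homotopic_paths_imp_subset[OF \<gamma>] by simp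
  finally show ?thesis by (simp add: pochhammer_contour_def)
qed

lemma turns_once_around_loop:
  assumes "turns_once_around S q p \<gamma>"
  shows "path \<gamma>" "path_image \<gamma> \<subseteq> S" "pathstart \<gamma> = q" "pathfinish \<gamma> = q"
proof -
  obtain r \<delta> where "path \<delta>" "path_image \<delta> \<subseteq> S" "pathstart \<delta> = q" "pathfinish \<delta> = p + of_real r"
    and hom: "homotopic_paths S \<gamma> (\<delta> +++ circlepath p r +++ reversepath \<delta>)"
    using assms(1) unfolding turns_once_around_def by blast
  then show "path \<gamma>" "path_image \<gamma> \<subseteq> S" "pathstart \<gamma> = q" "pathfinish \<gamma> = q"
    using homotopic_paths_imp_path[OF hom] homotopic_paths_imp_subset[OF hom]
      homotopic_paths_imp_pathstart[OF hom] homotopic_paths_imp_pathfinish[OF hom] by auto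
qed

lemma turns_once_around_infinity_loop:
  assumes "turns_once_around_infinity S q \<gamma>"
  shows "path \<gamma>" "path_image \<gamma> \<subseteq> S" "pathstart \<gamma> = q" "pathfinish \<gamma> = q"
proof -
  obtain R \<delta> c where "path \<delta>" "path_image \<delta> \<subseteq> S" "pathstart \<delta> = q" "pathfinish \<delta> = of_real R"
    and hom: "homotopic_paths S \<gamma> (\<delta> +++ c +++ reversepath \<delta>)"
    using assms(1) unfolding turns_once_around_infinity_def by blast
  then show "path \<gamma>" "path_image \<gamma> \<subseteq> S" "pathstart \<gamma> = q" "pathfinish \<gamma> = q"
    using homotopic_paths_imp_path[OF hom] homotopic_paths_imp_subset[OF hom]
      homotopic_paths_imp_pathstart[OF hom] homotopic_paths_imp_pathfinish[OF hom] by auto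
qed

lemma pochhammer_contour_loop:
  assumes "valid_path \<gamma>" "path_image \<gamma> \<subseteq> S" "pathstart \<gamma> = q" "pathfinish \<gamma> = q"
    and "valid_path \<gamma>'" "path_image \<gamma>' \<subseteq> S" "pathstart \<gamma>' = q" "pathfinish \<gamma>' = q"
  shows "valid_path (pochhammer_contour \<gamma> \<gamma>')" "path_image (pochhammer_contour \<gamma> \<gamma>') \<subseteq> S"
    "pathstart (pochhammer_contour \<gamma> \<gamma>') = q" "pathfinish (pochhammer_contour \<gamma> \<gamma>') = q"
  using assms by (auto simp: pochhammer_contour_def path_image_join)

text \<open>Winding numbers add under joining and change sign under reversal, so they cancel in a
  commutator. In a once-punctured plane this means contractibility.\<close>

lemma winding_number_pochhammer:
  assumes "valid_path \<gamma>" "z \<notin> path_image \<gamma>" "pathstart \<gamma> = q" "pathfinish \<gamma> = q"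
    and "valid_path \<gamma>'" "z \<notin> path_image \<gamma>'" "pathstart \<gamma>' = q" "pathfinish \<gamma>' = q"
  shows "winding_number (pochhammer_contour \<gamma> \<gamma>') z = 0"
  using assms
  by (simp add: pochhammer_contour_def winding_number_join winding_number_reversepath valid_path_imp_path
      not_in_path_image_join path_image_reversepath valid_path_join valid_path_imp_reverse)

section \<open>The algebra of the convolution\<close>

text \<open>Entries of degree at most 2 over z (z - 1) (z - t) are determined by their residues at
  0, 1, t; this is what allows matrices to be compared through residues.\<close>

definition quadratic :: "(complex \<Rightarrow> complex) \<Rightarrow> bool" where
  "quadratic f \<longleftrightarrow> (\<exists>\<alpha> \<beta> \<gamma>. \<forall>z. f z = \<alpha> + \<beta> * z + \<gamma> * z\<^sup>2)"

lemma quadraticI: "(\<And>z. f z = \<alpha> + \<beta> * z + \<gamma> * z\<^sup>2) \<Longrightarrow> quadratic f"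
  unfolding quadratic_def by blast

lemma quadratic_add:
  assumes "quadratic f" "quadratic g" shows "quadratic (\<lambda>z. f z + g z)"
proof -
  obtain \<alpha> \<beta> \<gamma> \<alpha>' \<beta>' \<gamma>' where "\<And>z. f z = \<alpha> + \<beta> * z + \<gamma> * z\<^sup>2" "\<And>z. g z = \<alpha>' + \<beta>' * z + \<gamma>' * z\<^sup>2"
    using assms unfolding quadratic_def by blast
  then show ?thesis
    by (intro quadraticI[of _ "\<alpha> + \<alpha>'" "\<beta> + \<beta>'" "\<gamma> + \<gamma>'"]) (simp add: algebra_simps)
qed

lemma quadratic_cmult:
  assumes "quadratic f" shows "quadratic (\<lambda>z. c * f z)"
proof -
  obtain \<alpha> \<beta> \<gamma> where "\<And>z. f z = \<alpha> + \<beta> * z + \<gamma> * z\<^sup>2"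
    using assms unfolding quadratic_def by blast
  then show ?thesis
    by (intro quadraticI[of _ "c * \<alpha>" "c * \<beta>" "c * \<gamma>"]) (simp add: algebra_simps)
qed

text \<open>Lagrange interpolation at 0, 1, t: the weights \<open>t\<close>, \<open>1 - t\<close>,
  \<open>t * (t - 1)\<close> are the values there of the derivative of z (z - 1) (z - t).\<close>

lemma quadratic_partial_fractions:
  assumes "quadratic f" and "t \<noteq> 0" "t \<noteq> 1" "z \<noteq> 0" "z \<noteq> 1" "z \<noteq> t"
  shows "f 0 / t / z + f 1 / (1 - t) / (z - 1) + f t / (t * (t - 1)) / (z - t) = f z / (z * (z - 1) * (z - t))"
proof -
  obtain \<alpha> \<beta> \<gamma> where f: "\<And>z. f z = \<alpha> + \<beta> * z + \<gamma> * z\<^sup>2"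
    using assms unfolding quadratic_def by blast
  have nz: "t - 1 \<noteq> 0" "1 - t \<noteq> 0" "z - 1 \<noteq> 0" "z - t \<noteq> 0" using assms by auto
  let ?d = "t * (t - 1) * (z * (z - 1) * (z - t))"
  have 1: "f 0 / t / z = f 0 * ((t - 1) * (z - 1) * (z - t)) / ?d"
    using assms nz by simp
  have "f 1 / (1 - t) / (z - 1) = - f 1 / (t - 1) / (z - 1)"
    by (metis minus_diff_eq minus_divide_divide minus_minus)
  also have "\<dots> = - f 1 * (t * z * (z - t)) / ?d"
    using assms nz by simp
  finally have 2: "f 1 / (1 - t) / (z - 1) = - f 1 * (t * z * (z - t)) / ?d" .
  have 3: "f t / (t * (t - 1)) / (z - t) = f t * (z * (z - 1)) / ?d"
    using assms nz by simp
  have 4: "f z / (z * (z - 1) * (z - t)) = t * (t - 1) * f z / ?d"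
    using assms nz by simp
  have "f 0 * ((t - 1) * (z - 1) * (z - t)) + (- f 1 * (t * z * (z - t))) + f t * (z * (z - 1)) = t * (t - 1) * f z"
    unfolding f by (simp add: algebra_simps power2_eq_square)
  then show ?thesis unfolding 1 2 3 4 by (simp only: add_divide_distrib[symmetric])
qed

text \<open>The comparison of residues, isolated as polynomial identities for Groebner bases. In the
  application \<open>l\<close> is \<open>lam'\<close>, \<open>D\<close> is
  \<open>lam - lam'\<close>, and \<open>\<alpha>\<close>, \<open>\<beta>\<close>,
  \<open>\<gamma>\<close> are the first three terms of \<open>\<mu>'\<close>; then \<open>M\<close>
  is \<open>\<mu>'\<close>, \<open>\<theta>\<close> is \<open>\<theta>inf\<close> and
  \<open>E\<close> is \<open>\<mu> * Q lam\<close>.\<close>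

lemma residue_polynomial_identities:
  fixes l t D \<nu> \<alpha> \<beta> \<gamma> :: complex
  defines "M \<equiv> \<alpha> + \<beta> + \<gamma> + \<nu>"
    and "\<theta> \<equiv> \<nu> * D - \<alpha> * l - \<beta> * (l - 1) - \<gamma> * (l - t)"
    and "E \<equiv> \<nu> * ((l + D) * (l + D - 1) * (l + D - t)) + ((\<alpha> * l - \<nu> * D) * (l + D - 1) * (l + D - t)
       + (\<beta> * (l - 1) - \<nu> * D) * (l + D) * (l + D - t) + (\<gamma> * (l - t) - \<nu> * D) * (l + D) * (l + D - 1))"
  shows "l * (l - 1) * (l - t) * M\<^sup>2
      + (2 * \<theta> * (l - 1) * (l - t) - \<beta> * (l - 1) * (l - t) - t * (\<gamma> * (l - t)) * (l - 1)) * M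
      + \<theta> * (\<theta> * (l - t - 1) - \<beta> * (l - 1) - t * (\<gamma> * (l - t)))
      = (\<theta> + \<nu> * D) * (\<alpha> * t + \<nu> * (l + D - 1) * (l + D - t)) + \<nu> * E"
    and "l * (l - 1) * (l - t) * M\<^sup>2
      + (2 * \<theta> * (l - 1) * (l - t) + (\<theta> + \<nu> * D - \<beta> * (l - 1)) * (l - t) - t * (\<gamma> * (l - t)) * (l - 1)) * M
      + \<theta> * (\<theta> * (l - t + 1) + \<alpha> * l - (t - 1) * (\<gamma> * (l - t)))
      = (\<theta> + \<nu> * D) * (\<beta> * (1 - t) + \<nu> * (l + D) * (l + D - t)) + \<nu> * E"
    and "l * (l - 1) * (l - t) * M\<^sup>2
      + (2 * \<theta> * (l - 1) * (l - t) - \<beta> * (l - 1) * (l - t) + t * (\<theta> + \<nu> * D - \<gamma> * (l - t)) * (l - 1)) * M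
      + \<theta> * (\<theta> * (l - t + 1) + \<alpha> * l + (t - 1) * (\<theta> + \<nu> * D - \<gamma> * (l - t)))
      = (\<theta> + \<nu> * D) * (\<gamma> * (t * (t - 1)) + \<nu> * (l + D) * (l + D - 1)) + \<nu> * E"
  unfolding M_def \<theta>_def E_def by algebra+

text \<open>
  Notation for the computation: \<open>\<kappa>\<close> is \<open>\<kappa>\<^sub>2\<close>, so that \<open>\<theta>\<^sub>\<infinity> = - 2 \<kappa> - \<sigma>\<close>, and \<open>\<nu>\<close> is the denominator
  of the correction term in \<open>lam'\<close>. The matrix \<open>(m11, m12; m21, m22)\<close>, divided by \<open>Q\<close>, is the
  coefficient matrix of the transformed system in the gauge where the second unknown is the
  transform of \<open>(y' - \<mu> y) / (w - lam)\<close>.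
\<close>
locale dy_parameters =
  fixes t \<theta>0 \<theta>1 \<theta>t \<kappa> lam \<mu> :: complex
  assumes t: "t \<noteq> 0" "t \<noteq> 1" and lam: "lam \<noteq> 0" "lam \<noteq> 1" "lam \<noteq> t"
begin

definition "\<sigma> = \<theta>0 + \<theta>1 + \<theta>t"
definition "\<kappa>1 = - \<kappa> - \<sigma>"
definition "Q z = z * (z - 1) * (z - t)"
definition "Q' z = 3 * z\<^sup>2 - 2 * (1 + t) * z + t"
text \<open>Divided differences appear throughout: \<open>q\<close> is that of \<open>Q\<close>;
  with \<open>e\<close> below, \<open>w + z + e\<close> is the second one of \<open>Q\<close> at
  \<open>z\<close>, \<open>w\<close>, \<open>lam\<close>, and \<open>2 * w + e\<close> is the
  derivative of \<open>q w lam\<close> in \<open>w\<close>. As \<open>\<Theta>1\<close> is the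
  linear coefficient of \<open>\<Theta>\<close>, the divided difference of \<open>\<Theta>\<close>
  at \<open>z\<close> and \<open>lam\<close> is
  \<open>\<sigma> * (z + lam) + \<Theta>1\<close>.\<close>

definition "q z w = z\<^sup>2 + z * w + w\<^sup>2 - (1 + t) * (z + w) + t"
definition "\<Theta> z = \<theta>0 * (z - 1) * (z - t) + \<theta>1 * z * (z - t) + \<theta>t * z * (z - 1)"
definition "p z = (1 - \<theta>0) / z + (1 - \<theta>1) / (z - 1) + (1 - \<theta>t) / (z - t)"
definition "\<nu> = \<mu> - \<theta>0 / lam - \<theta>1 / (lam - 1) - \<theta>t / (lam - t)"
definition "e = lam - 1 - t"
definition "\<Theta>1 = - \<theta>0 * (1 + t) - \<theta>1 * t - \<theta>t"
text \<open>What the scalar equation leaves as coefficient of y after y' = \<mu> y + (w - lam) v is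
  inserted, multiplied by \<open>Q\<close> and with the factor w - lam divided out.\<close>

definition "R w = \<kappa>1 * (1 + \<kappa>) + \<mu> * (2 * w + e) - \<mu> * (\<sigma> * (w + lam) + \<Theta>1) + \<mu>\<^sup>2 * q w lam"
definition "m22 z = \<kappa> * q z lam - \<nu> * Q lam"
definition "m21 z = \<kappa> * (2 * z + e) + \<sigma> * (z + lam) + \<Theta>1 - \<mu> * q z lam"
definition "m12 z = - (\<nu> * Q lam * (z - lam)) - \<kappa> * Q lam"
definition "m11 z = \<kappa> * Q' z + \<Theta> z + \<nu> * Q lam - \<kappa> * q z lam"

lemmas poly_defs = \<sigma>_def \<kappa>1_def Q_def Q'_def q_def \<Theta>_def e_def \<Theta>1_def R_def m22_def m21_def m12_def m11_def

lemma Q_nonzero: "z \<notin> {0, 1, t} \<Longrightarrow> Q z \<noteq> 0"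
  by (auto simp: Q_def)

lemma \<nu>_Q_lam: "\<nu> * Q lam = \<mu> * Q lam - \<Theta> lam"
proof -
  have "lam - 1 \<noteq> 0" "lam - t \<noteq> 0" using lam by auto
  then have "\<theta>0 / lam * Q lam = \<theta>0 * (lam - 1) * (lam - t)" "\<theta>1 / (lam - 1) * Q lam = \<theta>1 * lam * (lam - t)"
      "\<theta>t / (lam - t) * Q lam = \<theta>t * lam * (lam - 1)"
    using lam by (simp_all add: Q_def)
  then show ?thesis by (simp add: \<nu>_def \<Theta>_def left_diff_distrib)
qed

lemma Q_diff: "Q z - Q w = (z - w) * q z w"
  by (simp add: Q_def q_def algebra_simps power2_eq_square)

lemma Q_p:
  assumes "z \<notin> {0, 1, t}"
  shows "Q z * p z = Q' z - \<Theta> z"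
proof -
  have "z \<noteq> 0" "z - 1 \<noteq> 0" "z - t \<noteq> 0" using assms by auto
  then have "Q z * ((1 - \<theta>0) / z) = (1 - \<theta>0) * (z - 1) * (z - t)"
      "Q z * ((1 - \<theta>1) / (z - 1)) = (1 - \<theta>1) * z * (z - t)"
      "Q z * ((1 - \<theta>t) / (z - t)) = (1 - \<theta>t) * z * (z - 1)"
    by (simp_all add: Q_def)
  then have "Q z * p z = (1 - \<theta>0) * (z - 1) * (z - t) + (1 - \<theta>1) * z * (z - t) + (1 - \<theta>t) * z * (z - 1)"
    by (simp add: p_def distrib_left)
  then show ?thesis by (simp add: Q'_def \<Theta>_def algebra_simps power2_eq_square)
qed

text \<open>Together with \<open>m11_eq\<close> this is X' = \<mu> X + (z - lam) Z' - \<kappa> Z,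
  multiplied by \<open>Q\<close> and with Z' eliminated by the second row.\<close>

lemma m12_eq: "m12 z = (z - lam) * m22 z - \<kappa> * Q z"
  using Q_diff[of z lam] unfolding m12_def m22_def by algebra

lemma m11_eq: "m11 z = (z - lam) * m21 z + \<mu> * Q z"
  unfolding m11_def m21_def \<nu>_Q_lam unfolding poly_defs by algebra

text \<open>At a zero of \<open>Q\<close> the first row is a multiple of the second. The vanishing
  determinant matches the shape of \<open>DY_residue\<close>.\<close>

lemma m_det:
  assumes "z \<in> {0, 1, t}"
  shows "m11 z * m22 z = m12 z * m21 z"
proof -
  have "Q z = 0" using assms by (auto simp: Q_def)
  then show ?thesis by (simp add: m12_eq m11_eq)
qed

lemma quadratic_q: "quadratic (\<lambda>z. q z lam)"
  by (rule quadraticI[of _ "lam\<^sup>2 - (1 + t) * lam + t" "lam - (1 + t)" 1])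
    (simp add: q_def algebra_simps power2_eq_square)

lemma quadratic_linear: "quadratic (\<lambda>z. x * z + y)"
  by (rule quadraticI[of _ y x 0]) simp

lemma quadratic_m:
  "quadratic m11" "quadratic m12" "quadratic m21" "quadratic m22"
proof -
  have "quadratic (\<lambda>z. Q' z)"
    by (rule quadraticI[of _ t "- 2 * (1 + t)" 3]) (simp add: Q'_def algebra_simps)
  moreover have "quadratic \<Theta>"
    by (rule quadraticI[of _ "\<theta>0 * t" \<Theta>1 \<sigma>]) (simp add: \<Theta>_def \<Theta>1_def \<sigma>_def algebra_simps power2_eq_square)
  ultimately have "quadratic (\<lambda>z. (\<kappa> * Q' z + \<Theta> z) + ((0 * z + \<nu> * Q lam) + (- \<kappa>) * q z lam))"
    by (intro quadratic_add quadratic_cmult quadratic_q quadratic_linear)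
  then show "quadratic m11" by (simp add: m11_def[abs_def] algebra_simps)
  have "quadratic (\<lambda>z. (- (\<nu> * Q lam)) * z + (\<nu> * Q lam * lam - \<kappa> * Q lam))" by (rule quadratic_linear)
  then show "quadratic m12" by (simp add: m12_def[abs_def] algebra_simps)
  have "quadratic (\<lambda>z. (2 * \<kappa> + \<sigma>) * z + (\<kappa> * e + \<sigma> * lam + \<Theta>1) + (- \<mu>) * q z lam)"
    by (intro quadratic_add quadratic_cmult quadratic_q quadratic_linear)
  then show "quadratic m21" by (simp add: m21_def[abs_def] algebra_simps)
  have "quadratic (\<lambda>z. \<kappa> * q z lam + (0 * z + (- (\<nu> * Q lam))))"
    by (intro quadratic_add quadratic_cmult quadratic_q quadratic_linear)
  then show "quadratic m22" by (simp add: m22_def[abs_def])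
qed

text \<open>The apparent singularity: \<open>H\<close> is exactly what makes the left-hand side vanish at \<open>w = lam\<close>.\<close>
lemma apparent_singularity:
  assumes w: "w \<notin> {0, 1, t, lam}"
    and H: "t * (t - 1) * H = Q lam * \<mu>\<^sup>2
       - (\<theta>0 * (lam - 1) * (lam - t) + \<theta>1 * lam * (lam - t) + (\<theta>t - 1) * lam * (lam - 1)) * \<mu>
       + \<kappa>1 * (\<kappa> + 1) * (lam - t)"
  shows "(p w + \<mu>) * \<mu> + (\<kappa>1 * (\<kappa> + 1) / (w * (w - 1)) + lam * (lam - 1) * \<mu> / (w * (w - 1) * (w - lam))
     - t * (t - 1) * H / (w * (w - 1) * (w - t))) - \<mu> / (w - lam) = (w - lam) * (R w / Q w)"
proof -
  have nz: "w \<noteq> 0" "w - 1 \<noteq> 0" "w - t \<noteq> 0" "w - lam \<noteq> 0" "Q w \<noteq> 0" using w Q_nonzero by auto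
  have 1: "\<kappa>1 * (\<kappa> + 1) / (w * (w - 1)) = \<kappa>1 * (\<kappa> + 1) * (w - t) / Q w"
    using nz by (simp add: Q_def)
  have 2: "lam * (lam - 1) * \<mu> / (w * (w - 1) * (w - lam)) - \<mu> / (w - lam) = - ((w - t) * (w + lam - 1) * \<mu> / Q w)"
  proof -
    have "lam * (lam - 1) * \<mu> / (w * (w - 1) * (w - lam)) - \<mu> / (w - lam)
        = (lam * (lam - 1) * \<mu> - \<mu> * (w * (w - 1))) / (w * (w - 1) * (w - lam))"
      using nz by (simp add: diff_divide_distrib)
    also have "lam * (lam - 1) * \<mu> - \<mu> * (w * (w - 1)) = - ((w + lam - 1) * \<mu>) * (w - lam)"
      by (simp add: algebra_simps)
    finally show ?thesis using nz by (simp add: Q_def)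
  qed
  have 3: "p w = (Q' w - \<Theta> w) / Q w" using Q_p[of w] w nz(5) by (simp add: field_simps)
  have "(Q' w - \<Theta> w + \<mu> * Q w) * \<mu> + \<kappa>1 * (\<kappa> + 1) * (w - t) - (w - t) * (w + lam - 1) * \<mu> - t * (t - 1) * H = (w - lam) * R w"
    unfolding H poly_defs by algebra
  then have 5: "((Q' w - \<Theta> w + \<mu> * Q w) * \<mu> + \<kappa>1 * (\<kappa> + 1) * (w - t) - (w - t) * (w + lam - 1) * \<mu> - t * (t - 1) * H) / Q w = (w - lam) * (R w / Q w)"
    by simp
  have 0: "(p w + \<mu>) * \<mu> = (Q' w - \<Theta> w + \<mu> * Q w) * \<mu> / Q w"
    using nz(5) by (simp add: 3 field_simps)
  have 4: "t * (t - 1) * H / (w * (w - 1) * (w - t)) = t * (t - 1) * H / Q w" by (simp add: Q_def)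
  have reorder: "X + (a + b - c) - d = X + a + (b - d) - c" for X a b c d :: complex by simp
  then show ?thesis
    unfolding reorder 0 1 2 4 5[symmetric] by (simp add: diff_divide_distrib add_divide_distrib)
qed

text \<open>
  \<open>A w F - Q w G\<close>, multiplied by \<open>(z - w)\<^sup>\<kappa>\<close>, is the primitive that expresses the derivative of
  the transform of \<open>G\<close> by the transforms of \<open>F'\<close> and \<open>G\<close>.
\<close>
definition "A z w = (w - z) * (- \<kappa>1 - \<mu> * (w + z + e))"
definition "A' w = - \<kappa>1 - \<mu> * (2 * w + e)"

lemma A_derivative: "(A z has_field_derivative A' w) (at w)"
  unfolding A_def[abs_def] A'_def by (auto intro!: derivative_eq_intros simp: algebra_simps)

lemma Q_derivative: "(Q has_field_derivative Q' w) (at w)"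
  unfolding Q_def[abs_def] Q'_def by (auto intro!: derivative_eq_intros simp: algebra_simps power2_eq_square)

text \<open>The factor \<open>w - z\<close> of \<open>A\<close> cancels the pole in the
  \<open>F\<close> term; in the \<open>G\<close> term, \<open>Q w = Q z - (z - w) * q z w\<close>
  isolates a pole with factor \<open>Q z\<close>. There remain one polynomial identity for the
  coefficient of \<open>F\<close> and one for that of \<open>G\<close>, which \<open>A\<close>,
  \<open>m21\<close> and \<open>m22\<close> are made to satisfy.\<close>

lemma primitive_identity:
  assumes w: "w \<notin> {0, 1, t, z}"
    and F': "F' = \<mu> * F + (w - lam) * G" and G': "G' = - (R w / Q w) * F - (p w + \<mu>) * G"
  shows "A' w * F + A z w * F' - (Q' w * G + Q w * G') - \<kappa> / (z - w) * (A z w * F - Q w * G)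
     = \<kappa> * Q z * G / (z - w) - m21 z * F' - m22 z * G"
proof -
  have nz: "Q w \<noteq> 0" "z - w \<noteq> 0" using w Q_nonzero by auto
  have QG: "Q w * G' = - R w * F - (Q' w - \<Theta> w + \<mu> * Q w) * G"
  proof -
    have "Q w * G' = - (Q w * (R w / Q w)) * F - (Q w * p w + \<mu> * Q w) * G"
      unfolding G' by (simp add: algebra_simps)
    then show ?thesis using Q_p[of w] w nz by simp
  qed
  have AF: "\<kappa> / (z - w) * (A z w * F - Q w * G) = \<kappa> * (\<kappa>1 + \<mu> * (w + z + e)) * F - \<kappa> * (Q z - (z - w) * q z w) * G / (z - w)"
    using nz Q_diff[of z w] by (simp add: A_def field_simps)
  have split: "\<kappa> * (Q z - (z - w) * q z w) * G / (z - w) = \<kappa> * Q z * G / (z - w) - \<kappa> * q z w * G"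
    using nz by (simp add: field_simps)
  have "A' w + A z w * \<mu> + R w - \<kappa> * (\<kappa>1 + \<mu> * (w + z + e)) + m21 z * \<mu> = 0"
    unfolding A_def A'_def poly_defs by algebra
  moreover have "A z w * (w - lam) - \<Theta> w + \<mu> * Q w - \<kappa> * q z w + m21 z * (w - lam) + m22 z = 0"
    unfolding m22_def \<nu>_Q_lam A_def unfolding poly_defs by algebra
  ultimately have "(A' w + A z w * \<mu> + R w - \<kappa> * (\<kappa>1 + \<mu> * (w + z + e)) + m21 z * \<mu>) * F
     + (A z w * (w - lam) - \<Theta> w + \<mu> * Q w - \<kappa> * q z w + m21 z * (w - lam) + m22 z) * G = 0"
    by simp
  then show ?thesis unfolding AF QG split F' by (simp add: algebra_simps)
qed

section \<open>The parameters of the transformed system\<close>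

definition "\<theta>inf = - 2 * \<kappa> - \<sigma>"
definition "lam' = lam - \<kappa> / \<nu>"
definition "\<mu>' = (\<kappa> + \<theta>0) / lam' + (\<kappa> + \<theta>1) / (lam' - 1) + (\<kappa> + \<theta>t) / (lam' - t) + \<kappa> / (lam - lam')"

text \<open>The transformation exchanges \<open>\<theta>inf\<close> and \<open>\<kappa>1\<close>.
  Hence \<open>\<kappa>1 \<noteq> 0\<close> is the condition under which the target system is
  defined.\<close>

lemma kappa_eqs:
  "kappa1 \<theta>0 \<theta>1 \<theta>t \<theta>inf = \<kappa>1" "kappa2 \<theta>0 \<theta>1 \<theta>t \<theta>inf = \<kappa>"
  "kappa1 (\<kappa> + \<theta>0) (\<kappa> + \<theta>1) (\<kappa> + \<theta>t) (\<kappa> + \<theta>inf) = \<theta>inf" "\<kappa> + \<theta>inf = \<kappa>1"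
  by (simp_all add: kappa1_def kappa2_def \<theta>inf_def \<kappa>1_def \<sigma>_def field_simps)

text \<open>The origin of the formula for the new apparent singularity: it is the zero of the upper
  right entry.\<close>

lemma m12_lam':
  assumes "\<nu> \<noteq> 0"
  shows "m12 z = - (\<nu> * Q lam * (z - lam'))"
  using assms by (simp add: m12_def lam'_def field_simps)

text \<open>
  In the parameters \<open>\<nu>\<close>, \<open>D = lam - lam'\<close> and \<open>\<tau>\<^sub>i = (\<kappa> + \<theta>\<^sub>i) / (lam' - a\<^sub>i)\<close> everything below is
  polynomial.
\<close>
lemma residue_u:
  assumes \<nu>: "\<nu> \<noteq> 0" and lam': "lam' \<notin> {0, 1, t}" and \<kappa>: "\<kappa> \<noteq> 0"
  shows "lam' * (lam' * (lam' - 1) * (lam' - t) * \<mu>'\<^sup>2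
       + (2 * \<theta>inf * (lam' - 1) * (lam' - t) - (\<kappa> + \<theta>1) * (lam' - t) - t * (\<kappa> + \<theta>t) * (lam' - 1)) * \<mu>'
       + \<theta>inf * (\<theta>inf * (lam' - t - 1) - (\<kappa> + \<theta>1) - t * (\<kappa> + \<theta>t))) = \<kappa>1 * m11 0 + m12 0 * \<mu>" (is ?th0)
   and "(lam' - 1) * (lam' * (lam' - 1) * (lam' - t) * \<mu>'\<^sup>2
       + (2 * \<theta>inf * (lam' - 1) * (lam' - t) + (\<kappa> + \<theta>inf - (\<kappa> + \<theta>1)) * (lam' - t) - t * (\<kappa> + \<theta>t) * (lam' - 1)) * \<mu>'
       + \<theta>inf * (\<theta>inf * (lam' - t + 1) + (\<kappa> + \<theta>0) - (t - 1) * (\<kappa> + \<theta>t))) = \<kappa>1 * m11 1 + m12 1 * \<mu>" (is ?th1)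
   and "(lam' - t) * (lam' * (lam' - 1) * (lam' - t) * \<mu>'\<^sup>2
       + (2 * \<theta>inf * (lam' - 1) * (lam' - t) - (\<kappa> + \<theta>1) * (lam' - t) + t * (\<kappa> + \<theta>inf - (\<kappa> + \<theta>t)) * (lam' - 1)) * \<mu>'
       + \<theta>inf * (\<theta>inf * (lam' - t + 1) + (\<kappa> + \<theta>0) + (t - 1) * (\<kappa> + \<theta>inf - (\<kappa> + \<theta>t)))) = \<kappa>1 * m11 t + m12 t * \<mu>" (is ?tht)
proof -
  define n where "n = \<nu>"
  define D where "D = lam - lam'"
  define l where "l = lam'"
  define \<tau>0 where "\<tau>0 = (\<kappa> + \<theta>0) / lam'"
  define \<tau>1 where "\<tau>1 = (\<kappa> + \<theta>1) / (lam' - 1)"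
  define \<tau>t where "\<tau>t = (\<kappa> + \<theta>t) / (lam' - t)"
  have D: "D = \<kappa> / \<nu>" by (simp add: D_def lam'_def)
  have \<kappa>D: "\<kappa> = n * D" using \<nu> D by (simp add: n_def)
  have lam_eq: "lam = l + D" by (simp add: l_def D_def)
  have sub: "\<kappa> + \<theta>0 = \<tau>0 * l" "\<kappa> + \<theta>1 = \<tau>1 * (l - 1)" "\<kappa> + \<theta>t = \<tau>t * (l - t)"
    using lam' by (auto simp: \<tau>0_def \<tau>1_def \<tau>t_def l_def)
  have \<theta>: "\<theta>0 = \<tau>0 * l - n * D" "\<theta>1 = \<tau>1 * (l - 1) - n * D" "\<theta>t = \<tau>t * (l - t) - n * D"
    unfolding sub[symmetric] \<kappa>D[symmetric] by simp_all
  have "\<kappa> / (lam - lam') = n" using \<kappa> \<nu> by (simp add: lam'_def n_def)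
  then have \<mu>': "\<mu>' = \<tau>0 + \<tau>1 + \<tau>t + n" by (simp add: \<mu>'_def \<tau>0_def \<tau>1_def \<tau>t_def)
  define E where "E = n * ((l + D) * (l + D - 1) * (l + D - t)) + ((\<tau>0 * l - n * D) * (l + D - 1) * (l + D - t)
       + (\<tau>1 * (l - 1) - n * D) * (l + D) * (l + D - t) + (\<tau>t * (l - t) - n * D) * (l + D) * (l + D - 1))"
  \<comment> \<open>\<open>\<mu>\<close> enters only through this product, which is polynomial in
    the new variables although \<open>\<mu>\<close> is not.\<close>
  have E: "\<mu> * Q lam = E"
    using \<nu>_Q_lam by (simp add: n_def[symmetric] E_def Q_def \<Theta>_def lam_eq[symmetric] \<theta>[symmetric])
  have m12\<mu>: "m12 z * \<mu> = (l - z) * (n * E)" for z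
    by (simp add: m12_lam'[OF \<nu>] n_def[symmetric] l_def E[symmetric] algebra_simps)
  have m11: "m11 0 = l * (\<tau>0 * t + n * (l + D - 1) * (l + D - t))"
      "m11 1 = (l - 1) * (\<tau>1 * (1 - t) + n * (l + D) * (l + D - t))"
      "m11 t = (l - t) * (\<tau>t * (t * (t - 1)) + n * (l + D) * (l + D - 1))"
    unfolding m11_def Q_def Q'_def q_def \<Theta>_def n_def[symmetric] unfolding lam_eq \<theta> \<kappa>D
    by (simp_all add: algebra_simps power2_eq_square)
  have \<theta>inf: "\<theta>inf = n * D - \<tau>0 * l - \<tau>1 * (l - 1) - \<tau>t * (l - t)"
    unfolding \<theta>inf_def \<sigma>_def unfolding \<theta> \<kappa>D by (simp add: algebra_simps)
  have \<kappa>1: "\<kappa>1 = \<theta>inf + n * D" "\<kappa> + \<theta>inf = \<theta>inf + n * D"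
    unfolding \<kappa>1_def \<theta>inf_def \<kappa>D[symmetric] by simp_all
  note ids = residue_polynomial_identities[where l = l and t = t and D = D and \<nu> = n and \<alpha> = \<tau>0 and \<beta> = \<tau>1 and \<gamma> = \<tau>t,
      folded E_def, folded \<theta>inf, folded \<mu>']
  have combine: "c * (\<kappa>1 * x + n * E) = \<kappa>1 * (c * x) + c * (n * E)" for c x by (simp add: algebra_simps)
  show ?th0 unfolding l_def[symmetric] sub \<kappa>1(2) m11 m12\<mu> diff_0_right unfolding \<kappa>1(1)[symmetric] combine[symmetric]
    using ids(1) by (simp add: \<kappa>1(1))
  show ?th1 unfolding l_def[symmetric] sub \<kappa>1(2) m11 m12\<mu> unfolding \<kappa>1(1)[symmetric] combine[symmetric]
    using ids(2) by (simp add: \<kappa>1(1))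
  show ?tht unfolding l_def[symmetric] sub \<kappa>1(2) m11 m12\<mu> unfolding \<kappa>1(1)[symmetric] combine[symmetric]
    using ids(3) by (simp add: \<kappa>1(1))
qed

end

section \<open>The transformed system\<close>

text \<open>The diagonal, the upper right entry and a zero determinant fix the matrix: the lower
  left entry follows on division by \<open>w \<noteq> 0\<close>.\<close>

lemma DY_residue_entries:
  assumes "u + \<theta> = n11 / r" "- u = n22 / r" "- w = n12 / r" "n11 * n22 = n12 * n21" "w \<noteq> 0"
  shows "DY_residue \<theta> u w $ 1 $ 1 = n11 / r" "DY_residue \<theta> u w $ 1 $ 2 = n12 / r"
    "DY_residue \<theta> u w $ 2 $ 1 = n21 / r" "DY_residue \<theta> u w $ 2 $ 2 = n22 / r"
proof -
  have r: "r \<noteq> 0" "n12 \<noteq> 0" using assms(3,5) by auto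
  have u: "u = - n22 / r" and w: "w = - n12 / r" using assms(2,3) by (auto simp: eq_neg_iff_add_eq_0 neg_eq_iff_add_eq_0 add.commute)
  have "u * (u + \<theta>) / w = (- n22 / r) * (n11 / r) / (- n12 / r)"
    by (simp only: assms(1)) (simp only: u w)
  also have "\<dots> = (n11 * n22) / (n12 * r)"
    using r by (simp add: field_simps)
  also have "\<dots> = n21 / r" unfolding assms(4) using r by simp
  finally show "DY_residue \<theta> u w $ 2 $ 1 = n21 / r" by (simp add: DY_residue_def)
qed (use assms in \<open>simp_all add: DY_residue_def\<close>)

context dy_parameters begin

text \<open>The constant gauge change conjugates the matrix of the \<open>m\<close> into that of the
  \<open>n\<close>. The latter and the target matrix are both sums of simple poles at 0, 1, t, so
  equality of residues suffices.\<close>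

lemma satisfies_DY:
  assumes \<nu>: "\<nu> \<noteq> 0" and lam': "lam' \<notin> {0, 1, t}" and \<kappa>1: "\<kappa>1 \<noteq> 0" and \<kappa>: "\<kappa> \<noteq> 0" and k: "k \<noteq> 0"
    and z: "z \<notin> {0, 1, t}"
    and X: "(X has_field_derivative (m11 z * X z + m12 z * Z z) / Q z) (at z)"
    and Z: "(Z has_field_derivative (m21 z * X z + m22 z * Z z) / Q z) (at z)"
  shows "satisfies_DY_at t (\<kappa> + \<theta>0) (\<kappa> + \<theta>1) (\<kappa> + \<theta>t) (\<kappa> + \<theta>inf) lam' \<mu>' k
     (\<lambda>x. vector [X x, \<kappa> * lam * (lam - 1) * (lam - t) / (k * (lam - lam')) * (- Z x + \<mu> / \<kappa>1 * X x)]) z"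
proof -
  define C where "C = \<kappa> * lam * (lam - 1) * (lam - t) / (k * (lam - lam'))"
  \<comment> \<open>The quadratic coefficient of \<open>n21\<close> is \<open>C\<close> times \<mu>
    - s \<kappa>1; this choice removes it, so that the residue at infinity is diagonal.\<close>
  define s where "s = \<mu> / \<kappa>1"
  define n11 where "n11 z = m11 z + s * m12 z" for z
  define n12 where "n12 z = k * z + - (k * lam')" for z
  define n21 where "n21 z = C * (s * (m11 z + s * m12 z) + ((- 1) * m21 z + (- s) * m22 z))" for z
  define n22 where "n22 z = m22 z + (- s) * m12 z" for z
  have quad: "quadratic n11" "quadratic n12" "quadratic n21" "quadratic n22"
    unfolding n11_def[abs_def] n12_def[abs_def] n21_def[abs_def] n22_def[abs_def]
    by (intro quadratic_add quadratic_cmult quadratic_m quadratic_linear)+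
  have t': "t - 1 \<noteq> 0" "1 - t \<noteq> 0" using t by auto
  \<comment> \<open>This value gives the upper right entry the prescribed normalisation
    \<open>k\<close>.\<close>
  have C: "C = \<nu> * Q lam / k"
  proof -
    have "\<kappa> * lam * (lam - 1) * (lam - t) = \<kappa> * Q lam" "lam - lam' = \<kappa> / \<nu>"
      by (simp_all add: Q_def lam'_def)
    then show ?thesis using \<kappa> \<nu> k by (simp add: C_def)
  qed
  have m12: "m12 z = - C * n12 z" for z
    using k by (simp add: m12_lam'[OF \<nu>] C n12_def field_simps)
  have det: "n11 a * n22 a = n12 a * n21 a" if "a \<in> {0, 1, t}" for a
  proof -
    have "n11 a * n22 a = n12 a * n21 a + (m11 a * m22 a - m12 a * m21 a)"
      unfolding n11_def n22_def n21_def m12 by (simp add: algebra_simps)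
    then show ?thesis using m_det[OF that] by simp
  qed
  \<comment> \<open>At a zero \<open>a\<close> of \<open>Q\<close> one has
    \<open>\<Theta> a = \<theta> * Q' a\<close> with the \<theta> belonging to \<open>a\<close>.
    After division by \<open>Q' a\<close> the trace is therefore \<open>\<kappa> + \<theta>\<close>,
    and the (2,2) entries follow from the (1,1) entries.\<close>
  have trace: "n11 a + n22 a = \<kappa> * Q' a + \<Theta> a" for a
    by (simp add: n11_def n22_def m11_def m22_def)
  note res = residue_u[OF \<nu> lam' \<kappa>]
  have n\<kappa>1: "(\<kappa>1 * m11 a + m12 a * \<mu>) / \<kappa>1 = n11 a" for a
    using \<kappa>1 by (simp add: n11_def s_def field_simps)
  have u0: "DY_u0 t (\<kappa> + \<theta>0) (\<kappa> + \<theta>1) (\<kappa> + \<theta>t) (\<kappa> + \<theta>inf) lam' \<mu>' + (\<kappa> + \<theta>0) = n11 0 / t"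
  proof -
    have "lam' / (t * (\<kappa> + \<theta>inf)) * E = (lam' * E) / \<kappa>1 / t" for E
      by (simp add: kappa_eqs(4))
    then show ?thesis unfolding DY_u0_def Let_def kappa_eqs(3) by (simp only: res(1) n\<kappa>1) simp
  qed
  have u1: "DY_u1 t (\<kappa> + \<theta>0) (\<kappa> + \<theta>1) (\<kappa> + \<theta>t) (\<kappa> + \<theta>inf) lam' \<mu>' + (\<kappa> + \<theta>1) = n11 1 / (1 - t)"
  proof -
    have eq: "(lam' - 1) / ((t - 1) * (\<kappa> + \<theta>inf)) * E = ((lam' - 1) * E) / \<kappa>1 / (t - 1)" for E
      by (simp add: kappa_eqs(4))
    have "- (n / (t - 1)) = n / (1 - t)" for n :: complex
      by (metis minus_diff_eq minus_divide_right)
    then show ?thesis unfolding DY_u1_def Let_def kappa_eqs(3) eq by (simp only: res(2) n\<kappa>1) simp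
  qed
  have ut: "DY_ut t (\<kappa> + \<theta>0) (\<kappa> + \<theta>1) (\<kappa> + \<theta>t) (\<kappa> + \<theta>inf) lam' \<mu>' + (\<kappa> + \<theta>t) = n11 t / (t * (t - 1))"
  proof -
    have "(lam' - t) / (t * (t - 1) * (\<kappa> + \<theta>inf)) * E = ((lam' - t) * E) / \<kappa>1 / (t * (t - 1))" for E
      by (simp add: kappa_eqs(4))
    then show ?thesis unfolding DY_ut_def Let_def kappa_eqs(3) by (simp only: res(3) n\<kappa>1) simp
  qed
  have neg: "- u = n22 a / r" if "u + (\<kappa> + \<theta>) = n11 a / r" "\<kappa> * Q' a + \<Theta> a = (\<kappa> + \<theta>) * r" "r \<noteq> 0" for u \<theta> a r
  proof -
    have "n11 a / r + n22 a / r = \<kappa> + \<theta>"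
      unfolding add_divide_distrib[symmetric] trace that(2) using that(3) by simp
    with that(1) show ?thesis by algebra
  qed
  have Q'a: "\<kappa> * Q' 0 + \<Theta> 0 = (\<kappa> + \<theta>0) * t" "\<kappa> * Q' 1 + \<Theta> 1 = (\<kappa> + \<theta>1) * (1 - t)"
      "\<kappa> * Q' t + \<Theta> t = (\<kappa> + \<theta>t) * (t * (t - 1))"
    by (simp_all add: Q'_def \<Theta>_def algebra_simps power2_eq_square)
  have w: "- DY_w0 t lam' k = n12 0 / t" "- DY_w1 t lam' k = n12 1 / (1 - t)" "- DY_wt t lam' k = n12 t / (t * (t - 1))"
      "DY_w0 t lam' k \<noteq> 0" "DY_w1 t lam' k \<noteq> 0" "DY_wt t lam' k \<noteq> 0"
  proof -
    have "k * (lam' - 1) / (t - 1) = (k - k * lam') / (1 - t)"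
      by (metis (no_types, lifting) minus_diff_eq minus_divide_divide mult.right_neutral mult_minus_right right_diff_distrib)
    then show "- DY_w1 t lam' k = n12 1 / (1 - t)" by (simp add: DY_w1_def n12_def)
    show "- DY_wt t lam' k = n12 t / (t * (t - 1))" 
      unfolding DY_wt_def n12_def minus_divide_left by (simp add: algebra_simps)
  qed (use lam' k t' t in \<open>auto simp: DY_w0_def DY_w1_def DY_wt_def n12_def\<close>)
  note r0 = DY_residue_entries[OF u0 neg[OF u0 Q'a(1) t(1)] w(1) det[of 0] w(4), simplified]
  note r1 = DY_residue_entries[OF u1 neg[OF u1 Q'a(2) t'(2)] w(2) det[of 1] w(5), simplified]
  have tt: "t * (t - 1) \<noteq> 0" using t t' by simp
  note rt = DY_residue_entries[OF ut neg[OF ut Q'a(3) tt] w(3) det[of t] w(6), simplified]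
  let ?M = "DY_matrix t (\<kappa> + \<theta>0) (\<kappa> + \<theta>1) (\<kappa> + \<theta>t) (\<kappa> + \<theta>inf) lam' \<mu>' k z"
  have pf: "f 0 / t / z + f 1 / (1 - t) / (z - 1) + f t / (t * (t - 1)) / (z - t) = f z / Q z" if "quadratic f" for f
    using quadratic_partial_fractions[OF that t] z by (simp add: Q_def)
  have M: "?M $ 1 $ 1 = n11 z / Q z" "?M $ 1 $ 2 = n12 z / Q z" "?M $ 2 $ 1 = n21 z / Q z" "?M $ 2 $ 2 = n22 z / Q z"
    unfolding DY_matrix_def Let_def
    by (simp_all add: r0 r1 rt pf quad del: divide_divide_eq_left)
  have D1: "(n11 z * X z + n12 z * (C * (- Z z + s * X z))) / Q z = (m11 z * X z + m12 z * Z z) / Q z"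
    by (simp add: n11_def m12 algebra_simps)
  have D2: "(n21 z * X z + n22 z * (C * (- Z z + s * X z))) / Q z
      = C * (- ((m21 z * X z + m22 z * Z z) / Q z) + s * ((m11 z * X z + m12 z * Z z) / Q z))"
    by (simp add: n21_def n22_def algebra_simps add_divide_distrib diff_divide_distrib)
  have 1: "(X has_field_derivative ?M $ 1 $ 1 * X z + ?M $ 1 $ 2 * (C * (- Z z + s * X z))) (at z)"
    using X unfolding D1[symmetric] by (simp add: M add_divide_distrib)
  have "((\<lambda>x. C * (- Z x + s * X x)) has_field_derivative
     C * (- ((m21 z * X z + m22 z * Z z) / Q z) + s * ((m11 z * X z + m12 z * Z z) / Q z))) (at z)"
    by (intro DERIV_cmult DERIV_add DERIV_minus X Z)
  then have 2: "((\<lambda>x. C * (- Z x + s * X x)) has_field_derivative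
      ?M $ 2 $ 1 * X z + ?M $ 2 $ 2 * (C * (- Z z + s * X z))) (at z)"
    unfolding D2[symmetric] by (simp add: M add_divide_distrib)
  show ?thesis
    unfolding satisfies_DY_at_def forall_2 C_def[symmetric] s_def[symmetric]
    using 1 2 by (simp add: matrix_vector_mult_def sum_2 vector_2)
qed

end

section \<open>Solutions of the scalar equation\<close>

context dy_parameters begin

sublocale gauge: linear_system "- {0, 1, t}" "\<lambda>_. \<mu>" "\<lambda>w. w - lam" "\<lambda>w. - (R w / Q w)" "\<lambda>w. - (p w + \<mu>)"
proof
  show "open (- {0, 1, t})" by (intro open_Compl finite_imp_closed) simp
  have "R holomorphic_on - {0, 1, t}" "Q holomorphic_on - {0, 1, t}"
    unfolding R_def[abs_def] Q_def[abs_def] q_def by (intro holomorphic_intros)+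
  then show "(\<lambda>w. - (R w / Q w)) holomorphic_on - {0, 1, t}"
    by (intro holomorphic_intros) (use Q_nonzero in auto)
  show "(\<lambda>w. - (p w + \<mu>)) holomorphic_on - {0, 1, t}"
    unfolding p_def by (intro holomorphic_intros) auto
qed (intro holomorphic_intros)+

text \<open>The difficulty is a base point at or near \<open>lam\<close>. Holomorphy of
  \<open>y\<close> forces y' = \<mu> y at \<open>lam\<close>, so the quotient by w - lam is
  holomorphic, and equations derived off \<open>lam\<close> extend to it by the identity
  theorem.\<close>

lemma gauge_solution:
  assumes V: "open V" "b \<in> V" and b: "b \<notin> {0, 1, t}"
    and sol: "solves_Dy1_on t \<theta>0 \<theta>1 \<theta>t \<theta>inf lam \<mu> y V"
  obtains r v where "r > 0" "ball b r \<subseteq> - {0, 1, t}" "gauge.solves (ball b r) y v"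
proof -
  define H where "H = Dy1_H t \<theta>0 \<theta>1 \<theta>t \<theta>inf lam \<mu>"
  have tt: "t * (t - 1) \<noteq> 0" using t by simp
  have H: "t * (t - 1) * H = Q lam * \<mu>\<^sup>2
       - (\<theta>0 * (lam - 1) * (lam - t) + \<theta>1 * lam * (lam - t) + (\<theta>t - 1) * lam * (lam - 1)) * \<mu>
       + \<kappa>1 * (\<kappa> + 1) * (lam - t)"
    using tt unfolding H_def Dy1_H_def Let_def kappa_eqs(1,2) by (simp add: Q_def)
  have holV: "y holomorphic_on V"
    and ode: "\<And>z. z \<in> V - {0, 1, t, lam} \<Longrightarrow> deriv (deriv y) z
         + (p z - 1 / (z - lam)) * deriv y z
         + (\<kappa>1 * (\<kappa> + 1) / (z * (z - 1))
            + lam * (lam - 1) * \<mu> / (z * (z - 1) * (z - lam))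
            - t * (t - 1) * H / (z * (z - 1) * (z - t))) * y z = 0"
    using sol unfolding solves_Dy1_on_def Let_def kappa_eqs(1,2) H_def[symmetric] p_def by auto
  have "open (V \<inter> - {0, 1, t})"
    using V(1) by (intro open_Int open_Compl finite_imp_closed) auto
  then obtain r where r: "r > 0" "ball b r \<subseteq> V \<inter> - {0, 1, t}"
    using openE[of "V \<inter> - {0, 1, t}" b] V(2) b by blast
  let ?B = "ball b r"
  have hol: "y holomorphic_on ?B" using holV r(2) by (meson holomorphic_on_subset le_inf_iff)
  then have hol': "deriv y holomorphic_on ?B" "deriv (deriv y) holomorphic_on ?B"
    by (auto intro!: holomorphic_deriv)
  have B0: "z \<noteq> 0" "z \<noteq> 1" "z \<noteq> t" if "z \<in> ?B" for z using subsetD[OF r(2) that] by auto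
  have identity: "f w = 0" if "f holomorphic_on ?B" "\<And>z. z \<in> ?B - {lam} \<Longrightarrow> f z = 0" "w \<in> ?B" for f w
  proof (rule analytic_continuation_open[of "?B - {lam}" ?B f "\<lambda>_. 0"])
    show "?B - {lam} \<noteq> {}"
    proof
      assume "?B - {lam} = {}"
      then have "finite ?B" by (metis Diff_eq_empty_iff finite.emptyI finite_insert finite_subset)
      then show False using r(1) finite_imp_not_open[of ?B] by auto
    qed
  qed (use that in auto)
  define h where "h w = deriv y w - \<mu> * y w" for w
  have holh: "h holomorphic_on ?B" unfolding h_def[abs_def] by (intro holomorphic_intros hol hol')
  have h_lam: "h lam = 0" if lamB: "lam \<in> ?B"
  proof -
    \<comment> \<open>The equation multiplied by \<open>z - lam\<close>, with the poles at
      \<open>lam\<close> cancelled. It vanishes off \<open>lam\<close>, hence also at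
      \<open>lam\<close>, where its value is \<open>- h lam\<close>.\<close>
    define g where "g z = (z - lam) * (deriv (deriv y) z + p z * deriv y z
        + (\<kappa>1 * (\<kappa> + 1) / (z * (z - 1)) - t * (t - 1) * H / (z * (z - 1) * (z - t))) * y z)
        - deriv y z + lam * (lam - 1) * \<mu> / (z * (z - 1)) * y z" for z
    have "g lam = 0"
    proof (rule identity[of g])
      show "g holomorphic_on ?B"
        unfolding g_def[abs_def] p_def by (intro holomorphic_intros hol hol') (use B0 in auto)
      show "g z = 0" if z: "z \<in> ?B - {lam}" for z
      proof -
        have nz: "z - lam \<noteq> 0" using z by auto
        have e1: "(z - lam) * (1 / (z - lam)) = 1" using nz by simp
        have e2: "(z - lam) * (lam * (lam - 1) * \<mu> / (z * (z - 1) * (z - lam))) = lam * (lam - 1) * \<mu> / (z * (z - 1))"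
          using nz by simp
        have "(z - lam) * (deriv (deriv y) z + (p z - 1 / (z - lam)) * deriv y z
         + (\<kappa>1 * (\<kappa> + 1) / (z * (z - 1)) + lam * (lam - 1) * \<mu> / (z * (z - 1) * (z - lam))
            - t * (t - 1) * H / (z * (z - 1) * (z - t))) * y z) = 0"
          using ode[of z] z subsetD[OF r(2), of z] B0[of z] by auto
        then show ?thesis
          unfolding g_def using e1 e2 by algebra
      qed
    qed (rule lamB)
    then show ?thesis using lam by (simp add: g_def h_def)
  qed
  define v where "v w = (if w = lam then deriv h lam else (h w - h lam) / (w - lam))" for w
  \<comment> \<open>If \<open>lam\<close> lies outside the disc, nothing is known about
    \<open>h lam\<close>, and plain division is used.\<close>
  define v' where "v' = (if lam \<in> ?B then v else (\<lambda>w. h w / (w - lam)))"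
  have holv: "v' holomorphic_on ?B"
  proof (cases "lam \<in> ?B")
    case True
    then show ?thesis unfolding v'_def v_def[abs_def] using pole_lemma[OF holh, of lam] by simp
  next
    case False
    then show ?thesis unfolding v'_def by (auto intro!: holomorphic_intros holh)
  qed
  have hv: "h w = (w - lam) * v' w" if "w \<in> ?B" for w
    using that h_lam by (auto simp: v'_def v_def)
  have dy: "deriv y w = \<mu> * y w + (w - lam) * v' w" if "w \<in> ?B" for w
    using hv[OF that] by (simp add: h_def algebra_simps)
  have zero: "deriv v' w + R w / Q w * y w + (p w + \<mu>) * v' w = 0" if w: "w \<in> ?B" for w
  proof (rule identity[of "\<lambda>w. deriv v' w + R w / Q w * y w + (p w + \<mu>) * v' w", OF _ _ w])
    have "R holomorphic_on ?B" "Q holomorphic_on ?B" unfolding R_def[abs_def] Q_def[abs_def] q_def by (intro holomorphic_intros)+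
    moreover have "deriv v' holomorphic_on ?B" using holv by (intro holomorphic_deriv) auto
    ultimately show "(\<lambda>w. deriv v' w + R w / Q w * y w + (p w + \<mu>) * v' w) holomorphic_on ?B"
      unfolding p_def by (intro holomorphic_intros hol holv) (use B0 Q_nonzero in auto)
    fix z assume z: "z \<in> ?B - {lam}"
    then have nz: "z - lam \<noteq> 0" "z \<in> ?B" "z \<notin> {0, 1, t, lam}" "z \<in> V" using B0[of z] subsetD[OF r(2), of z] by auto
    have "(deriv y has_field_derivative \<mu> * deriv y z + (v' z + (z - lam) * deriv v' z)) (at z)"
    proof (rule has_field_derivative_transform_within_open[of "\<lambda>w. \<mu> * y w + (w - lam) * v' w" _ _ ?B])
      have D: "(y has_field_derivative deriv y z) (at z)" "(v' has_field_derivative deriv v' z) (at z)"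
        using hol holv nz(2) by (auto intro: holomorphic_derivI)
      show "((\<lambda>w. \<mu> * y w + (w - lam) * v' w) has_field_derivative \<mu> * deriv y z + (v' z + (z - lam) * deriv v' z)) (at z)"
        by (auto intro!: derivative_eq_intros D)
    qed (use nz dy in auto)
    then have 1: "deriv (deriv y) z = \<mu> * deriv y z + (v' z + (z - lam) * deriv v' z)"
      by (rule DERIV_imp_deriv)
    define i where "i = 1 / (z - lam)"
    define q0 where "q0 = \<kappa>1 * (\<kappa> + 1) / (z * (z - 1)) + lam * (lam - 1) * \<mu> / (z * (z - 1) * (z - lam))
     - t * (t - 1) * H / (z * (z - 1) * (z - t))"
    have 2: "(p z + \<mu>) * \<mu> + q0 - \<mu> * i = (z - lam) * (R z / Q z)"
      using apparent_singularity[OF nz(3) H] by (simp add: q0_def i_def)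
    have 3: "i * (z - lam) = 1" using nz by (simp add: i_def)
    have 4: "deriv (deriv y) z + (p z - i) * deriv y z + q0 * y z = 0"
      using ode[of z] nz(3,4) by (simp add: q0_def i_def)
    have "(z - lam) * (deriv v' z + R z / Q z * y z + (p z + \<mu>) * v' z) = 0"
      using 1 2 3 4 dy[OF nz(2)] by algebra
    then show "deriv v' z + R z / Q z * y z + (p z + \<mu>) * v' z = 0" using nz by simp
  qed
  have dv: "deriv v' w = - (R w / Q w) * y w + - (p w + \<mu>) * v' w" if "w \<in> ?B" for w
    using zero[OF that] by algebra
  have "gauge.solves ?B y v'"
    unfolding gauge.solves_def
  proof (intro ballI conjI)
    fix w assume w: "w \<in> ?B"
    show "(y has_field_derivative \<mu> * y w + (w - lam) * v' w) (at w)"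
      using holomorphic_derivI[OF hol open_ball w] unfolding dy[OF w] .
    show "(v' has_field_derivative - (R w / Q w) * y w + - (p w + \<mu>) * v' w) (at w)"
      using holomorphic_derivI[OF holv open_ball w] unfolding dv[OF w] .
  qed
  then show ?thesis using r by (intro that[of r v']) auto
qed

end

section \<open>Derivatives of the transforms\<close>

text \<open>Differentiating \<open>exp (lg \<zeta>) = \<zeta>\<close> gives the derivative 1 /
  \<zeta> for any local branch of the logarithm.\<close>

lemma DERIV_power_solution:
  assumes "open W" "lg holomorphic_on W" "\<And>\<zeta>. \<zeta> \<in> W \<Longrightarrow> exp (lg \<zeta>) = \<zeta>" "\<zeta> \<in> W"
  shows "((\<lambda>\<zeta>. exp (\<kappa> * lg \<zeta>)) has_field_derivative \<kappa> / \<zeta> * exp (\<kappa> * lg \<zeta>)) (at \<zeta>)"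
proof -
  have D: "(lg has_field_derivative deriv lg \<zeta>) (at \<zeta>)"
    using assms holomorphic_derivI by blast
  have "((\<lambda>\<zeta>. exp (lg \<zeta>)) has_field_derivative exp (lg \<zeta>) * deriv lg \<zeta>) (at \<zeta>)"
    by (auto intro!: derivative_eq_intros D)
  moreover have "((\<lambda>\<zeta>. exp (lg \<zeta>)) has_field_derivative 1) (at \<zeta>)"
    by (rule has_field_derivative_transform_within_open[of "\<lambda>\<zeta>. \<zeta>" _ _ W]) (use assms in auto)
  ultimately have "\<zeta> * deriv lg \<zeta> = 1" using DERIV_unique assms(3,4) by fastforce
  then have "deriv lg \<zeta> = 1 / \<zeta>" by (metis nonzero_mult_div_cancel_left mult_zero_left zero_neq_one)
  with D have "(lg has_field_derivative 1 / \<zeta>) (at \<zeta>)" by simp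
  then show ?thesis by (auto intro!: derivative_eq_intros)
qed

context dy_parameters begin

text \<open>All integrals are written as \<open>J\<close> of a weight: differentiation in
  \<open>z\<close> inserts the factor \<open>L\<close>, and total derivatives in \<open>w\<close>,
  whose boundary terms cancel by the closing assumptions, express the resulting integrals by
  \<open>X\<close> and \<open>Z\<close> again.\<close>

lemma convolution_derivatives:
  assumes sol: "\<And>s. s \<in> {0..1} \<Longrightarrow> gauge.solves (ball (\<Gamma> s) r) (F s) (G s)"
    and sub: "\<And>s. s \<in> {0..1} \<Longrightarrow> ball (\<Gamma> s) r \<subseteq> - {0, 1, t}"
    and F: "function_elements \<Gamma> r \<delta> F" and G: "function_elements \<Gamma> r \<delta> G"
    and closed: "\<Gamma> 0 = q0" "\<Gamma> 1 = q0" "F 1 q0 = F 0 q0" "G 1 q0 = G 0 q0"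
    and \<Phi>: "function_elements (\<lambda>s. z0 - \<Gamma> s) (2 * r) \<delta> \<Phi>"
    and \<Phi>': "\<And>s \<zeta>. s \<in> {0..1} \<Longrightarrow> \<zeta> \<in> ball (z0 - \<Gamma> s) (2 * r) \<Longrightarrow> (\<Phi> s has_field_derivative \<kappa> / \<zeta> * \<Phi> s \<zeta>) (at \<zeta>)"
    and \<Phi>0: "\<And>s. s \<in> {0..1} \<Longrightarrow> 0 \<notin> ball (z0 - \<Gamma> s) (2 * r)"
    and \<Phi>closed: "\<And>\<zeta>. \<zeta> \<in> ball (z0 - q0) (2 * r) \<Longrightarrow> \<Phi> 1 \<zeta> = \<Phi> 0 \<zeta>"
    and N: "fine_for \<Gamma> r \<delta> N"
    and z: "z \<in> ball z0 r" "z \<notin> {0, 1, t}"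
  defines "X \<equiv> \<lambda>z. polygon_integral \<Gamma> N (\<lambda>s w. (\<mu> * F s w + (w - lam) * G s w) * \<Phi> s (z - w))"
    and "Z \<equiv> \<lambda>z. polygon_integral \<Gamma> N (\<lambda>s w. G s w * \<Phi> s (z - w))"
  shows "(X has_field_derivative (m11 z * X z + m12 z * Z z) / Q z) (at z)"
    and "(Z has_field_derivative (m21 z * X z + m22 z * Z z) / Q z) (at z)"
proof -
  let ?D = "\<lambda>s. ball (\<Gamma> s) r"
  have Qz: "Q z \<noteq> 0" using Q_nonzero z(2) by blast
  have shift: "x - w \<in> ball (z0 - \<Gamma> s) (2 * r)" if "w \<in> ?D s" "x \<in> ball z0 r" for s w x
  proof -
    have eq: "z0 - \<Gamma> s - (x - w) = (z0 - x) - (\<Gamma> s - w)" by simp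
    show ?thesis unfolding mem_ball dist_norm eq
      using that norm_triangle_ineq4[of "z0 - x" "\<Gamma> s - w"] by (simp add: dist_norm)
  qed
  have w: "w \<notin> {0, 1, t, z}" if "s \<in> {0..1}" "w \<in> ?D s" for s w
  proof -
    have "z - w \<noteq> 0" using shift[OF that(2) z(1)] \<Phi>0[OF that(1)] by auto
    then show ?thesis using subsetD[OF sub[OF that(1)] that(2)] by auto
  qed
  define \<phi> where "\<phi> = (\<lambda>s w. \<mu> * F s w + (w - lam) * G s w)"
  define L where "L = (\<lambda>(w::complex). \<kappa> / (z - w))"
  define E where "E = (\<lambda>s w. \<Phi> s (z - w))"
  have DF: "(F s has_field_derivative \<phi> s w) (at w)"
    and DG: "(G s has_field_derivative - (R w / Q w) * F s w + - (p w + \<mu>) * G s w) (at w)"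
    and DE: "(E s has_field_derivative - (L w * E s w)) (at w)"
    if "s \<in> {0..1}" "w \<in> ?D s" for s w
  proof -
    note S = bspec[OF sol[OF that(1), unfolded gauge.solves_def] that(2)]
    show "(F s has_field_derivative \<phi> s w) (at w)" unfolding \<phi>_def by (rule conjunct1[OF S])
    show "(G s has_field_derivative - (R w / Q w) * F s w + - (p w + \<mu>) * G s w) (at w)" by (rule conjunct2[OF S])
    have "((\<lambda>w. \<Phi> s (z - w)) has_field_derivative (\<kappa> / (z - w) * \<Phi> s (z - w)) * (- 1)) (at w)"
      by (rule DERIV_chain2[where f = "\<Phi> s" and g = "\<lambda>w. z - w", OF \<Phi>'[OF that(1) shift[OF that(2) z(1)]]]) (auto intro!: derivative_eq_intros)
    then show "(E s has_field_derivative - (L w * E s w)) (at w)"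
      by (simp add: E_def L_def)
  qed
  have fixed: "function_elements \<Gamma> r \<delta> (\<lambda>_. h)" if "h holomorphic_on - {0, 1, t, z}" for h
    by (rule function_elements_fixed[OF that]) (use w in blast)
  have FE\<phi>: "function_elements \<Gamma> r \<delta> \<phi>"
    unfolding \<phi>_def by (intro function_elements_add function_elements_mult F G fixed holomorphic_intros)
  have FEE: "function_elements \<Gamma> r \<delta> E"
    unfolding E_def by (rule function_elements_reflect[OF \<Phi> z(1)])
  have FEL: "function_elements \<Gamma> r \<delta> (\<lambda>_. L)"
    unfolding L_def by (rule fixed) (intro holomorphic_intros, auto)
  define J where "J = (\<lambda>\<psi>. polygon_integral \<Gamma> N (\<lambda>s w. \<psi> s w * E s w))"
  have J_add: "J (\<lambda>s w. \<psi> s w + \<omega> s w) = J \<psi> + J \<omega>"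
    if "function_elements \<Gamma> r \<delta> \<psi>" "function_elements \<Gamma> r \<delta> \<omega>" for \<psi> \<omega>
    unfolding J_def distrib_right
    by (intro polygon_integral_add[OF _ _ N] function_elements_mult that FEE)
  have J_cmult: "J (\<lambda>s w. c * \<psi> s w) = c * J \<psi>" if "function_elements \<Gamma> r \<delta> \<psi>" for c \<psi>
    unfolding J_def mult.assoc
    by (intro polygon_integral_cmult[OF _ N] function_elements_mult that FEE)
  have J_cong: "J \<psi> = J \<omega>" if "\<And>s w. s \<in> {0..1} \<Longrightarrow> w \<in> ?D s \<Longrightarrow> \<psi> s w = \<omega> s w" for \<psi> \<omega>
    unfolding J_def by (rule polygon_integral_cong[OF N]) (simp add: that)
  have r0: "r > 0" using N by (simp add: fine_for_def)
  have E_closed: "E 1 q0 = E 0 q0"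
    unfolding E_def by (rule \<Phi>closed) (use shift[of q0 0 z] z(1) closed r0 in simp)
  \<comment> \<open>The power factor satisfies E' = - L E, so the derivative of T E is (T' - L T)
    E.\<close>
  have J_primitive: "J \<psi> = 0"
    if T: "function_elements \<Gamma> r \<delta> T" "T 1 q0 = T 0 q0"
      and D: "\<And>s w. s \<in> {0..1} \<Longrightarrow> w \<in> ?D s \<Longrightarrow> \<exists>T'. (T s has_field_derivative T') (at w) \<and> T' - L w * T s w = \<psi> s w" for T \<psi>
  proof -
    have "polygon_integral \<Gamma> N (\<lambda>s w. \<psi> s w * E s w) = T 1 (\<Gamma> 1) * E 1 (\<Gamma> 1) - T 0 (\<Gamma> 0) * E 0 (\<Gamma> 0)"
    proof (rule polygon_integral_primitive[OF function_elements_mult[OF T(1) FEE] N])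
      fix s :: real and w assume s: "s \<in> {0..1}" "w \<in> ?D s"
      obtain T' where T': "(T s has_field_derivative T') (at w)" "T' - L w * T s w = \<psi> s w"
        using D[OF s] by blast
      have "((\<lambda>w. T s w * E s w) has_field_derivative T' * E s w + - (L w * E s w) * T s w) (at w)"
        by (rule DERIV_mult[OF T'(1) DE[OF s]])
      moreover have "T' * E s w + - (L w * E s w) * T s w = \<psi> s w * E s w"
        unfolding T'(2)[symmetric] by (simp add: algebra_simps)
      ultimately show "((\<lambda>w. T s w * E s w) has_field_derivative \<psi> s w * E s w) (at w)" by simp
    qed
    then show ?thesis unfolding J_def by (simp add: closed T(2) E_closed)
  qed
  have J_deriv: "((\<lambda>x. polygon_integral \<Gamma> N (\<lambda>s w. \<psi> s w * \<Phi> s (x - w))) has_field_derivative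
      J (\<lambda>s w. L w * \<psi> s w)) (at z)" if \<psi>: "function_elements \<Gamma> r \<delta> \<psi>" for \<psi>
    unfolding J_def polygon_integral_def
  proof (rule DERIV_sum)
    fix i assume "i \<in> {..<N}"
    then have i: "i < N" by simp
    note part = fine_for_partition[OF N i]
    let ?p = "real i / real N" and ?p' = "real (Suc i) / real N"
    have "((\<lambda>x. contour_integral (linepath (\<Gamma> ?p) (\<Gamma> ?p')) (\<lambda>w. \<psi> ?p w * \<Phi> ?p (x - w))) has_field_derivative
       contour_integral (linepath (\<Gamma> ?p) (\<Gamma> ?p')) (\<lambda>w. \<psi> ?p w * deriv (\<Phi> ?p) (z - w))) (at z)"
    proof (rule convolution_linepath_has_field_derivative)
      show "continuous_on (closed_segment (\<Gamma> ?p) (\<Gamma> ?p')) (\<psi> ?p)"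
        by (rule continuous_on_subset[OF holomorphic_on_imp_continuous_on[OF function_elements_holomorphic[OF \<psi> part(1)]] part(5)])
      show "\<Phi> ?p holomorphic_on ball (z0 - \<Gamma> ?p) (2 * r)"
        by (rule function_elements_holomorphic[OF \<Phi> part(1)])
      show "x - w \<in> ball (z0 - \<Gamma> ?p) (2 * r)" if "x \<in> ball z0 r" "w \<in> closed_segment (\<Gamma> ?p) (\<Gamma> ?p')" for x w
        using shift[OF _ that(1)] part(5) that(2) by blast
    qed (use z in auto)
    moreover have "contour_integral (linepath (\<Gamma> ?p) (\<Gamma> ?p')) (\<lambda>w. \<psi> ?p w * deriv (\<Phi> ?p) (z - w))
       = contour_integral (linepath (\<Gamma> ?p) (\<Gamma> ?p')) (\<lambda>w. L w * \<psi> ?p w * E ?p w)"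
    proof (rule contour_integral_eq)
      fix w assume "w \<in> path_image (linepath (\<Gamma> ?p) (\<Gamma> ?p'))"
      then have "w \<in> ?D ?p" using part(5) by auto
      then have "deriv (\<Phi> ?p) (z - w) = \<kappa> / (z - w) * \<Phi> ?p (z - w)"
        using DERIV_imp_deriv[OF \<Phi>'[OF part(1) shift[OF _ z(1)]]] by blast
      then show "\<psi> ?p w * deriv (\<Phi> ?p) (z - w) = L w * \<psi> ?p w * E ?p w"
        by (simp add: L_def E_def)
    qed
    ultimately show "((\<lambda>x. contour_integral (linepath (\<Gamma> ?p) (\<Gamma> ?p')) (\<lambda>w. \<psi> ?p w * \<Phi> ?p (x - w))) has_field_derivative
       contour_integral (linepath (\<Gamma> ?p) (\<Gamma> ?p')) (\<lambda>w. L w * \<psi> ?p w * E ?p w)) (at z)" by simp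
  qed
  have XZ: "X z = J \<phi>" "Z z = J G" by (simp_all add: X_def Z_def J_def E_def \<phi>_def)
  have FELF: "function_elements \<Gamma> r \<delta> (\<lambda>s w. L w * F s w)" and FELG: "function_elements \<Gamma> r \<delta> (\<lambda>s w. L w * G s w)"
    by (intro function_elements_mult FEL F G)+
  have c: "function_elements \<Gamma> r \<delta> (\<lambda>s w. c * \<psi> s w)" if "function_elements \<Gamma> r \<delta> \<psi>" for c \<psi>
    by (intro function_elements_mult that fixed holomorphic_intros)

  \<comment> \<open>The primitive \<open>F\<close> turns the integral with weight
    \<open>L * F\<close> into that of \<open>F'\<close>, which is \<open>X z\<close>.\<close>
  have "J (\<lambda>s w. \<phi> s w + (- 1) * (L w * F s w)) = 0"
  proof (rule J_primitive[OF F closed(3)])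
    fix s :: real and w assume s: "s \<in> {0..1}" "w \<in> ?D s"
    show "\<exists>T'. (F s has_field_derivative T') (at w) \<and> T' - L w * F s w = \<phi> s w + (- 1) * (L w * F s w)"
      using DF[OF s] by auto
  qed
  then have JF: "J (\<lambda>s w. L w * F s w) = X z"
    unfolding J_add[OF FE\<phi> c[OF FELF]] J_cmult[OF FELF] XZ by simp

  \<comment> \<open>Only \<open>L * G\<close> keeps a pole at \<open>w = z\<close>, and its factor
    \<open>Q z\<close> leaves the integral.\<close>
  have "J (\<lambda>s w. Q z * (L w * G s w) + ((- m21 z) * \<phi> s w + (- m22 z) * G s w)) = 0"
  proof (rule J_primitive[of "\<lambda>s w. A z w * F s w + (- Q w) * G s w"])
    show "function_elements \<Gamma> r \<delta> (\<lambda>s w. A z w * F s w + (- Q w) * G s w)"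
      unfolding A_def Q_def by (intro function_elements_add function_elements_mult F G fixed holomorphic_intros)
    show "A z q0 * F 1 q0 + (- Q q0) * G 1 q0 = A z q0 * F 0 q0 + (- Q q0) * G 0 q0" by (simp add: closed)
    fix s :: real and w assume s: "s \<in> {0..1}" "w \<in> ?D s"
    define G' where "G' = - (R w / Q w) * F s w + - (p w + \<mu>) * G s w"
    define T' where "T' = (A' w * F s w + \<phi> s w * A z w) + ((- Q' w) * G s w + G' * (- Q w))"
    have "((\<lambda>w. A z w * F s w + (- Q w) * G s w) has_field_derivative T') (at w)"
      unfolding T'_def G'_def
      by (intro DERIV_add DERIV_mult DERIV_minus A_derivative Q_derivative DF[OF s] DG[OF s])
    moreover have "T' - L w * (A z w * F s w + (- Q w) * G s w)
        = Q z * (L w * G s w) + ((- m21 z) * \<phi> s w + (- m22 z) * G s w)"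
    proof -
      have "A' w * F s w + A z w * \<phi> s w - (Q' w * G s w + Q w * G') - \<kappa> / (z - w) * (A z w * F s w - Q w * G s w)
         = \<kappa> * Q z * G s w / (z - w) - m21 z * \<phi> s w - m22 z * G s w"
        by (rule primitive_identity[OF w[OF s]]) (simp_all add: \<phi>_def G'_def algebra_simps)
      then show ?thesis by (simp add: T'_def L_def algebra_simps)
    qed
    ultimately show "\<exists>T'. ((\<lambda>w. A z w * F s w + (- Q w) * G s w) has_field_derivative T') (at w) \<and>
        T' - L w * (A z w * F s w + (- Q w) * G s w) = Q z * (L w * G s w) + ((- m21 z) * \<phi> s w + (- m22 z) * G s w)"
      by blast
  qed
  then have "Q z * J (\<lambda>s w. L w * G s w) + ((- m21 z) * X z + (- m22 z) * Z z) = 0"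
    unfolding J_add[OF c[OF FELG] function_elements_add[OF c[OF FE\<phi>] c[OF G]]] J_add[OF c[OF FE\<phi>] c[OF G]]
      J_cmult[OF FELG] J_cmult[OF FE\<phi>] J_cmult[OF G] XZ .
  then have QZ: "Q z * J (\<lambda>s w. L w * G s w) = m21 z * X z + m22 z * Z z"
    by algebra
  then have Z': "J (\<lambda>s w. L w * G s w) = (m21 z * X z + m22 z * Z z) / Q z"
    using Qz by (simp add: field_simps)
  show "(Z has_field_derivative (m21 z * X z + m22 z * Z z) / Q z) (at z)"
    using J_deriv[OF G] unfolding Z' by (simp add: Z_def)

  \<comment> \<open>Splitting w - lam as (z - lam) - (z - w), where \<open>L\<close> times z - w is
    \<kappa>, leaves only integrals already known.\<close>
  have "J (\<lambda>s w. L w * \<phi> s w) = J (\<lambda>s w. \<mu> * (L w * F s w) + ((z - lam) * (L w * G s w) + (- \<kappa>) * G s w))"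
  proof (rule J_cong)
    fix s :: real and w' assume s: "s \<in> {0..1}" "w' \<in> ?D s"
    have \<kappa>_eq: "\<kappa> = L w' * (z - w')" using w[OF s] by (auto simp: L_def)
    show "L w' * \<phi> s w' = \<mu> * (L w' * F s w') + ((z - lam) * (L w' * G s w') + (- \<kappa>) * G s w')"
      unfolding \<phi>_def \<kappa>_eq by (simp add: algebra_simps)
  qed
  also have "\<dots> = \<mu> * X z + ((z - lam) * J (\<lambda>s w. L w * G s w) + (- \<kappa>) * Z z)"
    unfolding J_add[OF c[OF FELF] function_elements_add[OF c[OF FELG] c[OF G]]] J_add[OF c[OF FELG] c[OF G]]
      J_cmult[OF FELF] J_cmult[OF FELG] J_cmult[OF G] JF XZ(2) ..
  finally have "Q z * J (\<lambda>s w. L w * \<phi> s w) = m11 z * X z + m12 z * Z z"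
    using QZ unfolding m11_eq m12_eq by algebra
  then have "J (\<lambda>s w. L w * \<phi> s w) = (m11 z * X z + m12 z * Z z) / Q z"
    using Qz by (simp add: field_simps)
  then show "(X has_field_derivative (m11 z * X z + m12 z * Z z) / Q z) (at z)"
    using J_deriv[OF FE\<phi>] by (simp add: X_def \<phi>_def)
qed

end

text \<open>The power is continued as a solution of \<zeta> \<Phi>' = \<kappa> \<Phi>, so the theory
  of linear systems applies and no logarithm has to be followed along the contour.\<close>

lemma power_continuation:
  assumes hom: "homotopic_paths (- {z0}) \<Gamma> (linepath q q)"
    and W: "open W" "z0 - q \<in> W" "lg holomorphic_on W" "\<And>\<zeta>. \<zeta> \<in> W \<Longrightarrow> exp (lg \<zeta>) = \<zeta>"
  obtains \<rho> \<delta> \<Phi> r where "\<rho> > 0" "\<delta> > 0" "function_elements (\<lambda>s. z0 - \<Gamma> s) \<rho> \<delta> \<Phi>" "r > 0"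
    "\<And>s \<zeta>. s \<in> {0..1} \<Longrightarrow> \<zeta> \<in> ball (z0 - \<Gamma> s) \<rho> \<Longrightarrow> (\<Phi> s has_field_derivative \<kappa> / \<zeta> * \<Phi> s \<zeta>) (at \<zeta>)"
    "\<And>s. s \<in> {0..1} \<Longrightarrow> 0 \<notin> ball (z0 - \<Gamma> s) \<rho>"
    "\<And>\<zeta>. \<zeta> \<in> ball (z0 - q) \<rho> \<Longrightarrow> \<Phi> 1 \<zeta> = \<Phi> 0 \<zeta>"
    "\<And>\<zeta>. \<zeta> \<in> ball (z0 - q) r \<Longrightarrow> \<Phi> 0 \<zeta> = exp (\<kappa> * lg \<zeta>)"
proof -
  \<comment> \<open>A scalar equation, padded by a second unknown that is constant.\<close>
  interpret power: linear_system "- {0}" "\<lambda>\<zeta>. \<kappa> / \<zeta>" "\<lambda>_. 0" "\<lambda>_. 0" "\<lambda>_. 0"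
    by standard (auto intro!: holomorphic_intros)
  have ends: "\<Gamma> 0 = q" "\<Gamma> 1 = q"
    using homotopic_paths_imp_pathstart[OF hom] homotopic_paths_imp_pathfinish[OF hom]
    by (auto simp: pathstart_def pathfinish_def linepath_def)
  have "homotopic_paths (- {0}) ((\<lambda>w. z0 - w) \<circ> \<Gamma>) ((\<lambda>w. z0 - w) \<circ> linepath q q)"
    by (rule homotopic_paths_continuous_image[OF hom]) (auto intro!: continuous_intros)
  then have hom': "homotopic_paths (- {0}) (\<lambda>s. z0 - \<Gamma> s) (linepath (z0 - q) (z0 - q))"
    by (simp add: o_def linepath_refl)
  obtain \<rho> \<delta> \<Phi> \<Psi> where \<rho>: "\<rho> > 0" "\<delta> > 0"
    and sub: "\<And>s. s \<in> {0..1} \<Longrightarrow> ball (z0 - \<Gamma> s) \<rho> \<subseteq> - {0}"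
    and sol: "\<And>s. s \<in> {0..1} \<Longrightarrow> power.solves (ball (z0 - \<Gamma> s) \<rho>) (\<Phi> s) (\<Psi> s)"
    and FE: "function_elements (\<lambda>s. z0 - \<Gamma> s) \<rho> \<delta> \<Phi>" "function_elements (\<lambda>s. z0 - \<Gamma> s) \<rho> \<delta> \<Psi>"
    and init: "\<Phi> 0 (z0 - q) = exp (\<kappa> * lg (z0 - q))" "\<Psi> 0 (z0 - q) = 0"
      "\<Phi> 1 (z0 - q) = exp (\<kappa> * lg (z0 - q))" "\<Psi> 1 (z0 - q) = 0"
    by (rule power.null_homotopic_loop_solutions[OF hom', of "exp (\<kappa> * lg (z0 - q))" 0]) blast
  have sub0: "ball (z0 - q) \<rho> \<subseteq> - {0}" and sol0: "power.solves (ball (z0 - q) \<rho>) (\<Phi> 0) (\<Psi> 0)"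
    and sol1: "power.solves (ball (z0 - q) \<rho>) (\<Phi> 1) (\<Psi> 1)"
    using sub[of 0] sol[of 0] sol[of 1] ends by simp_all
  obtain r0 where r0: "r0 > 0" "ball (z0 - q) r0 \<subseteq> W"
    using openE[OF W(1,2)] by blast
  define r where "r = min r0 \<rho>"
  have r: "r > 0" "ball (z0 - q) r \<subseteq> W" "ball (z0 - q) r \<subseteq> ball (z0 - q) \<rho>"
    using r0 \<rho>(1) by (auto simp: r_def)
  have solW: "power.solves (ball (z0 - q) r) (\<lambda>\<zeta>. exp (\<kappa> * lg \<zeta>)) (\<lambda>_. 0)"
    unfolding power.solves_def using r(2) DERIV_power_solution[OF W(1,3,4)] by (auto simp: subset_iff)
  show ?thesis
  proof (rule that[OF \<rho> FE(1) r(1)])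
    show "(\<Phi> s has_field_derivative \<kappa> / \<zeta> * \<Phi> s \<zeta>) (at \<zeta>)" if "s \<in> {0..1}" "\<zeta> \<in> ball (z0 - \<Gamma> s) \<rho>" for s \<zeta>
      using conjunct1[OF bspec[OF sol[OF that(1), unfolded power.solves_def] that(2)]] by simp
    show "0 \<notin> ball (z0 - \<Gamma> s) \<rho>" if "s \<in> {0..1}" for s using sub[OF that] by blast
    \<comment> \<open>Agreement on a disc, not just at \<open>z0 - q\<close>, is wanted because
      \<open>z\<close> will move while the contour stays.\<close>
    show "\<Phi> 1 \<zeta> = \<Phi> 0 \<zeta>" if "\<zeta> \<in> ball (z0 - q) \<rho>" for \<zeta>
      by (rule power.solves_unique(1)[OF sub0 sub0 sol1 sol0, of "z0 - q"]) (use that \<rho> init in auto)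
    show "\<Phi> 0 \<zeta> = exp (\<kappa> * lg \<zeta>)" if "\<zeta> \<in> ball (z0 - q) r" for \<zeta>
      by (rule power.solves_unique(1)[OF sub0 subset_trans[OF r(3) sub0] sol0 solW, of "z0 - q"])
        (use that \<rho> r init in auto)
  qed
qed

lemma satisfies_DY_at_cong:
  assumes "\<forall>\<^sub>F x in nhds z. Y x = Y' x" and "satisfies_DY_at t \<theta>0 \<theta>1 \<theta>t \<theta>inf lam \<mu> k Y z"
  shows "satisfies_DY_at t \<theta>0 \<theta>1 \<theta>t \<theta>inf lam \<mu> k Y' z"
  unfolding satisfies_DY_at_def
proof
  fix i :: 2
  have "Y z = Y' z" using assms(1) by (rule eventually_nhds_x_imp_x)
  moreover have "((\<lambda>x. Y x $ i) has_field_derivative (DY_matrix t \<theta>0 \<theta>1 \<theta>t \<theta>inf lam \<mu> k z *v Y z) $ i) (at z)"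
    using assms(2) by (simp add: satisfies_DY_at_def)
  moreover have "\<forall>\<^sub>F x in nhds z. Y x $ i = Y' x $ i"
    using assms(1) by eventually_elim simp
  ultimately show "((\<lambda>x. Y' x $ i) has_field_derivative (DY_matrix t \<theta>0 \<theta>1 \<theta>t \<theta>inf lam \<mu> k z *v Y' z) $ i) (at z)"
    by (simp add: DERIV_cong_ev[OF refl _ refl, where f = "\<lambda>x. Y x $ i" and g = "\<lambda>x. Y' x $ i"])
qed

text \<open>The contour is chosen for \<open>z0\<close> and kept while \<open>z\<close> moves
  nearby, which gives the derivative in \<open>z\<close> its meaning. Another logarithm near
  \<open>z0 - b\<close> only multiplies both transforms by a common constant.\<close>

theorem theorem1:
  fixes t \<theta>0 \<theta>1 \<theta>t \<theta>inf lam \<mu> k \<kappa>1 \<kappa>2 lam' \<mu>' z0 b :: complex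
    and y1 lg :: "complex \<Rightarrow> complex"
    and V W :: "complex set"
    and \<gamma>z \<gamma>p :: "real \<Rightarrow> complex"
  defines "\<kappa>1 \<equiv> kappa1 \<theta>0 \<theta>1 \<theta>t \<theta>inf"
    and "\<kappa>2 \<equiv> kappa2 \<theta>0 \<theta>1 \<theta>t \<theta>inf"
    and "lam' \<equiv> lam_tilde t \<theta>0 \<theta>1 \<theta>t \<theta>inf lam \<mu>"
    and "\<mu>' \<equiv> mu_tilde t \<theta>0 \<theta>1 \<theta>t \<theta>inf lam \<mu>"
  assumes "t \<notin> {0, 1}" and "lam \<notin> {0, 1, t}" and "k \<noteq> 0"
    and "\<kappa>1 \<noteq> 0" and "\<kappa>2 \<noteq> 0" and "\<theta>inf \<noteq> 0"
    and "\<mu> - \<theta>0 / lam - \<theta>1 / (lam - 1) - \<theta>t / (lam - t) \<noteq> 0"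
    and "lam' \<notin> {0, 1, t}"
    and z0: "z0 \<notin> {0, 1, t}"
    and b: "b \<notin> {0, 1, t, z0}"
    and y1: "open V" "b \<in> V" "solves_Dy1_on t \<theta>0 \<theta>1 \<theta>t \<theta>inf lam \<mu> y1 V"
    and branch: "open W" "z0 - b \<in> W" "lg holomorphic_on W" "\<And>\<zeta>. \<zeta> \<in> W \<Longrightarrow> exp (lg \<zeta>) = \<zeta>"
    and \<gamma>z: "valid_path \<gamma>z" "turns_once_around (- {0, 1, t, z0}) b z0 \<gamma>z"
    and \<gamma>p: "valid_path \<gamma>p"
      "(\<exists>p\<in>{0, 1, t}. turns_once_around (- {0, 1, t, z0}) b p \<gamma>p) \<or>
       turns_once_around_infinity (- {0, 1, t, z0}) b \<gamma>p"
  shows "\<forall>\<^sub>F z in nhds z0.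
    satisfies_DY_at t (\<kappa>2 + \<theta>0) (\<kappa>2 + \<theta>1) (\<kappa>2 + \<theta>t) (\<kappa>2 + \<theta>inf) lam' \<mu>' k
      (\<lambda>x. vector
        [y1_tilde \<kappa>2 (pochhammer_contour \<gamma>z \<gamma>p) lg y1 x,
         y2_tilde t \<kappa>1 \<kappa>2 lam lam' \<mu> k (pochhammer_contour \<gamma>z \<gamma>p) lg y1 x]) z"
proof -
  interpret P: dy_parameters t \<theta>0 \<theta>1 \<theta>t \<kappa>2 lam \<mu>
    by standard (use assms(5,6) in auto)
  have \<theta>inf: "P.\<theta>inf = \<theta>inf"
    unfolding P.\<theta>inf_def P.\<sigma>_def by (simp add: \<kappa>2_def kappa2_def field_simps)
  have \<kappa>1: "P.\<kappa>1 = \<kappa>1" using P.kappa_eqs(1) by (simp add: \<theta>inf \<kappa>1_def)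
  have lam': "P.lam' = lam'"
    unfolding P.lam'_def P.\<nu>_def unfolding lam'_def lam_tilde_def \<kappa>2_def by (rule refl)
  have \<mu>': "P.\<mu>' = \<mu>'"
    unfolding P.\<mu>'_def lam' unfolding \<mu>'_def mu_tilde_def Let_def lam'_def \<kappa>2_def by (rule refl)
  have \<nu>: "P.\<nu> \<noteq> 0" using assms(11) by (simp add: P.\<nu>_def)

  define \<Gamma> where "\<Gamma> = pochhammer_contour \<gamma>z \<gamma>p"
  note lz = turns_once_around_loop[OF \<gamma>z(2)]
  have lp: "path \<gamma>p" "path_image \<gamma>p \<subseteq> - {0, 1, t, z0}" "pathstart \<gamma>p = b" "pathfinish \<gamma>p = b"
    using \<gamma>p(2) turns_once_around_loop[of _ b _ \<gamma>p] turns_once_around_infinity_loop[of _ b \<gamma>p] by blast+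
  note \<Gamma>_loop = pochhammer_contour_loop[OF \<gamma>z(1) lz(2-4) \<gamma>p(1) lp(2-4), folded \<Gamma>_def]
  have ends: "\<Gamma> 0 = b" "\<Gamma> 1 = b" using \<Gamma>_loop(3,4) by (simp_all add: pathstart_def pathfinish_def)
  have "homotopic_paths (- {0, 1, t}) \<gamma>z (linepath b b)"
    by (rule turns_once_around_null_homotopic[OF \<gamma>z(2)]) (use z0 in auto)
  then have hom1: "homotopic_paths (- {0, 1, t}) \<Gamma> (linepath b b)"
    unfolding \<Gamma>_def by (rule pochhammer_null_homotopic) (use lp in auto)
  \<comment> \<open>A loop around infinity may enclose \<open>z0\<close>, so
    \<open>\<gamma>p\<close> need not contract away from \<open>z0\<close>; the winding number of
    the commutator still vanishes.\<close>
  have "winding_number \<Gamma> z0 = 0"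
    unfolding \<Gamma>_def by (rule winding_number_pochhammer[OF \<gamma>z(1) _ lz(3,4) \<gamma>p(1) _ lp(3,4)]) (use lz(2) lp(2) in auto)
  moreover have "z0 \<notin> path_image \<Gamma>" using \<Gamma>_loop(2) by auto
  ultimately have hom2: "homotopic_paths (- {z0}) \<Gamma> (linepath b b)"
    using winding_number_homotopic_paths_null_explicit_eq[OF valid_path_imp_path[OF \<Gamma>_loop(1)]] \<Gamma>_loop(3) by simp

  obtain r v where r: "r > 0" "ball b r \<subseteq> - {0, 1, t}" and sol_b: "P.gauge.solves (ball b r) y1 v"
    using P.gauge_solution[OF y1(1,2) _ y1(3)[folded \<theta>inf]] b by blast
  obtain R1 \<delta>1 F G where R1: "R1 > 0" "\<delta>1 > 0"
    and sub1: "\<And>s. s \<in> {0..1} \<Longrightarrow> ball (\<Gamma> s) R1 \<subseteq> - {0, 1, t}"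
    and sol1: "\<And>s. s \<in> {0..1} \<Longrightarrow> P.gauge.solves (ball (\<Gamma> s) R1) (F s) (G s)"
    and FG1: "function_elements \<Gamma> R1 \<delta>1 F" "function_elements \<Gamma> R1 \<delta>1 G"
    and init: "F 0 b = y1 b" "G 0 b = v b" "F 1 b = y1 b" "G 1 b = v b"
    by (rule P.gauge.null_homotopic_loop_solutions[OF hom1, of "y1 b" "v b"]) blast
  obtain \<rho> \<delta>2 \<Phi> r2 where \<rho>: "\<rho> > 0" "\<delta>2 > 0" and FE\<Phi>: "function_elements (\<lambda>s. z0 - \<Gamma> s) \<rho> \<delta>2 \<Phi>" and r2: "r2 > 0"
    and D\<Phi>: "\<And>s \<zeta>. s \<in> {0..1} \<Longrightarrow> \<zeta> \<in> ball (z0 - \<Gamma> s) \<rho> \<Longrightarrow> (\<Phi> s has_field_derivative \<kappa>2 / \<zeta> * \<Phi> s \<zeta>) (at \<zeta>)"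
    and \<Phi>0: "\<And>s. s \<in> {0..1} \<Longrightarrow> 0 \<notin> ball (z0 - \<Gamma> s) \<rho>"
    and \<Phi>closed: "\<And>\<zeta>. \<zeta> \<in> ball (z0 - b) \<rho> \<Longrightarrow> \<Phi> 1 \<zeta> = \<Phi> 0 \<zeta>"
    and \<Phi>init: "\<And>\<zeta>. \<zeta> \<in> ball (z0 - b) r2 \<Longrightarrow> \<Phi> 0 \<zeta> = exp (\<kappa>2 * lg \<zeta>)"
    by (rule power_continuation[OF hom2 branch, where \<kappa> = \<kappa>2]) blast+

  \<comment> \<open>Half of \<open>\<rho>\<close>, because moving \<open>z\<close> and moving
    \<open>w\<close> each cost one \<open>R\<close>.\<close>
  define R where "R = min R1 (\<rho> / 2)"
  define \<delta> where "\<delta> = min \<delta>1 \<delta>2"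
  have R: "R > 0" "R \<le> R1" "2 * R \<le> \<rho>" and \<delta>: "\<delta> > 0" "\<delta> \<le> \<delta>1" "\<delta> \<le> \<delta>2"
    using R1 \<rho> by (auto simp: R_def \<delta>_def)
  have balls: "ball x R \<subseteq> ball x R1" "ball x (2 * R) \<subseteq> ball x \<rho>" for x :: complex
    using R by auto
  note F = function_elements_subset[OF FG1(1) R(2) \<delta>(2)] and G = function_elements_subset[OF FG1(2) R(2) \<delta>(2)]
    and \<Phi> = function_elements_subset[OF FE\<Phi> R(3) \<delta>(3)]
  obtain N where N: "fine_for \<Gamma> R \<delta> N"
    using fine_for_exists[OF valid_path_imp_path[OF \<Gamma>_loop(1)] R(1) \<delta>(1)] by blast
  define \<phi> where "\<phi> = (\<lambda>s w. \<mu> * F s w + (w - lam) * G s w)"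
  define X where "X = (\<lambda>z. polygon_integral \<Gamma> N (\<lambda>s w. \<phi> s w * \<Phi> s (z - w)))"
  define Z where "Z = (\<lambda>z. polygon_integral \<Gamma> N (\<lambda>s w. G s w * \<Phi> s (z - w)))"
  define C where "C = \<kappa>2 * lam * (lam - 1) * (lam - t) / (k * (lam - lam'))"
  have DY: "satisfies_DY_at t (\<kappa>2 + \<theta>0) (\<kappa>2 + \<theta>1) (\<kappa>2 + \<theta>t) (\<kappa>2 + \<theta>inf) lam' \<mu>' k
      (\<lambda>x. vector [X x, C * (- Z x + \<mu> / \<kappa>1 * X x)]) z"
    if z: "z \<in> ball z0 R" "z \<notin> {0, 1, t}" for z
  proof -
    have "(X has_field_derivative (P.m11 z * X z + P.m12 z * Z z) / P.Q z) (at z)"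
      and "(Z has_field_derivative (P.m21 z * X z + P.m22 z * Z z) / P.Q z) (at z)"
      unfolding X_def Z_def \<phi>_def
    proof -
      have s: "P.gauge.solves (ball (\<Gamma> s) R) (F s) (G s)" "ball (\<Gamma> s) R \<subseteq> - {0, 1, t}" if "s \<in> {0..1}" for s
        using P.gauge.solves_subset[OF sol1[OF that] balls(1)] subset_trans[OF balls(1) sub1[OF that]] by auto
      have k: "(\<Phi> s has_field_derivative \<kappa>2 / \<zeta> * \<Phi> s \<zeta>) (at \<zeta>)" if "s \<in> {0..1}" "\<zeta> \<in> ball (z0 - \<Gamma> s) (2 * R)" for s \<zeta>
        by (rule D\<Phi>[OF that(1) subsetD[OF balls(2) that(2)]])
      have k0: "0 \<notin> ball (z0 - \<Gamma> s) (2 * R)" if "s \<in> {0..1}" for s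
        using \<Phi>0[OF that] balls(2) by blast
      have kc: "\<Phi> 1 \<zeta> = \<Phi> 0 \<zeta>" if "\<zeta> \<in> ball (z0 - b) (2 * R)" for \<zeta>
        by (rule \<Phi>closed[OF subsetD[OF balls(2) that]])
      have c: "F 1 b = F 0 b" "G 1 b = G 0 b" using init by simp_all
      note cd = P.convolution_derivatives[OF s F G ends c \<Phi> k k0 kc N z]
      show "((\<lambda>z. polygon_integral \<Gamma> N (\<lambda>s w. (\<mu> * F s w + (w - lam) * G s w) * \<Phi> s (z - w))) has_field_derivative
        (P.m11 z * polygon_integral \<Gamma> N (\<lambda>s w. (\<mu> * F s w + (w - lam) * G s w) * \<Phi> s (z - w))
         + P.m12 z * polygon_integral \<Gamma> N (\<lambda>s w. G s w * \<Phi> s (z - w))) / P.Q z) (at z)"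
        by (rule cd(1))
      show "((\<lambda>z. polygon_integral \<Gamma> N (\<lambda>s w. G s w * \<Phi> s (z - w))) has_field_derivative
        (P.m21 z * polygon_integral \<Gamma> N (\<lambda>s w. (\<mu> * F s w + (w - lam) * G s w) * \<Phi> s (z - w))
         + P.m22 z * polygon_integral \<Gamma> N (\<lambda>s w. G s w * \<Phi> s (z - w))) / P.Q z) (at z)"
        by (rule cd(2))
    qed
    from P.satisfies_DY[OF \<nu> _ _ assms(9) assms(7) z(2) this] assms(8,12) show ?thesis
      unfolding \<theta>inf \<kappa>1 lam' \<mu>' C_def by blast
  qed

  \<comment> \<open>Half of \<open>r2\<close> is reserved for \<open>z\<close>, half for
    \<open>w\<close> near \<open>b\<close>; then \<open>z - w\<close> stays where
    \<open>\<Phi> 0\<close> is the given branch.\<close>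
  define \<epsilon> where "\<epsilon> = min R (r2 / 2)"
  have \<epsilon>: "\<epsilon> > 0" using R(1) r2 by (simp add: \<epsilon>_def)
  define U where "U = ball z0 \<epsilon> \<inter> - {0, 1, t}"
  have U: "open U" "z0 \<in> U"
    using z0 \<epsilon> unfolding U_def by (auto intro!: open_Int open_Compl finite_imp_closed)
  have Y: "y1_tilde \<kappa>2 \<Gamma> lg y1 z = X z" "y2_tilde t \<kappa>1 \<kappa>2 lam lam' \<mu> k \<Gamma> lg y1 z = C * (- Z z + \<mu> / \<kappa>1 * X z)"
    if "z \<in> U" for z
  proof -
    have z: "z \<in> ball z0 R" "z \<in> ball z0 (r2 / 2)" using that by (auto simp: U_def \<epsilon>_def)
    have FE\<phi>: "function_elements \<Gamma> R \<delta> \<phi>"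
      unfolding \<phi>_def
      by (intro function_elements_add function_elements_mult F G function_elements_fixed[OF _ subset_UNIV] holomorphic_intros)
    have FEE: "function_elements \<Gamma> R \<delta> (\<lambda>s w. \<Phi> s (z - w))" by (rule function_elements_reflect[OF \<Phi> z(1)])
    note FE1 = function_elements_mult[OF FE\<phi> FEE] and FE2 = function_elements_mult[OF G FEE]
    have const: "function_elements \<Gamma> R \<delta> (\<lambda>_ _. c)" for c :: complex
      by (rule function_elements_fixed[OF _ subset_UNIV]) (intro holomorphic_intros)
    have "\<forall>\<^sub>F w in nhds b. w \<in> ball b (min r (min R1 (r2 / 2)))"
      using r(1) R1(1) r2 by (intro eventually_nhds_in_open) auto
    then have near: "\<forall>\<^sub>F w in at b. w \<in> ball b (min r (min R1 (r2 / 2)))"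
      unfolding eventually_at_filter by (rule eventually_mono) simp
    have local: "\<phi> 0 w = deriv y1 w \<and> F 0 w = y1 w \<and> G 0 w = v w \<and> \<Phi> 0 (z - w) = exp (\<kappa>2 * lg (z - w))"
      if w: "w \<in> ball b (min r (min R1 (r2 / 2)))" for w
    proof -
      have wb: "w \<in> ball b r" "w \<in> ball b R1" "w \<in> ball b (r2 / 2)" using w by auto
      have sol0: "P.gauge.solves (ball b R1) (F 0) (G 0)" "ball b R1 \<subseteq> - {0, 1, t}"
        using sol1[of 0] sub1[of 0] ends by simp_all
      have FG: "F 0 w = y1 w" "G 0 w = v w"
        using P.gauge.solves_unique[OF sol0(2) r(2) sol0(1) sol_b, of b w] wb r(1) R1(1) init by auto
      have "(y1 has_field_derivative \<mu> * y1 w + (w - lam) * v w) (at w)"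
        by (rule conjunct1[OF bspec[OF sol_b[unfolded P.gauge.solves_def] wb(1)]])
      then have "\<phi> 0 w = deriv y1 w" by (simp add: \<phi>_def FG DERIV_imp_deriv)
      moreover have "z - w \<in> ball (z0 - b) r2"
      proof -
        have eq: "z0 - b - (z - w) = (z0 - z) - (b - w)" by simp
        show ?thesis unfolding mem_ball dist_norm eq
          using z(2) wb(3) norm_triangle_ineq4[of "z0 - z" "b - w"] by (simp add: dist_norm)
      qed
      ultimately show ?thesis using FG \<Phi>init by simp
    qed
    have "\<forall>\<^sub>F w in at (\<Gamma> 0). \<phi> 0 w * \<Phi> 0 (z - w) = deriv y1 w * exp (\<kappa>2 * lg (z - w))"
      unfolding ends using near by eventually_elim (use local in auto)
    from continued_contour_integral_eq[OF FE1 \<Gamma>_loop(1) N this]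
    show Y1: "y1_tilde \<kappa>2 \<Gamma> lg y1 z = X z" by (simp add: y1_tilde_def X_def)
    \<comment> \<open>The integrand divides by \<open>lam - w\<close> whereas \<open>G\<close>
      carries \<open>w - lam\<close>, hence the coefficient -1.\<close>
    let ?K = "\<lambda>s w. (- 1) * (G s w * \<Phi> s (z - w)) + \<mu> / \<kappa>1 * (\<phi> s w * \<Phi> s (z - w))"
    note FEm = function_elements_mult[OF const FE2] and FEp = function_elements_mult[OF const FE1]
    \<comment> \<open>If \<open>b = lam\<close>, the written integrand divides by zero at the base
      point itself; the punctured neighbourhood avoids this.\<close>
    have "\<forall>\<^sub>F w in at b. w \<noteq> lam" by (rule eventually_neq_at_within)
    with near have "\<forall>\<^sub>F w in at (\<Gamma> 0). ?K 0 w =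
       ((deriv y1 w - \<mu> * y1 w) * (1 / (lam - w)) + \<mu> / \<kappa>1 * deriv y1 w) * exp (\<kappa>2 * lg (z - w))"
      unfolding ends
    proof eventually_elim
      case (elim w)
      note L = local[OF elim(1)]
      have "deriv y1 w = \<mu> * y1 w + (w - lam) * v w" using L by (auto simp: \<phi>_def)
      then have "(deriv y1 w - \<mu> * y1 w) * (1 / (lam - w)) = (w - lam) * v w / (lam - w)" by simp
      also have "\<dots> = - v w" using elim(2) by (simp add: divide_eq_eq algebra_simps)
      finally have v: "(deriv y1 w - \<mu> * y1 w) * (1 / (lam - w)) = - v w" .
      show ?case unfolding v using L by (simp add: algebra_simps)
    qed
    from continued_contour_integral_eq[OF function_elements_add[OF FEm FEp] \<Gamma>_loop(1) N this]
    show "y2_tilde t \<kappa>1 \<kappa>2 lam lam' \<mu> k \<Gamma> lg y1 z = C * (- Z z + \<mu> / \<kappa>1 * X z)"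
      unfolding polygon_integral_add[OF FEm FEp N] polygon_integral_cmult[OF FE1 N] polygon_integral_cmult[OF FE2 N]
      by (simp add: y2_tilde_def C_def X_def Z_def)
  qed
  have "\<forall>\<^sub>F z in nhds z0. z \<in> U" using U by (rule eventually_nhds_in_open)
  then show ?thesis
  proof eventually_elim
    case (elim z)
    have "\<forall>\<^sub>F x in nhds z. x \<in> U" using U(1) elim by (rule eventually_nhds_in_open)
    then have "\<forall>\<^sub>F x in nhds z. vector [X x, C * (- Z x + \<mu> / \<kappa>1 * X x)] =
       (vector [y1_tilde \<kappa>2 \<Gamma> lg y1 x, y2_tilde t \<kappa>1 \<kappa>2 lam lam' \<mu> k \<Gamma> lg y1 x] :: complex ^ 2)"
      by eventually_elim (simp add: Y)
    then show ?case
      unfolding \<Gamma>_def[symmetric] by (rule satisfies_DY_at_cong) (use DY elim in \<open>auto simp: U_def \<epsilon>_def\<close>)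
  qed
qed

end
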